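(* Let $\Xi=[\boldsymbol\xi_1\ \cdots\ \boldsymbol\xi_n]$ be a real $s\times n$ matrix of rank $s$ with nonzero columns (so that the box spline $M_\Xi$ is non-degenerate). Then, as an equality of distributions on $\mathbb{R}^s$, $$M_\Xi(\boldsymbol x)=\sum_{(b,\boldsymbol p)\in S_\Xi}\ \sum_{(c,\boldsymbol\alpha)\in P_{n-s}}\frac{b\,c}{|\det\Xi_\alpha|}\,[\![\,\Xi_\alpha^{-1}(\boldsymbol x-\boldsymbol p)\,]\!]_+^{\boldsymbol\mu_\alpha-\boldsymbol 1}.$$
   Context: Box spline: $M_{[\,]}:=\delta$ (Dirac delta distribution on $\mathbb{R}^s$) and $M_\Xi:=\int_0^1 M_{\Xi\setminus\boldsymbol\zeta}(\cdot-t\boldsymbol\zeta)\,dt$, where $\boldsymbol\zeta$ is any column of $\Xi$ and $\Xi\setminus\boldsymbol\zeta$ is $\Xi$ with that column removed. Thus $\langle M_\Xi,\varphi\rangle=\int_{[0,1]^n}\varphi(\Xi\boldsymbol t)\,d\boldsymbol t$. Multiset $S_\Xi$ (pairs of a scalar and a vector in $\mathbb{R}^s$): $S_{[\,]}:=\{(1,\boldsymbol 0)\}$ and $S_\Xi:=\{(-c,\boldsymbol\xi+\boldsymbol p):(c,\boldsymbol p)\in S_{\Xi\setminus\boldsymbol\xi}\}\cup S_{\Xi\setminus\boldsymbol\xi}$ (multiset union, multiplicities added), where $\boldsymbol\xi$ is any column of $\Xi$. Kernel matrices: for a matrix $X$, $\ker X$ denotes a fixed matrix whose columns form a basis of the null-space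 of $X$ and which is in column echelon form (the row index of the first nonzero entry of each column strictly increases from left to right). So $\ker\Xi$ is $n\times(n-s)$. For an $n$-dimensional vector $\boldsymbol\alpha$ of nonnegative integers, $\|\boldsymbol\alpha\|_0$ is the number of nonzero entries, and $\Xi_\alpha$ is the $s\times\|\boldsymbol\alpha\|_0$ matrix of the columns $\boldsymbol\xi_j$ (in order) with $\alpha(j)\neq0$. Vectors $\boldsymbol\nu_\alpha$: suppose $s<\|\boldsymbol\alpha\|_0\le n$. If $\|\boldsymbol\alpha\|_0=n$, $\boldsymbol\nu_\alpha$ is the first column of $\ker\Xi$. Otherwise let $C_\alpha$ be the $(n-\|\boldsymbol\alpha\|_0)\times(n-s)$ matrix consisting of those rows $j$ of $\ker\Xi$ with $\alpha(j)=0$, let $\boldsymbol t_\alpha$ be the first column of $\ker C_\alpha$, and put $\boldsymbol\nu_\alpha:=(\ker\Xi)\,\boldsymbol t_\alpha$. Put $m_\alpha:=\min\{i:\nu_\alpha(i)\ne0\}$. Multisets $P_k$, $0\le k\le n-s$ (pairs of a real scalar and an $n$-dimensional integer vector): $P_0:=\{(1,\boldsymbol 1)\}$ and $$P_k:=\Big\{\Big(-c\,\tfrac{\nu_\alpha(j)}{\nu_\alpha(m_\alpha)},\ \boldsymbol r_j(\boldsymbol\alpha)\Big):(c,\boldsymbol\alpha)\in P_{k-1},\ m_\alpha<j\le n,\ \nu_\alpha(j)\ne0\Big\},$$ where $\boldsymbol r_j(\boldsymbol\alpha)$ is obtained from $\boldsymbol\alpha$ by increasing entry $m_\alpha$ by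 $1$ and decreasing entry $j$ by $1$. For $\|\boldsymbol\alpha\|_0=s$, $\boldsymbol\mu_\alpha$ is the $s$-dimensional vector of the nonzero entries of $\boldsymbol\alpha$ (in order). One-sided normalized power: for $\boldsymbol y\in\mathbb{R}^s$ and a nonnegative integer vector $\boldsymbol\beta$, $[\![\boldsymbol y]\!]_+^{\boldsymbol\beta}:=\prod_{j=1}^s\frac{y(j)^{\beta(j)}H(y(j))}{\beta(j)!}$ with $H$ the Heaviside function. $\boldsymbol 0,\boldsymbol 1$ are the all-zeros and all-ones vectors. *)

theory Defs
  imports
    "HOL-Analysis.Analysis"
    "HOL-Library.Multiset"
    "Jordan_Normal_Form.Matrix_Kernel"
    "Jordan_Normal_Form.DL_Rank"
    "Jordan_Normal_Form.DL_Submatrix"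
    "Jordan_Normal_Form.Gauss_Jordan_Elimination"
begin

unbundle no vec_syntax

hide_const (open) Finite_Cartesian_Product.vec Finite_Cartesian_Product.mat
  Determinants.det Cartesian_Space.rank Finite_Cartesian_Product.row

text \<open>
  Matrices and vectors whose sizes vary are those of \<open>Jordan_Normal_Form\<close>, with rows, columns and
  entries numbered from 0. Test functions live on the Euclidean space \<open>real ^ 's\<close>, whose
  coordinates are listed in the order of the index type; so \<open>s\<close> is \<open>CARD('s)\<close>.
\<close>

definition to_cart :: "real vec \<Rightarrow> real ^ 's :: {finite, linorder}" where
  "to_cart v = vec_lambda (\<lambda>i. v $ card {j. j < i})"

definition of_cart :: "real ^ 's :: {finite, linorder} \<Rightarrow> real vec" where
  "of_cart x = vec CARD('s) (\<lambda>k. vec_nth x (sorted_list_of_set (UNIV :: 's set) ! k))"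

lemma card_less_sorted_list_of_set_nth:
  assumes "k < CARD('s :: {finite, linorder})"
  shows "card {j. j < sorted_list_of_set (UNIV :: 's set) ! k} = k"
proof -
  define xs where "xs = sorted_list_of_set (UNIV :: 's set)"
  have xs: "sorted_wrt (<) xs" "set xs = UNIV" "length xs = CARD('s)" "distinct xs"
    by (simp_all add: xs_def)
  have mono: "xs ! i < xs ! j \<longleftrightarrow> i < j" if "i < CARD('s)" "j < CARD('s)" for i j
    using that xs sorted_wrt_nth_less[OF xs(1)] by (metis linorder_neqE_nat order_less_asym order_less_irrefl)
  have "{j. j < xs ! k} = (!) xs ` {..<k}"
  proof (intro Set.set_eqI iffI)
    fix j assume "j \<in> {j. j < xs ! k}"
    moreover obtain i where "i < CARD('s)" "j = xs ! i"
      using xs by (metis UNIV_I in_set_conv_nth)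
    ultimately show "j \<in> (!) xs ` {..<k}" using mono assms by auto
  qed (use mono assms in auto)
  moreover have "inj_on ((!) xs) {..<k}"
    using xs assms by (auto simp: inj_on_def nth_eq_iff_index_eq)
  ultimately show ?thesis by (simp add: card_image xs_def)
qed

lemma of_cart_to_cart:
  assumes "v \<in> carrier_vec CARD('s)"
  shows "of_cart (to_cart v :: real ^ 's :: {finite, linorder}) = v"
  using assms by (intro eq_vecI) (auto simp: of_cart_def to_cart_def card_less_sorted_list_of_set_nth)

lemma to_cart_of_cart: "to_cart (of_cart x) = (x :: real ^ 's :: {finite, linorder})"
proof -
  define xs where "xs = sorted_list_of_set (UNIV :: 's set)"
  have xs: "set xs = UNIV" "length xs = CARD('s)" by (simp_all add: xs_def)
  have "vec_nth (to_cart (of_cart x)) i = vec_nth x i" for i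
  proof -
    obtain k where "k < CARD('s)" "i = xs ! k"
      using xs by (metis UNIV_I in_set_conv_nth)
    then show ?thesis
      by (simp add: to_cart_def of_cart_def xs_def card_less_sorted_list_of_set_nth)
  qed
  then show ?thesis by (simp add: Finite_Cartesian_Product.vec_eq_iff)
qed


section \<open>Distributions\<close>

primrec Ck :: "nat \<Rightarrow> ('a :: euclidean_space \<Rightarrow> real) \<Rightarrow> bool" where
  "Ck 0 f \<longleftrightarrow> continuous_on UNIV f"
| "Ck (Suc k) f \<longleftrightarrow>
    (\<forall>x. f differentiable at x) \<and> (\<forall>i\<in>Basis. Ck k (\<lambda>x. frechet_derivative f (at x) i))"

definition test_function :: "('a :: euclidean_space \<Rightarrow> real) \<Rightarrow> bool" where
  "test_function \<phi> \<longleftrightarrow> (\<forall>k. Ck k \<phi>) \<and> compact (closure {x. \<phi> x \<noteq> 0})"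

definition locally_integrable :: "('a :: euclidean_space \<Rightarrow> real) \<Rightarrow> bool" where
  "locally_integrable f \<longleftrightarrow> (\<forall>K. compact K \<longrightarrow> set_integrable lborel K f)"

text \<open>
  A distribution \<open>T\<close> is given by its pairing with (real-valued) test functions. The equality of
  \<open>T\<close> with the regular distribution of a function \<open>f\<close> presupposes that \<open>f\<close> is locally integrable.
\<close>

definition eq_regular_distribution ::
    "(('a :: euclidean_space \<Rightarrow> real) \<Rightarrow> real) \<Rightarrow> ('a \<Rightarrow> real) \<Rightarrow> bool" where
  "eq_regular_distribution T f \<longleftrightarrow>
    locally_integrable f \<and> (\<forall>\<phi>. test_function \<phi> \<longrightarrow> T \<phi> = (\<integral>x. f x * \<phi> x \<partial>lborel))"


section \<open>Box splines\<close>

text \<open>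
  The recursions for the box spline and for \<open>S\<close> may remove any column; here it is always the first
  one. Pairing the translate of a distribution by \<open>t\<zeta>\<close> with \<open>\<phi>\<close> is pairing the distribution with
  \<open>\<lambda>x. \<phi> (x + t\<zeta>)\<close>.
\<close>

primrec box_spline_cols :: "real vec list \<Rightarrow> (real ^ 's :: {finite, linorder} \<Rightarrow> real) \<Rightarrow> real" where
  "box_spline_cols [] \<phi> = \<phi> 0"
| "box_spline_cols (\<zeta> # Z) \<phi> =
    integral {0..1} (\<lambda>t. box_spline_cols Z (\<lambda>x. \<phi> (x + t *\<^sub>R to_cart \<zeta>)))"

definition box_spline :: "real mat \<Rightarrow> (real ^ 's :: {finite, linorder} \<Rightarrow> real) \<Rightarrow> real" where
  "box_spline \<Xi> = box_spline_cols (cols \<Xi>)"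

primrec S_cols :: "nat \<Rightarrow> real vec list \<Rightarrow> (real \<times> real vec) multiset" where
  "S_cols s [] = {#(1, 0\<^sub>v s)#}"
| "S_cols s (\<xi> # Z) = image_mset (\<lambda>(c, p). (- c, \<xi> + p)) (S_cols s Z) + S_cols s Z"

definition S_mset :: "real mat \<Rightarrow> (real \<times> real vec) multiset" where
  "S_mset \<Xi> = S_cols (dim_row \<Xi>) (cols \<Xi>)"


section \<open>Kernel matrices\<close>

definition first_nonzero :: "'a :: zero vec \<Rightarrow> nat" where
  "first_nonzero v = (LEAST i. i < dim_vec v \<and> v $ i \<noteq> 0)"

definition column_echelon_form :: "'a :: zero mat \<Rightarrow> bool" where
  "column_echelon_form K \<longleftrightarrow>
    (\<forall>j k. j < k \<and> k < dim_col K \<longrightarrow> first_nonzero (col K j) < first_nonzero (col K k))"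

definition kernel_matrix :: "real mat \<Rightarrow> real mat \<Rightarrow> bool" where
  "kernel_matrix X K \<longleftrightarrow>
    dim_row K = dim_col X \<and> distinct (cols K) \<and>
    kernel.basis (dim_col X) X (set (cols K)) \<and>
    column_echelon_form K"


section \<open>The multisets \<open>P\<^sub>k\<close>\<close>

definition supp :: "nat vec \<Rightarrow> nat set" where
  "supp \<alpha> = {j. j < dim_vec \<alpha> \<and> \<alpha> $ j \<noteq> 0}"

definition zero_set :: "nat vec \<Rightarrow> nat set" where
  "zero_set \<alpha> = {j. j < dim_vec \<alpha> \<and> \<alpha> $ j = 0}"

definition norm0 :: "nat vec \<Rightarrow> nat" where
  "norm0 \<alpha> = card (supp \<alpha>)"

definition ones :: "nat \<Rightarrow> nat vec" where
  "ones n = vec n (\<lambda>_. 1)"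

definition sub_cols :: "real mat \<Rightarrow> nat vec \<Rightarrow> real mat" where
  "sub_cols \<Xi> \<alpha> = submatrix \<Xi> UNIV (supp \<alpha>)"

text \<open>
  The argument \<open>ker\<close> below is the fixed choice of kernel matrices. Column 0 of a kernel matrix
  exists in the cases that matter, namely when \<open>dim_row \<Xi> < norm0 \<alpha>\<close>.
\<close>

definition \<nu> :: "(real mat \<Rightarrow> real mat) \<Rightarrow> real mat \<Rightarrow> nat vec \<Rightarrow> real vec" where
  "\<nu> ker \<Xi> \<alpha> =
    (if norm0 \<alpha> = dim_col \<Xi> then col (ker \<Xi>) 0
     else let C = submatrix (ker \<Xi>) (zero_set \<alpha>) UNIV; t = col (ker C) 0
          in ker \<Xi> *\<^sub>v t)"

text \<open>
  Entries of \<open>\<alpha>\<close> are natural numbers; the decrease of entry \<open>j\<close> is only used where \<open>\<nu>\<close> does not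
  vanish, hence where \<open>\<alpha>\<close> is positive.
\<close>

definition shift_entry :: "nat \<Rightarrow> nat \<Rightarrow> nat vec \<Rightarrow> nat vec" where
  "shift_entry m j \<alpha> = vec (dim_vec \<alpha>)
    (\<lambda>i. if i = m then \<alpha> $ i + 1 else if i = j then \<alpha> $ i - 1 else \<alpha> $ i)"

definition P_step ::
    "(real mat \<Rightarrow> real mat) \<Rightarrow> real mat \<Rightarrow> real \<times> nat vec \<Rightarrow> (real \<times> nat vec) multiset" where
  "P_step ker \<Xi> = (\<lambda>(c, \<alpha>).
    let v = \<nu> ker \<Xi> \<alpha>; m = first_nonzero v
    in {# (- c * (v $ j / v $ m), shift_entry m j \<alpha>).
          j \<in># mset_set {j. m < j \<and> j < dim_col \<Xi> \<and> v $ j \<noteq> 0} #})"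

primrec P_mset ::
    "(real mat \<Rightarrow> real mat) \<Rightarrow> real mat \<Rightarrow> nat \<Rightarrow> (real \<times> nat vec) multiset" where
  "P_mset ker \<Xi> 0 = {#(1, ones (dim_col \<Xi>))#}"
| "P_mset ker \<Xi> (Suc k) = (\<Sum>q\<in>#P_mset ker \<Xi> k. P_step ker \<Xi> q)"

definition \<mu> :: "nat vec \<Rightarrow> nat vec" where
  "\<mu> \<alpha> = vec_of_list (filter (\<lambda>a. a \<noteq> 0) (list_of_vec \<alpha>))"


section \<open>One-sided powers\<close>

text \<open>The value at 0 is immaterial for the distributions considered here.\<close>

definition heaviside :: "real \<Rightarrow> real" where
  "heaviside t = (if t \<ge> 0 then 1 else 0)"

definition one_sided_power :: "real vec \<Rightarrow> nat vec \<Rightarrow> real" where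
  "one_sided_power y \<beta> =
    (\<Prod>j<dim_vec y. y $ j ^ (\<beta> $ j) * heaviside (y $ j) / fact (\<beta> $ j))"

end

theory Submission
  imports Defs
begin

text \<open>
  Write \<open>D\<^sub>j\<close> for the derivative along the column \<open>\<xi>\<^sub>j\<close>, and for a nonnegative integer vector \<open>\<alpha>\<close> whose
  support selects linearly independent columns let \<open>E\<^sub>\<alpha>\<close> be the distribution that integrates
  \<open>\<phi> (\<Sum>\<^sub>j t\<^sub>j \<xi>\<^sub>j)\<close> against the one-sided powers \<open>t\<^sub>j\<^bsup>\<alpha>\<^sub>j - 1\<^esup> / (\<alpha>\<^sub>j - 1)!\<close>, \<open>t\<^sub>j \<ge> 0\<close>,
  over the \<open>j\<close> with \<open>\<alpha>\<^sub>j \<noteq> 0\<close> (\<open>cone_pairing\<close>). Integration by parts in one variable says that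
  \<open>D\<^sub>m E\<^bsub>\<alpha> + e\<^sub>m\<^esub> = E\<^sub>\<alpha>\<close>, where \<open>E\<^sub>0\<close> is the Dirac distribution (\<open>cone_pairing_dir_deriv\<close>). If the
  support of \<open>\<alpha>\<close> has \<open>s\<close> elements, then a linear change of variables turns \<open>E\<^sub>\<alpha>\<close> into the function
  of the theorem, divided by the determinant (\<open>cone_pairing_eq_integral\<close>).

  The average of a function over the segments \<open>x + [0,1] \<xi>\<^sub>j\<close> has as derivative along \<open>\<xi>\<^sub>j\<close> a difference.
  Averaging along all the columns and evaluating at 0 is the box spline, and the product of all the
  difference operators is the sum over \<open>S\<close>. Hence the theorem follows once
  \<open>F = \<Sum>\<^bsub>(c, \<alpha>)\<^esub> c E\<^sub>\<alpha>\<close>, the sum over the last multiset \<open>P\<close>, is known to be a fundamental solution of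
  the product of all the \<open>D\<^sub>j\<close>: pair that identity with the average of a test function.

  The identity \<open>D\<^sub>1 \<cdots> D\<^sub>n F = \<delta>\<close> is where the kernel vectors enter. A kernel vector \<open>\<nu>\<close> is a relation
  \<open>\<Sum>\<^sub>j \<nu>\<^sub>j D\<^sub>j = 0\<close>, which expresses \<open>D\<^sub>m\<close> at the pivot \<open>m\<close> by the later \<open>D\<^sub>j\<close>; formally, one step of the
  recursion rewrites \<open>1 / D\<^sup>\<alpha> = D\<^sub>m / D\<^bsup>\<alpha> + e\<^sub>m\<^esup>\<close> in this way. The expressions \<open>1 / D\<^sup>\<alpha>\<close> need not have
  a meaning by themselves while the support of \<open>\<alpha>\<close> is dependent: the columns need not lie in a half-space, and
  otherwise the cone integrals may diverge. What does make sense at every stage is \<open>E\<^bsub>\<alpha> - 1\<^esub>\<close>, with 1 subtracted on the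
  support of \<open>\<alpha>\<close>, because the columns with \<open>\<alpha>\<^sub>j \<ge> 2\<close> stay linearly independent. The invariant is therefore
    \<open>\<delta> = \<Sum>\<^bsub>(c, \<alpha>)\<^esub> c (\<Prod>\<^bsub>\<alpha>\<^sub>j = 0\<^esub> D\<^sub>j) E\<^bsub>\<alpha> - 1\<^esub>\<close>.
  A step writes \<open>E\<^bsub>\<alpha> - 1\<^esub>\<close> as \<open>D\<^sub>m\<close> of the distribution with exponent raised at \<open>m\<close>, and substitutes the relation for
  \<open>D\<^sub>m\<close>; the derivative \<open>D\<^sub>j\<close> of each summand joins the product, since \<open>\<alpha>\<^sub>j\<close> drops from 1 to 0.

  The independence comes from the echelon form. It makes the pivot minimal: every relation supported on the
  support of \<open>\<alpha>\<close> vanishes before \<open>m\<close> (\<open>nu_minimal_pivot\<close>). So the pivots weakly increase, only entries up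
  to the current pivot have been raised, and a relation among the raised columns and \<open>\<xi>\<^sub>m\<close> reduces to a
  multiple of \<open>\<xi>\<^sub>m \<noteq> 0\<close>. After \<open>n - s\<close> steps the supports are bases, and one more derivative along each
  basis column raises \<open>E\<^bsub>\<alpha> - 1\<^esub>\<close> to \<open>E\<^sub>\<alpha>\<close>.
\<close>


section \<open>Directional derivatives and segment averages of test functions\<close>

definition dir_deriv :: "'a :: euclidean_space \<Rightarrow> ('a \<Rightarrow> real) \<Rightarrow> 'a \<Rightarrow> real" where
  "dir_deriv v f x = frechet_derivative f (at x) v"

definition segment_avg :: "'a :: euclidean_space \<Rightarrow> ('a \<Rightarrow> real) \<Rightarrow> 'a \<Rightarrow> real" where
  "segment_avg v f x = integral {0..1} (\<lambda>t. f (x + t *\<^sub>R v))"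

lemma dir_deriv_eqI: "(f has_derivative f') (at x) \<Longrightarrow> dir_deriv v f x = f' v"
  unfolding dir_deriv_def by (metis frechet_derivative_at)

text \<open>
  The recursive clause for \<open>Ck\<close> in terms of \<open>dir_deriv\<close>; the original clause is withdrawn from the
  simplifier so that iterated derivatives keep this form.
\<close>

lemma Ck_Suc_iff: "Ck (Suc k) f \<longleftrightarrow> (\<forall>x. f differentiable at x) \<and> (\<forall>b\<in>Basis. Ck k (dir_deriv b f))"
  by (simp add: dir_deriv_def[abs_def])

declare Ck.simps(2)[simp del]

lemma differentiable_has_dir_deriv: "f differentiable at x \<Longrightarrow> (f has_derivative (\<lambda>h. dir_deriv h f x)) (at x)"
  unfolding dir_deriv_def by (metis eta_contract_eq frechet_derivative_works)

lemma Ck_has_dir_deriv: "Ck (Suc k) f \<Longrightarrow> (f has_derivative (\<lambda>h. dir_deriv h f x)) (at x)"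
  using Ck_Suc_iff differentiable_has_dir_deriv by blast

lemma Ck_continuous: "Ck k f \<Longrightarrow> continuous_on UNIV f"
proof (cases k)
  case (Suc m)
  assume "Ck k f"
  then show ?thesis unfolding Suc
    by (metis Ck_has_dir_deriv continuous_at_imp_continuous_on has_derivative_continuous)
qed simp

lemma Ck_add: "Ck k f \<Longrightarrow> Ck k g \<Longrightarrow> Ck k (\<lambda>x. f x + g x)"
proof (induction k arbitrary: f g)
  case 0
  then show ?case by (auto intro: continuous_on_add)
next
  case (Suc k)
  have d: "((\<lambda>x. f x + g x) has_derivative (\<lambda>h. dir_deriv h f x + dir_deriv h g x)) (at x)" for x
    by (intro has_derivative_add Ck_has_dir_deriv[OF Suc.prems(1)] Ck_has_dir_deriv[OF Suc.prems(2)])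
  have "dir_deriv b (\<lambda>x. f x + g x) = (\<lambda>x. dir_deriv b f x + dir_deriv b g x)" for b
    by (rule ext, rule dir_deriv_eqI, rule d)
  then show ?case using Suc d Ck_Suc_iff differentiable_def by metis
qed

lemma Ck_cmult: "Ck k f \<Longrightarrow> Ck k (\<lambda>x. c * f x)"
proof (induction k arbitrary: f)
  case 0
  then show ?case by (auto intro: continuous_on_mult continuous_on_const)
next
  case (Suc k)
  have d: "((\<lambda>x. c * f x) has_derivative (\<lambda>h. c * dir_deriv h f x)) (at x)" for x
    by (intro has_derivative_mult_right Ck_has_dir_deriv[OF Suc.prems(1)])
  have "dir_deriv b (\<lambda>x. c * f x) = (\<lambda>x. c * dir_deriv b f x)" for b
    by (rule ext, rule dir_deriv_eqI, rule d)
  then show ?case using Suc d Ck_Suc_iff differentiable_def by metis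
qed

lemma Ck_zero: "Ck k (\<lambda>x. 0)"
proof (induction k)
  case (Suc k)
  have "dir_deriv b (\<lambda>x. 0) = (\<lambda>x. 0)" for b :: 'a
    by (rule ext, rule dir_deriv_eqI[where f'="\<lambda>_. 0"]) simp
  then show ?case using Suc Ck_Suc_iff by (metis differentiable_const)
qed simp

lemma Ck_sum: "finite S \<Longrightarrow> (\<And>i. i \<in> S \<Longrightarrow> Ck k (f i)) \<Longrightarrow> Ck k (\<lambda>x. \<Sum>i\<in>S. f i x)"
  by (induction S rule: finite_induct) (auto intro: Ck_zero Ck_add)

lemma dir_deriv_linear:
  assumes "f differentiable at x"
  shows "linear (\<lambda>v. dir_deriv v f x)"
  using differentiable_has_dir_deriv[OF assms] has_derivative_linear by blast

lemma dir_deriv_basis: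
  assumes "f differentiable at x"
  shows "dir_deriv v f x = (\<Sum>b\<in>Basis. (v \<bullet> b) * dir_deriv b f x)"
proof -
  interpret linear "\<lambda>v. dir_deriv v f x" by (rule dir_deriv_linear[OF assms])
  have "dir_deriv v f x = dir_deriv (\<Sum>b\<in>Basis. (v \<bullet> b) *\<^sub>R b) f x" by (simp add: euclidean_representation)
  then show ?thesis by (simp add: sum scaleR)
qed

lemma Ck_dir_deriv: "Ck (Suc k) f \<Longrightarrow> Ck k (dir_deriv v f)"
proof -
  assume f: "Ck (Suc k) f"
  then have "dir_deriv v f = (\<lambda>x. \<Sum>b\<in>Basis. (v \<bullet> b) * dir_deriv b f x)"
    using dir_deriv_basis Ck_Suc_iff by blast
  moreover have "Ck k \<dots>" using f Ck_Suc_iff by (intro Ck_sum Ck_cmult) auto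
  ultimately show ?thesis by simp
qed

lemma dir_deriv_translate:
  assumes "Ck (Suc k) f"
  shows "dir_deriv v (\<lambda>x. f (x + a)) x = dir_deriv v f (x + a)"
proof (rule dir_deriv_eqI)
  show "((\<lambda>x. f (x + a)) has_derivative (\<lambda>h. dir_deriv h f (x + a))) (at x)"
    by (rule has_derivative_compose[OF _ Ck_has_dir_deriv[OF assms], of "\<lambda>x. x + a" "\<lambda>x. x" x UNIV, simplified])
       (auto intro!: derivative_eq_intros)
qed

lemma Ck_translate: "Ck k f \<Longrightarrow> Ck k (\<lambda>x. f (x + a))"
proof (induction k arbitrary: f)
  case 0
  then show ?case by (auto intro!: continuous_on_compose2[of UNIV f] continuous_intros)
next
  case (Suc k)
  have "(\<lambda>x. f (x + a)) differentiable at x" for x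
    by (rule differentiable_compose[of f "\<lambda>x. x + a", unfolded o_def]) (use Suc Ck_Suc_iff in auto)
  moreover have "dir_deriv b (\<lambda>x. f (x + a)) = (\<lambda>x. dir_deriv b f (x + a))" for b
    using dir_deriv_translate[OF Suc.prems] by blast
  ultimately show ?case using Suc Ck_Suc_iff by metis
qed

lemma continuous_on_along:
  assumes "continuous_on UNIV f" "continuous_on S g"
  shows "continuous_on S (\<lambda>x. f (g x))"
  using continuous_on_compose2[OF assms] by auto

text \<open>
  Differentiation under the integral sign. The Leibniz rule asks for a continuous family of bounded linear
  maps, so the derivatives at \<open>x + t v\<close> are packed into a \<open>Blinfun\<close>, whose continuity is checked componentwise.
\<close>

lemma segment_avg_has_derivative:
  assumes f: "Ck (Suc k) f"
  shows "(segment_avg v f has_derivative (\<lambda>h. segment_avg v (dir_deriv h f) x)) (at x)"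
proof -
  define F where "F x t = Blinfun (\<lambda>h. dir_deriv h f (x + t *\<^sub>R v))" for x t
  have F: "blinfun_apply (F x t) = (\<lambda>h. dir_deriv h f (x + t *\<^sub>R v))" for x t
    unfolding F_def by (rule bounded_linear_Blinfun_apply)
      (rule has_derivative_bounded_linear[OF Ck_has_dir_deriv[OF f]])
  have cd: "continuous_on UNIV (dir_deriv h f)" for h
    using Ck_continuous Ck_dir_deriv[OF f] by blast
  have cF: "continuous_on S (\<lambda>(x, t). F x t)" for S
    by (rule continuous_on_blinfun_componentwise)
       (auto simp: F split_beta intro!: continuous_on_along[OF cd] continuous_intros)
  have cF2: "continuous_on S (F x)" for S x
    by (rule continuous_on_blinfun_componentwise)
       (auto simp: F split_beta intro!: continuous_on_along[OF cd] continuous_intros)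
  have "((\<lambda>x. integral (cbox 0 1) (\<lambda>t. f (x + t *\<^sub>R v))) has_derivative
      blinfun_apply (integral (cbox 0 1) (F x))) (at x within UNIV)"
  proof (rule leibniz_rule)
    fix x t assume "t \<in> cbox 0 (1::real)"
    show "((\<lambda>x. f (x + t *\<^sub>R v)) has_derivative blinfun_apply (F x t)) (at x within UNIV)"
      unfolding F using Ck_has_dir_deriv[OF Ck_translate[OF f, of "t *\<^sub>R v"]] dir_deriv_translate[OF f] by simp
  next
    show "(\<lambda>t. f (x + t *\<^sub>R v)) integrable_on cbox 0 1" for x
      by (intro integrable_continuous continuous_on_along[OF Ck_continuous[OF f]] continuous_intros)
  qed (auto intro: cF)
  moreover have "blinfun_apply (integral (cbox 0 1) (F x)) =
      (\<lambda>h. integral (cbox 0 1) (\<lambda>t. dir_deriv h f (x + t *\<^sub>R v)))"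
    by (rule ext, subst blinfun_apply_integral) (auto simp: F intro!: integrable_continuous_real cF2)
  ultimately show ?thesis unfolding segment_avg_def[abs_def] by simp
qed

lemma dir_deriv_segment_avg: "Ck (Suc k) f \<Longrightarrow> dir_deriv w (segment_avg v f) = segment_avg v (dir_deriv w f)"
  by (rule ext, rule dir_deriv_eqI, rule segment_avg_has_derivative)

lemma Ck_segment_avg: "Ck k f \<Longrightarrow> Ck k (segment_avg v f)"
proof (induction k arbitrary: f)
  case 0
  have "continuous_on UNIV (\<lambda>x. integral (cbox 0 1) (\<lambda>t. f (x + t *\<^sub>R v)))"
    by (rule integral_continuous_on_param)
       (use 0 in \<open>auto simp: split_beta intro!: continuous_on_along[of f] continuous_intros\<close>)
  then show ?case by (simp add: segment_avg_def[abs_def])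
next
  case (Suc k)
  then show ?case unfolding Ck_Suc_iff[of k "segment_avg v f"]
    using dir_deriv_segment_avg[OF Suc.prems] Ck_dir_deriv[OF Suc.prems] segment_avg_has_derivative[OF Suc.prems] 
    by (metis differentiable_def)
qed

text \<open>
  The fundamental theorem of calculus on the segment from \<open>x\<close> to \<open>x + v\<close>. With
  \<open>dir_deriv_segment_avg\<close> it makes the derivative of an average along its own direction a difference.
\<close>

lemma segment_avg_dir_deriv_same:
  assumes f: "Ck (Suc k) f"
  shows "segment_avg v (dir_deriv v f) x = f (x + v) - f x"
proof -
  have "((\<lambda>t. dir_deriv v f (x + t *\<^sub>R v)) has_integral (f (x + 1 *\<^sub>R v) - f (x + 0 *\<^sub>R v))) {0..1}"
  proof (rule fundamental_theorem_of_calculus)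
    fix t :: real
    interpret linear "\<lambda>h. dir_deriv h f (x + t *\<^sub>R v)"
      using dir_deriv_linear f Ck_Suc_iff by blast
    have "((\<lambda>t. f (x + t *\<^sub>R v)) has_derivative (\<lambda>h. dir_deriv (h *\<^sub>R v) f (x + t *\<^sub>R v))) (at t within {0..1})"
      by (rule has_derivative_compose[OF _ Ck_has_dir_deriv[OF f], of "\<lambda>t. x + t *\<^sub>R v" "\<lambda>h. h *\<^sub>R v"])
         (auto intro!: derivative_eq_intros)
    then show "((\<lambda>t. f (x + t *\<^sub>R v)) has_vector_derivative dir_deriv v f (x + t *\<^sub>R v)) (at t within {0..1})"
      by (simp add: has_vector_derivative_def scaleR)
  qed simp
  then show ?thesis unfolding segment_avg_def by (simp add: integral_unique)
qed

lemma dir_deriv_scale: "Ck (Suc k) f \<Longrightarrow> dir_deriv (s *\<^sub>R v) f x = s * dir_deriv v f x"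
  using dir_deriv_linear[of f x] Ck_Suc_iff[of k f] linear_cmul by fastforce

lemma segment_avg_cmult: "segment_avg v (\<lambda>x. c * f x) x = c * segment_avg v f x"
  unfolding segment_avg_def by simp

text \<open>
  Symmetry of second derivatives. The derivative along \<open>w\<close> of the difference quotient of \<open>f\<close> along \<open>v\<close>
  is an average of \<open>D\<^sub>w D\<^sub>v f\<close> over a segment of direction \<open>v\<close>, and the difference quotient of \<open>D\<^sub>w f\<close> is
  the average of \<open>D\<^sub>v D\<^sub>w f\<close> over the same segment. Shrinking the segment to a point gives the claim.
\<close>

lemma dir_deriv_commute:
  assumes f: "Ck 2 f"
  shows "dir_deriv v (dir_deriv w f) = dir_deriv w (dir_deriv v f)"
proof
  fix x
  have f2: "Ck (Suc (Suc 0)) f" using f by (simp add: numeral_2_eq_2)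
  note fd = Ck_dir_deriv[OF f2]
  define P where "P = dir_deriv v (dir_deriv w f)"
  define Q where "Q = dir_deriv w (dir_deriv v f)"
  have cP: "continuous_on UNIV P" and cQ: "continuous_on UNIV Q"
    using Ck_dir_deriv[OF fd] unfolding P_def Q_def by auto
  \<comment> \<open>Both sides describe the derivative along \<open>w\<close> of \<open>f (y + s v) - f y\<close> at \<open>x\<close>.\<close>
  have eq: "segment_avg (s *\<^sub>R v) P x = segment_avg (s *\<^sub>R v) Q x" if s: "s \<noteq> 0" for s
  proof -
    have "(\<lambda>y. f (y + s *\<^sub>R v)) = (\<lambda>y. f y + s * segment_avg (s *\<^sub>R v) (dir_deriv v f) y)"
      using segment_avg_dir_deriv_same[OF f2, of "s *\<^sub>R v"] dir_deriv_scale[OF f2, of s v] segment_avg_cmult[of "s *\<^sub>R v" s "dir_deriv v f"]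
      by (auto simp: fun_eq_iff segment_avg_def)
    moreover have "((\<lambda>y. f y + s * segment_avg (s *\<^sub>R v) (dir_deriv v f) y) has_derivative
        (\<lambda>h. dir_deriv h f x + s * segment_avg (s *\<^sub>R v) (dir_deriv h (dir_deriv v f)) x)) (at x)"
      by (intro has_derivative_add has_derivative_mult_right Ck_has_dir_deriv[OF f2] segment_avg_has_derivative[OF fd])
    ultimately have "dir_deriv w (\<lambda>y. f (y + s *\<^sub>R v)) x = dir_deriv w f x + s * segment_avg (s *\<^sub>R v) Q x"
      by (simp add: dir_deriv_eqI Q_def)
    then have "dir_deriv w f (x + s *\<^sub>R v) = dir_deriv w f x + s * segment_avg (s *\<^sub>R v) Q x"
      using dir_deriv_translate[OF f2] by simp
    moreover have "s * segment_avg (s *\<^sub>R v) P x = dir_deriv w f (x + s *\<^sub>R v) - dir_deriv w f x"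
      using segment_avg_dir_deriv_same[OF fd, of "s *\<^sub>R v"] dir_deriv_scale[OF fd, of s v] segment_avg_cmult[of "s *\<^sub>R v" s P]
      by (auto simp: P_def fun_eq_iff segment_avg_def)
    ultimately show ?thesis using s by simp
  qed
  have cont: "continuous_on UNIV (\<lambda>s. segment_avg (s *\<^sub>R v) R x)" if "continuous_on UNIV R" for R
  proof -
    have "continuous_on UNIV (\<lambda>s::real. integral (cbox 0 1) (\<lambda>t. R (x + t *\<^sub>R s *\<^sub>R v)))"
      by (rule integral_continuous_on_param)
         (use that in \<open>auto simp: split_beta intro!: continuous_on_along[of R] continuous_intros\<close>)
    then show ?thesis by (simp add: segment_avg_def[abs_def])
  qed
  have lim: "((\<lambda>s. segment_avg (s *\<^sub>R v) R x) \<longlongrightarrow> R x) (at 0)" if "continuous_on UNIV R" for R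
    using cont[OF that, unfolded continuous_on_def, rule_format, of 0] by (simp add: segment_avg_def)
  have "((\<lambda>s. segment_avg (s *\<^sub>R v) Q x) \<longlongrightarrow> P x) (at 0)"
    by (rule Lim_transform_eventually[OF lim[OF cP]]) (auto simp: eventually_at_filter eq)
  then show "dir_deriv v (dir_deriv w f) x = dir_deriv w (dir_deriv v f) x"
    using lim[OF cQ] LIM_unique unfolding P_def Q_def by blast
qed

lemma test_function_iff:
  "test_function f \<longleftrightarrow> (\<forall>k. Ck k f) \<and> bounded {x. f x \<noteq> 0}"
  by (simp add: test_function_def)

lemma dir_deriv_supp: "{x. dir_deriv v f x \<noteq> 0} \<subseteq> closure {x. f x \<noteq> 0}"
proof
  fix x assume x: "x \<in> {x. dir_deriv v f x \<noteq> 0}"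
  show "x \<in> closure {x. f x \<noteq> 0}"
  proof (rule ccontr)
    assume n: "x \<notin> closure {x. f x \<noteq> 0}"
    have "((\<lambda>x. 0) has_derivative (\<lambda>h. 0)) (at x)" by simp
    then have "(f has_derivative (\<lambda>h. 0)) (at x)"
    proof (rule has_derivative_transform_within_open)
      show "open (- closure {x. f x \<noteq> 0})" by (rule open_Compl) (rule closed_closure)
      show "x \<in> - closure {x. f x \<noteq> 0}" using n by simp
      fix y assume "y \<in> - closure {x. f x \<noteq> 0}"
      then show "0 = f y" using closure_subset[of "{x. f x \<noteq> 0}"] by auto
    qed
    then show False using x dir_deriv_eqI[of f "\<lambda>h. 0" x v] by simp
  qed
qed

lemma test_function_dir_deriv: "test_function f \<Longrightarrow> test_function (dir_deriv v f)"
  unfolding test_function_iff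
  using Ck_dir_deriv bounded_subset[OF _ dir_deriv_supp] bounded_closure by blast

lemma test_function_translate: "test_function f \<Longrightarrow> test_function (\<lambda>x. f (x + a))"
  unfolding test_function_iff
proof (intro conjI allI)
  assume "(\<forall>k. Ck k f) \<and> bounded {x. f x \<noteq> 0}"
  then have f: "\<And>k. Ck k f" "bounded {x. f x \<noteq> 0}" by auto
  show "Ck k (\<lambda>x. f (x + a))" for k using f Ck_translate by blast
  have "{x. f (x + a) \<noteq> 0} \<subseteq> (\<lambda>x. - a + x) ` {x. f x \<noteq> 0}"
    by (auto intro!: image_eqI[where x="_ + a"])
  then show "bounded {x. f (x + a) \<noteq> 0}"
    using bounded_subset bounded_translation[OF f(2)] by blast
qed

lemma test_function_segment_avg: "test_function f \<Longrightarrow> test_function (segment_avg v f)"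
  unfolding test_function_iff
proof (intro conjI allI)
  assume "(\<forall>k. Ck k f) \<and> bounded {x. f x \<noteq> 0}"
  then have f: "\<And>k. Ck k f" "bounded {x. f x \<noteq> 0}" by auto
  show "Ck k (segment_avg v f)" for k using f Ck_segment_avg by blast
  obtain B where B: "\<And>x. f x \<noteq> 0 \<Longrightarrow> norm x \<le> B" using f(2) unfolding bounded_iff by auto
  show "bounded {x. segment_avg v f x \<noteq> 0}"
    unfolding bounded_iff
  proof (intro exI ballI)
    fix x assume "x \<in> {x. segment_avg v f x \<noteq> 0}"
    then have "\<exists>t\<in>{0..1}. f (x + t *\<^sub>R v) \<noteq> 0"
      unfolding segment_avg_def by (metis (mono_tags, lifting) integral_0 integral_cong mem_Collect_eq)
    then obtain t where t: "t \<in> {0..1}" "f (x + t *\<^sub>R v) \<noteq> 0" by auto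
    have "norm x \<le> norm (x + t *\<^sub>R v) + norm (t *\<^sub>R v)" by (metis add_diff_cancel norm_triangle_ineq4)
    also have "\<dots> \<le> B + norm v" using B[OF t(2)] t(1) 
      by (intro add_mono) (auto simp: mult_left_le_one_le)
    finally show "norm x \<le> B + norm v" .
  qed
qed

section \<open>Integration of one-sided powers over simplicial cones\<close>

definition lin_indep_family :: "('i \<Rightarrow> 'a :: euclidean_space) \<Rightarrow> 'i set \<Rightarrow> bool" where
  "lin_indep_family \<xi> I \<longleftrightarrow> (\<forall>u. (\<Sum>i\<in>I. u i *\<^sub>R \<xi> i) = 0 \<longrightarrow> (\<forall>i\<in>I. u i = 0))"

lemma lin_indep_family_inj:
  assumes "finite I" "lin_indep_family \<xi> I"
  shows "inj_on \<xi> I"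
proof (rule inj_onI, rule ccontr)
  fix i k assume ik: "i \<in> I" "k \<in> I" "\<xi> i = \<xi> k" "i \<noteq> k"
  define u where "u j = (if j = i then 1 else if j = k then -1 else (0::real))" for j
  have "(\<Sum>j\<in>I. u j *\<^sub>R \<xi> j) = (\<Sum>j\<in>{i,k}. u j *\<^sub>R \<xi> j)"
    using ik assms(1) by (intro sum.mono_neutral_right) (auto simp: u_def)
  also have "\<dots> = 0" using ik by (simp add: u_def)
  finally have "u i = 0" using assms(2) ik unfolding lin_indep_family_def by blast
  then show False by (simp add: u_def)
qed

lemma lin_indep_family_independent:
  assumes "finite I" "lin_indep_family \<xi> I"
  shows "independent (\<xi> ` I)"
proof -
  note inj = lin_indep_family_inj[OF assms]
  have "\<forall>v\<in>\<xi> ` I. w v = 0" if "(\<Sum>v\<in>\<xi> ` I. w v *\<^sub>R v) = 0" for w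
  proof -
    have "(\<Sum>i\<in>I. w (\<xi> i) *\<^sub>R \<xi> i) = 0" using that by (simp add: sum.reindex[OF inj] o_def)
    then show ?thesis
      using assms(2)[unfolded lin_indep_family_def, rule_format, of "\<lambda>i. w (\<xi> i)"] by blast
  qed
  then show ?thesis unfolding dependent_finite[OF finite_imageI[OF assms(1)]] by blast
qed

text \<open>
  A linear functional that reads off the coefficient of \<open>\<xi> i\<close>: extend the dual basis vector from the independent
  set to the whole space.
\<close>

lemma lin_indep_family_coord:
  assumes "finite I" "lin_indep_family \<xi> I" "i \<in> I"
  shows "\<exists>g :: 'a :: euclidean_space \<Rightarrow> real. linear g \<and> (\<forall>t. g (\<Sum>k\<in>I. t k *\<^sub>R \<xi> k) = t i)"
proof -
  obtain g where g: "linear g" "\<And>x. x \<in> \<xi> ` I \<Longrightarrow> g x = (if x = \<xi> i then 1 else (0::real))"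
    using linear_independent_extend[OF lin_indep_family_independent[OF assms(1,2)],
        of "\<lambda>x. if x = \<xi> i then 1 else (0::real)"] by blast
  have "g (\<Sum>k\<in>I. t k *\<^sub>R \<xi> k) = t i" for t
  proof -
    have "g (\<Sum>k\<in>I. t k *\<^sub>R \<xi> k) = (\<Sum>k\<in>I. t k *\<^sub>R g (\<xi> k))"
      using g(1) by (simp add: linear_sum linear_scale)
    also have "\<dots> = (\<Sum>k\<in>I. if k = i then t i else 0)"
      using inj_onD[OF lin_indep_family_inj[OF assms(1,2)] _ _ assms(3)]
      by (intro sum.cong) (auto simp: g(2))
    finally show ?thesis using assms by simp
  qed
  then show ?thesis using g(1) by blast
qed

text \<open>
  On an independent family the coefficients are controlled by the norm of the combination. This confines
  the cone parameters to a box when the combination lies in the support of a test function, so that the cone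
  integrals below exist.
\<close>

lemma lin_indep_family_bound:
  assumes "finite I" "lin_indep_family \<xi> I"
  shows "\<exists>C\<ge>0. \<forall>t. \<forall>i\<in>I. \<bar>t i\<bar> \<le> C * norm (\<Sum>k\<in>I. t k *\<^sub>R \<xi> k)"
proof -
  have "\<exists>C\<ge>0. \<forall>t. \<bar>t i\<bar> \<le> C * norm (\<Sum>k\<in>I. t k *\<^sub>R \<xi> k)" if i: "i \<in> I" for i
  proof -
    obtain g where g: "linear g" "\<forall>t. g (\<Sum>k\<in>I. t k *\<^sub>R \<xi> k) = t i"
      using lin_indep_family_coord[OF assms i] by blast
    obtain B where B: "B > 0" "\<forall>x. norm (g x) \<le> B * norm x" using linear_bounded_pos[OF g(1)] by blast
    show ?thesis using B g(2) by (metis less_eq_real_def real_norm_def)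
  qed
  then obtain C where C: "\<And>i. i \<in> I \<Longrightarrow> C i \<ge> 0"
    "\<And>i t. i \<in> I \<Longrightarrow> \<bar>t i\<bar> \<le> C i * norm (\<Sum>k\<in>I. t k *\<^sub>R \<xi> k)" by metis
  have "\<bar>t i\<bar> \<le> sum C I * norm (\<Sum>k\<in>I. t k *\<^sub>R \<xi> k)" if "i \<in> I" for i t
    using C(2)[OF that, of t] member_le_sum[OF that, of C] C(1) assms(1)
    by (meson DiffD1 mult_right_mono norm_ge_zero order_trans)
  then show ?thesis using C(1) by (intro exI[of _ "sum C I"]) (auto intro: sum_nonneg)
qed

lemma lin_indep_family_subset:
  assumes "finite I" "lin_indep_family \<xi> I" "J \<subseteq> I"
  shows "lin_indep_family \<xi> J"
  unfolding lin_indep_family_def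
proof (intro allI impI)
  fix u assume u: "(\<Sum>i\<in>J. u i *\<^sub>R \<xi> i) = 0"
  have "(\<Sum>i\<in>I. (if i \<in> J then u i else 0) *\<^sub>R \<xi> i) = (\<Sum>i\<in>J. u i *\<^sub>R \<xi> i)"
    using assms by (intro sum.mono_neutral_cong_right) auto
  then show "\<forall>i\<in>J. u i = 0"
    using assms(2)[unfolded lin_indep_family_def, rule_format, of "\<lambda>i. if i \<in> J then u i else 0"] assms(3) u
    by (metis subsetD)
qed

text \<open>
  The density on the half-line of the \<open>k\<close>-fold antiderivative of the Dirac distribution, for \<open>k \<ge> 1\<close>.
\<close>

definition tpow :: "nat \<Rightarrow> real \<Rightarrow> real" where
  "tpow k t = (if t \<ge> 0 then t ^ (k - 1) / fact (k - 1) else 0)"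

lemma tpow_measurable [measurable]: "tpow k \<in> borel_measurable borel"
  unfolding tpow_def[abs_def] by measurable

definition cone_integral :: "('i \<Rightarrow> 'a :: euclidean_space) \<Rightarrow> 'i set \<Rightarrow> ('i \<Rightarrow> nat) \<Rightarrow> ('a \<Rightarrow> real) \<Rightarrow> real" where
  "cone_integral \<xi> I \<gamma> f =
    (\<integral>t. (\<Prod>i\<in>I. tpow (\<gamma> i) (t i)) * f (\<Sum>i\<in>I. t i *\<^sub>R \<xi> i) \<partial>(\<Pi>\<^sub>M i\<in>I. lborel))"

lemma product_sigma_finite_lborel: "product_sigma_finite (\<lambda>_. lborel :: real measure)"
  by (simp add: lborel.sigma_finite_measure_axioms product_sigma_finite_def)

lemma test_function_measurable: "test_function f \<Longrightarrow> f \<in> borel_measurable borel"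
  by (rule borel_measurable_continuous_onI, rule Ck_continuous[of 0]) (simp only: test_function_iff)

lemma test_function_bounded:
  assumes "test_function f"
  obtains M where "\<And>x. \<bar>f x\<bar> \<le> M" "M \<ge> 0"
proof -
  let ?K = "closure {x. f x \<noteq> 0}"
  have "compact (f ` ?K)"
    using assms Ck_continuous[of 0 f] unfolding test_function_def
    by (intro compact_continuous_image) (auto intro: continuous_on_subset)
  then have "bounded (f ` ?K)" by (rule compact_imp_bounded)
  then obtain M where M: "\<And>y. y \<in> f ` ?K \<Longrightarrow> \<bar>y\<bar> \<le> M" 
    unfolding bounded_iff real_norm_def by blast
  have "\<bar>f x\<bar> \<le> max M 0" for x
    using M[of "f x"] closure_subset[of "{x. f x \<noteq> 0}"] by (cases "f x = 0") (auto simp: le_max_iff_disj)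
  then show ?thesis using that[of "max M 0"] by simp
qed

lemma test_function_support:
  assumes "test_function f"
  obtains R where "\<And>x. f x \<noteq> 0 \<Longrightarrow> norm x \<le> R" "R \<ge> 0"
proof -
  obtain B where "\<And>x. f x \<noteq> 0 \<Longrightarrow> norm x \<le> B" using assms unfolding test_function_iff bounded_iff by auto
  then show ?thesis using that[of "max B 0"] by (meson le_max_iff_disj max.cobounded2)
qed

text \<open>
  By \<open>lin_indep_family_bound\<close> the integrand vanishes outside a box, where it is dominated by a
  product of integrable functions of one variable each.
\<close>

lemma cone_integrable:
  assumes I: "finite I" and ind: "lin_indep_family \<xi> I" and f: "test_function f"
  shows "integrable (\<Pi>\<^sub>M i\<in>I. lborel) (\<lambda>t. (\<Prod>i\<in>I. tpow (\<gamma> i) (t i)) * f (\<Sum>i\<in>I. t i *\<^sub>R \<xi> i))"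
proof -
  interpret product_sigma_finite "\<lambda>_. lborel :: real measure" by (rule product_sigma_finite_lborel)
  obtain C where C: "C \<ge> 0" "\<And>t i. i \<in> I \<Longrightarrow> \<bar>t i\<bar> \<le> C * norm (\<Sum>k\<in>I. t k *\<^sub>R \<xi> k)"
    using lin_indep_family_bound[OF I ind] by blast
  obtain M where M: "\<And>x. \<bar>f x\<bar> \<le> M" "M \<ge> 0" using test_function_bounded[OF f] by blast
  obtain R where R: "\<And>x. f x \<noteq> 0 \<Longrightarrow> norm x \<le> R" "R \<ge> 0" using test_function_support[OF f] by blast
  note [measurable] = test_function_measurable[OF f]
  let ?h = "\<lambda>i s. tpow (\<gamma> i) s * indicator {0..C * R} s :: real"
  have "integrable lborel (?h i)" for i
  proof -
    have "integrable lborel (\<lambda>s. s ^ (\<gamma> i - 1) / fact (\<gamma> i - 1) * indicator {0..C * R} s :: real)"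
      by (rule borel_integrable_atLeastAtMost) (auto intro!: continuous_intros)
    moreover have "?h i = (\<lambda>s. s ^ (\<gamma> i - 1) / fact (\<gamma> i - 1) * indicator {0..C * R} s)"
      by (auto simp: tpow_def indicator_def fun_eq_iff)
    ultimately show ?thesis by simp
  qed
  then have int: "integrable (\<Pi>\<^sub>M i\<in>I. lborel) (\<lambda>t. M * (\<Prod>i\<in>I. ?h i (t i)))"
    by (intro integrable_mult_right product_integrable_prod I)
  show ?thesis
  proof (rule Bochner_Integration.integrable_bound[OF int])
    show "(\<lambda>t. (\<Prod>i\<in>I. tpow (\<gamma> i) (t i)) * f (\<Sum>i\<in>I. t i *\<^sub>R \<xi> i)) \<in> borel_measurable (\<Pi>\<^sub>M i\<in>I. lborel)"
      by measurable
    have "norm ((\<Prod>i\<in>I. tpow (\<gamma> i) (t i)) * f (\<Sum>i\<in>I. t i *\<^sub>R \<xi> i)) \<le> norm (M * (\<Prod>i\<in>I. ?h i (t i)))" for t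
    proof (cases "f (\<Sum>i\<in>I. t i *\<^sub>R \<xi> i) = 0")
      case False
      have "\<bar>t i\<bar> \<le> C * R" if "i \<in> I" for i
        using C(2)[OF that, of t] mult_left_mono[OF R(1)[OF False] C(1)] by linarith
      then have "(\<Prod>i\<in>I. ?h i (t i)) = (\<Prod>i\<in>I. tpow (\<gamma> i) (t i))"
        by (intro prod.cong) (fastforce simp: tpow_def indicator_def)+
      then show ?thesis
        using mult_right_mono[OF M(1) abs_ge_zero, of "\<Sum>i\<in>I. t i *\<^sub>R \<xi> i" "\<Prod>i\<in>I. tpow (\<gamma> i) (t i)"] M(2)
        unfolding real_norm_def abs_mult by (simp only: abs_of_nonneg mult.commute)
    qed simp
    then show "AE t in \<Pi>\<^sub>M i\<in>I. lborel. norm ((\<Prod>i\<in>I. tpow (\<gamma> i) (t i)) * f (\<Sum>i\<in>I. t i *\<^sub>R \<xi> i))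
        \<le> norm (M * (\<Prod>i\<in>I. ?h i (t i)))" by (intro AE_I2)
  qed
qed

text \<open>
  Differentiation lowers the exponent of a one-sided power by one; from \<open>k = 0\<close> on the right-hand side the
  Heaviside function becomes the evaluation at 0.
\<close>

lemma tpow_integral_by_parts:
  fixes g g' :: "real \<Rightarrow> real"
  assumes g: "\<And>t. (g has_real_derivative g' t) (at t)" and g': "continuous_on UNIV g'"
    and R: "R \<ge> 0" "\<And>t. t \<ge> R \<Longrightarrow> g t = 0" "\<And>t. t \<ge> R \<Longrightarrow> g' t = 0"
  shows "(\<integral>t. tpow (Suc k) t * g' t \<partial>lborel) = - (if k = 0 then g 0 else \<integral>t. tpow k t * g t \<partial>lborel)"
proof -
  define F where "F t = t ^ k / fact k" for t :: real
  define F' where "F' t = (if k = 0 then 0 else t ^ (k - 1) / fact (k - 1))" for t :: real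
  have F: "(F has_real_derivative F' t) (at t)" for t
  proof (cases k)
    case (Suc j)
    have "((\<lambda>t. t ^ Suc j / fact (Suc j)) has_real_derivative (real (Suc j) * t ^ j) / fact (Suc j)) (at t)"
      using DERIV_cdivide[OF DERIV_pow[of "Suc j" t UNIV]] by (simp del: power_Suc fact_Suc of_nat_Suc)
    also have "(real (Suc j) * t ^ j) / fact (Suc j) = t ^ j / fact j"
      by (subst fact_Suc) (simp del: of_nat_Suc)
    finally show ?thesis unfolding F_def[abs_def] F'_def Suc by simp
  qed (simp add: F_def[abs_def] F'_def)
  have "(\<integral>t. (F t * g' t) * indicator {0..R} t \<partial>lborel) =
      F R * g R - F 0 * g 0 - (\<integral>t. (F' t * g t) * indicator {0..R} t \<partial>lborel)"
  proof (rule integral_by_parts)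
    show "isCont F' t" for t unfolding F'_def[abs_def] by (cases "k = 0") (simp_all add: continuous_intros)
    show "isCont g' t" for t using g' by (simp add: continuous_on_eq_continuous_at)
  qed (use R(1) g F in simp_all)
  moreover have "(\<lambda>t. (F t * g' t) * indicator {0..R} t) = (\<lambda>t. tpow (Suc k) t * g' t)"
    using R(1) R(3)[OF less_imp_le] by (auto simp: fun_eq_iff F_def tpow_def indicator_def not_le)
  moreover have "(\<lambda>t. (F' t * g t) * indicator {0..R} t) = (if k = 0 then (\<lambda>t. 0) else (\<lambda>t. tpow k t * g t))"
    using R(1) R(2)[OF less_imp_le] by (auto simp: fun_eq_iff F'_def tpow_def indicator_def not_le)
  moreover have "F R * g R = 0" "F 0 * g 0 = (if k = 0 then g 0 else 0)" using R(1,2) by (simp_all add: F_def)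
  ultimately show ?thesis by (simp split: if_splits)
qed

lemma tpow_integral_dir_deriv:
  assumes f: "test_function f" and v: "v \<noteq> 0"
  shows "(\<integral>t. tpow (Suc k) t * dir_deriv (- v) f (y + t *\<^sub>R v) \<partial>lborel) =
    (if k = 0 then f y else \<integral>t. tpow k t * f (y + t *\<^sub>R v) \<partial>lborel)"
proof -
  have f1: "Ck (Suc 0) f" using f test_function_iff by blast
  have fd: "test_function (dir_deriv v f)" using test_function_dir_deriv[OF f] .
  obtain R1 where R1: "\<And>x. f x \<noteq> 0 \<Longrightarrow> norm x \<le> R1" using test_function_support[OF f] by blast
  obtain R2 where R2: "\<And>x. dir_deriv v f x \<noteq> 0 \<Longrightarrow> norm x \<le> R2" using test_function_support[OF fd] by blast
  \<comment> \<open>Beyond parameter \<open>R\<close> the ray has left the supports of \<open>f\<close> and of its derivative.\<close>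
  define R where "R = (max (max R1 R2) 0 + 1 + norm y) / norm v"
  have R: "R \<ge> 0" unfolding R_def by simp
  have big: "norm (y + t *\<^sub>R v) > max R1 R2" if "t \<ge> R" for t
  proof -
    have "R * norm v \<le> t * norm v" using that v by simp
    moreover have "R * norm v = max (max R1 R2) 0 + 1 + norm y" using v by (simp add: R_def)
    moreover have "norm (t *\<^sub>R v) = t * norm v" using that R by simp
    moreover have "norm (t *\<^sub>R v) \<le> norm (y + t *\<^sub>R v) + norm y"
      by (metis add_diff_cancel_left' norm_triangle_ineq4)
    ultimately show ?thesis by linarith
  qed
  have "(\<integral>t. tpow (Suc k) t * dir_deriv v f (y + t *\<^sub>R v) \<partial>lborel) =
    - (if k = 0 then f (y + 0 *\<^sub>R v) else \<integral>t. tpow k t * f (y + t *\<^sub>R v) \<partial>lborel)"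
  proof (rule tpow_integral_by_parts[OF _ _ R])
    fix t
    have "((\<lambda>t. f (y + t *\<^sub>R v)) has_derivative (\<lambda>h. dir_deriv (h *\<^sub>R v) f (y + t *\<^sub>R v))) (at t)"
      by (rule has_derivative_compose[OF _ Ck_has_dir_deriv[OF f1], of "\<lambda>t. y + t *\<^sub>R v" "\<lambda>h. h *\<^sub>R v"])
         (auto intro!: derivative_eq_intros)
    then show "((\<lambda>t. f (y + t *\<^sub>R v)) has_real_derivative dir_deriv v f (y + t *\<^sub>R v)) (at t)"
      by (simp add: has_field_derivative_def dir_deriv_scale[OF f1] mult_commute_abs)
  next
    have "continuous_on UNIV (dir_deriv v f)" using fd Ck_continuous test_function_iff by blast
    then show "continuous_on UNIV (\<lambda>t. dir_deriv v f (y + t *\<^sub>R v))"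
      by (rule continuous_on_along) (intro continuous_intros)
  qed (use big R1 R2 in \<open>fastforce+\<close>)
  moreover have "dir_deriv (- v) f x = - dir_deriv v f x" for x
    using dir_deriv_scale[OF f1, of "-1" v x] by simp
  ultimately show ?thesis by simp
qed

text \<open>
  Fubini, with the variable belonging to \<open>\<xi> m\<close> innermost, so that the one-variable computation
  \<open>tpow_integral_dir_deriv\<close> applies to the inner integral.
\<close>

lemma cone_integral_insert:
  assumes I: "finite I" "m \<notin> I" and ind: "lin_indep_family \<xi> (insert m I)" and f: "test_function f"
  shows "cone_integral \<xi> (insert m I) \<gamma> f =
    (\<integral>t. (\<Prod>i\<in>I. tpow (\<gamma> i) (t i)) * (\<integral>s. tpow (\<gamma> m) s * f ((\<Sum>i\<in>I. t i *\<^sub>R \<xi> i) + s *\<^sub>R \<xi> m) \<partial>lborel)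
      \<partial>(\<Pi>\<^sub>M i\<in>I. lborel))"
proof -
  interpret product_sigma_finite "\<lambda>_. lborel :: real measure" by (rule product_sigma_finite_lborel)
  have 1: "(\<Prod>i\<in>insert m I. tpow (\<gamma> i) ((t(m := s)) i)) = tpow (\<gamma> m) s * (\<Prod>i\<in>I. tpow (\<gamma> i) (t i))"
    for t s using I by (simp, intro disjI2 prod.cong) auto
  have 2: "(\<Sum>i\<in>insert m I. (t(m := s)) i *\<^sub>R \<xi> i) = (\<Sum>i\<in>I. t i *\<^sub>R \<xi> i) + s *\<^sub>R \<xi> m"
    for t s using I by (simp add: add.commute, intro sum.cong) auto
  show ?thesis
    unfolding cone_integral_def product_integral_insert[OF I cone_integrable[OF finite.insertI[OF I(1)] ind f]] 1 2
    by (simp only: integral_mult_right_zero[symmetric] mult.assoc mult.left_commute)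
qed

lemma cone_integral_dir_deriv:
  assumes I: "finite I" "m \<notin> I" and ind: "lin_indep_family \<xi> (insert m I)" and f: "test_function f"
  shows "cone_integral \<xi> (insert m I) (\<gamma>(m := Suc k)) (dir_deriv (- \<xi> m) f) =
    (if k = 0 then cone_integral \<xi> I \<gamma> f else cone_integral \<xi> (insert m I) (\<gamma>(m := k)) f)"
proof -
  have "lin_indep_family \<xi> {m}" by (rule lin_indep_family_subset[OF _ ind]) (use I in auto)
  then have m: "\<xi> m \<noteq> 0" unfolding lin_indep_family_def by force
  have g: "(\<Prod>i\<in>I. tpow ((\<gamma>(m := k)) i) (t i)) = (\<Prod>i\<in>I. tpow (\<gamma> i) (t i))" for k t
    using I by (intro prod.cong) auto
  show ?thesis
    unfolding cone_integral_insert[OF I ind test_function_dir_deriv[OF f]] cone_integral_insert[OF I ind f] g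
    by (simp only: fun_upd_same tpow_integral_dir_deriv[OF f m]) (simp add: cone_integral_def)
qed

text \<open>
  Indices with \<open>\<gamma> i = 0\<close> contribute no integration variable: along them the distribution is a Dirac
  distribution. This convention is what makes \<open>cone_pairing_dir_deriv\<close> uniform in \<open>\<gamma> m\<close>.
\<close>

definition cone_pairing :: "('i \<Rightarrow> 'a :: euclidean_space) \<Rightarrow> ('i \<Rightarrow> nat) \<Rightarrow> ('a \<Rightarrow> real) \<Rightarrow> real" where
  "cone_pairing \<xi> \<gamma> = cone_integral \<xi> {i. \<gamma> i \<noteq> 0} \<gamma>"

text \<open>
  The rule \<open>D\<^sub>m E\<^bsub>\<gamma> + e\<^sub>m\<^esub> = E\<^sub>\<gamma>\<close>, in which the sign from moving the derivative to the test function is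
  absorbed in the direction \<open>- \<xi> m\<close>.
\<close>

lemma cone_pairing_dir_deriv:
  assumes fin: "finite {i. \<gamma> i \<noteq> 0}" and ind: "lin_indep_family \<xi> (insert m {i. \<gamma> i \<noteq> 0})"
    and f: "test_function f"
  shows "cone_pairing \<xi> (\<gamma>(m := Suc (\<gamma> m))) (dir_deriv (- \<xi> m) f) = cone_pairing \<xi> \<gamma> f"
proof -
  define I where "I = {i. \<gamma> i \<noteq> 0} - {m}"
  have I: "finite I" "m \<notin> I" "insert m I = insert m {i. \<gamma> i \<noteq> 0}" using fin by (auto simp: I_def)
  have s: "{i. (\<gamma>(m := Suc (\<gamma> m))) i \<noteq> 0} = insert m I" by (auto simp: I_def)
  have "{i. \<gamma> i \<noteq> 0} = (if \<gamma> m = 0 then I else insert m I)" by (auto simp: I_def)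
  then show ?thesis
    unfolding cone_pairing_def s
    using cone_integral_dir_deriv[OF I(1,2) _ f, of \<xi> \<gamma> "\<gamma> m"] ind I(3) by (simp split: if_splits)
qed

lemma cone_pairing_zero: "cone_pairing \<xi> (\<lambda>_. 0) f = f 0"
  by (simp add: cone_pairing_def cone_integral_def
      PiM_empty lebesgue_integral_count_space_finite)

lemma cone_pairing_sum:
  assumes fin: "finite {i. \<gamma> i \<noteq> 0}" and ind: "lin_indep_family \<xi> {i. \<gamma> i \<noteq> 0}"
    and f: "\<And>j. j \<in> J \<Longrightarrow> test_function (f j)"
  shows "cone_pairing \<xi> \<gamma> (\<lambda>x. \<Sum>j\<in>J. c j * f j x) = (\<Sum>j\<in>J. c j * cone_pairing \<xi> \<gamma> (f j))"
proof -
  let ?I = "{i. \<gamma> i \<noteq> 0}"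
  let ?w = "\<lambda>t. \<Prod>i\<in>?I. tpow (\<gamma> i) (t i)" and ?T = "\<lambda>t. \<Sum>i\<in>?I. t i *\<^sub>R \<xi> i"
  have "cone_pairing \<xi> \<gamma> (\<lambda>x. \<Sum>j\<in>J. c j * f j x) =
      (\<integral>t. (\<Sum>j\<in>J. c j * (?w t * f j (?T t))) \<partial>(\<Pi>\<^sub>M i\<in>?I. lborel))"
    unfolding cone_pairing_def cone_integral_def
    by (simp only: sum_distrib_left mult.left_commute)
  also have "\<dots> = (\<Sum>j\<in>J. \<integral>t. c j * (?w t * f j (?T t)) \<partial>(\<Pi>\<^sub>M i\<in>?I. lborel))"
    by (rule Bochner_Integration.integral_sum)
       (intro integrable_mult_right cone_integrable[OF fin ind] f)
  also have "\<dots> = (\<Sum>j\<in>J. c j * cone_pairing \<xi> \<gamma> (f j))"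
    unfolding cone_pairing_def cone_integral_def by (simp only: integral_mult_right_zero)
  finally show ?thesis .
qed

section \<open>Kernel matrices and pivots\<close>

lemma first_nonzero_props:
  assumes "v \<in> carrier_vec n" "v \<noteq> 0\<^sub>v n"
  shows "first_nonzero v < n" "v $ first_nonzero v \<noteq> 0" "\<And>i. i < first_nonzero v \<Longrightarrow> v $ i = 0"
proof -
  obtain k where "k < dim_vec v \<and> v $ k \<noteq> 0" using assms by (metis carrier_vecD eq_vecI index_zero_vec)
  from LeastI[of "\<lambda>i. i < dim_vec v \<and> v $ i \<noteq> 0", OF this]
  show a: "first_nonzero v < n" "v $ first_nonzero v \<noteq> 0"
    using assms(1) unfolding first_nonzero_def by auto
  show "v $ i = 0" if "i < first_nonzero v" for i
    using not_less_Least[OF that[unfolded first_nonzero_def]] that a assms(1) by auto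
qed

lemma first_nonzero_eqI:
  assumes "m < dim_vec v" "v $ m \<noteq> 0" "\<And>i. i < m \<Longrightarrow> v $ i = 0"
  shows "first_nonzero v = m"
  unfolding first_nonzero_def using assms by (intro Least_equality) (auto simp: not_less[symmetric])

text \<open>
  What is used of a kernel matrix besides its echelon form: the columns are nonzero kernel vectors, and every
  kernel vector is a combination of them.
\<close>

lemma kernel_matrixD:
  assumes "kernel_matrix X K"
  shows "dim_row K = dim_col X"
    and "\<And>j. j < dim_col K \<Longrightarrow> col K j \<in> mat_kernel X"
    and "\<And>j. j < dim_col K \<Longrightarrow> col K j \<noteq> 0\<^sub>v (dim_col X)"
    and "\<And>v. v \<in> mat_kernel X \<Longrightarrow> \<exists>t\<in>carrier_vec (dim_col K). v = K *\<^sub>v t"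
proof -
  interpret kernel "dim_row X" "dim_col X" X by unfold_locales simp
  have K: "dim_row K = dim_col X" "distinct (cols K)" "basis (set (cols K))"
    using assms unfolding kernel_matrix_def by auto
  then have b: "lin_indpt (set (cols K))" "gen_set (set (cols K))" "set (cols K) \<subseteq> mat_kernel X"
    unfolding Ker.basis_def by auto
  show "dim_row K = dim_col X" by fact
  show 2: "col K j \<in> mat_kernel X" if "j < dim_col K" for j
    using b(3) that by (auto simp: cols_def)
  show "col K j \<noteq> 0\<^sub>v (dim_col X)" if "j < dim_col K" for j
  proof -
    have "(UNIV :: real set) \<noteq> {0}" by (metis UNIV_I singletonD zero_neq_one)
    then have "0\<^sub>v (dim_col X) \<notin> set (cols K)"
      using Ker.zero_nin_lin_indpt[OF b(3) b(1)] by simp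
    then show ?thesis using that by (metis cols_length cols_nth nth_mem)
  qed
  show "\<exists>t\<in>carrier_vec (dim_col K). v = K *\<^sub>v t" if v: "v \<in> mat_kernel X" for v
  proof -
    have "v \<in> span (set (cols K))" using b(2) v by simp
    then obtain a where a: "lincomb a (set (cols K)) = v"
      using Ker.finite_in_span[OF _ b(3)] by auto
    define t where "t = Matrix.vec (dim_col K) (\<lambda>j. a (col K j))"
    have inj: "inj_on (col K) {..<dim_col K}"
      using K(2) unfolding cols_def distinct_map by (simp add: atLeast0LessThan)
    have cs: "set (cols K) = col K ` {..<dim_col K}" by (auto simp: cols_def)
    have "v = K *\<^sub>v t"
    proof (rule eq_vecI)
      have d: "dim_vec v = dim_col X" using v by (auto simp: mat_kernel_def)
      then show "dim_vec v = dim_vec (K *\<^sub>v t)" using K(1) by simp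
      fix i assume "i < dim_vec (K *\<^sub>v t)"
      then have i: "i < dim_col X" using K(1) by simp
      have "v $ i = (\<Sum>x\<in>set (cols K). a x * x $ i)"
        using lincomb_index[OF i b(3), of a] a by simp
      also have "\<dots> = (\<Sum>j<dim_col K. a (col K j) * K $$ (i, j))"
        unfolding cs sum.reindex[OF inj] using i K(1) by (intro sum.cong) auto
      also have "\<dots> = (K *\<^sub>v t) $ i"
        using i K(1) by (simp add: t_def scalar_prod_def atLeast0LessThan mult.commute)
      finally show "v $ i = (K *\<^sub>v t) $ i" .
    qed
    then show ?thesis by (intro bexI[of _ t]) (simp_all add: t_def)
  qed
qed

lemma mult_mat_vec_index:
  assumes "i < dim_row K" "t \<in> carrier_vec (dim_col K)"
  shows "(K *\<^sub>v t) $ i = (\<Sum>j<dim_col K. K $$ (i, j) * t $ j)"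
  using assms by (simp add: scalar_prod_def atLeast0LessThan)

text \<open>
  If the coefficients before \<open>r\<close> vanish, only the columns from \<open>r\<close> on contribute to \<open>K t\<close>. By the echelon
  form all of these vanish before the first nonzero row of column \<open>r\<close>, and in that row column \<open>r\<close> is the only
  one that does not vanish.
\<close>

lemma kernel_matrix_echelon:
  assumes K: "kernel_matrix X K" and r: "r < dim_col K"
    and t: "t \<in> carrier_vec (dim_col K)" "\<And>j. j < r \<Longrightarrow> t $ j = 0"
  shows "\<And>i. i < first_nonzero (col K r) \<Longrightarrow> (K *\<^sub>v t) $ i = 0"
    and "(K *\<^sub>v t) $ first_nonzero (col K r) = K $$ (first_nonzero (col K r), r) * t $ r"
    and "first_nonzero (col K r) < dim_col X" "K $$ (first_nonzero (col K r), r) \<noteq> 0"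
proof -
  note d = kernel_matrixD[OF K]
  have fn: "first_nonzero (col K j) < dim_col X" "col K j $ first_nonzero (col K j) \<noteq> 0"
    "\<And>i. i < first_nonzero (col K j) \<Longrightarrow> col K j $ i = 0" if "j < dim_col K" for j
    using first_nonzero_props[OF carrier_vecI d(3)[OF that]] d(1) by simp_all
  have mono: "first_nonzero (col K r) < first_nonzero (col K j)" if "r < j" "j < dim_col K" for j
    using K that unfolding kernel_matrix_def column_echelon_form_def by blast
  let ?M = "first_nonzero (col K r)"
  show M: "?M < dim_col X" using fn(1)[OF r] .
  show "K $$ (?M, r) \<noteq> 0" using fn(2)[OF r] M r d(1) by simp
  have z: "K $$ (i, j) = 0" if "i \<le> ?M" "r \<le> j" "j < dim_col K" "i < ?M \<or> r < j" for i j
  proof -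
    have "i < first_nonzero (col K j)" using that mono[of j] by (cases "r = j") auto
    then show ?thesis using fn(3)[OF that(3), of i] fn(1)[OF that(3)] that d(1) by simp
  qed
  show "(K *\<^sub>v t) $ i = 0" if i: "i < ?M" for i
  proof -
    have "K $$ (i, j) * t $ j = 0" if "j < dim_col K" for j
      using z[of i j] t(2)[of j] i that by (cases "j < r") auto
    then have "(\<Sum>j<dim_col K. K $$ (i, j) * t $ j) = 0" by (intro sum.neutral) auto
    then show ?thesis using mult_mat_vec_index[of i K t] i M d(1) t(1) by simp
  qed
  have "(K *\<^sub>v t) $ ?M = (\<Sum>j<dim_col K. K $$ (?M, j) * t $ j)"
    using mult_mat_vec_index[of ?M K t] M d(1) t(1) by simp
  also have "\<dots> = (\<Sum>j\<in>{r}. K $$ (?M, j) * t $ j)"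
  proof (rule sum.mono_neutral_right)
    show "\<forall>j\<in>{..<dim_col K} - {r}. K $$ (?M, j) * t $ j = 0"
    proof
      fix j assume "j \<in> {..<dim_col K} - {r}"
      then show "K $$ (?M, j) * t $ j = 0"
        using z[of ?M j] t(2)[of j] by (cases "j < r") auto
    qed
  qed (use r in auto)
  finally show "(K *\<^sub>v t) $ ?M = K $$ (?M, r) * t $ r" by simp
qed

text \<open>
  The kernel of the rows \<open>Z\<close> of \<open>K\<close> consists of the coefficient vectors \<open>t\<close> for which \<open>K t\<close> vanishes
  on \<open>Z\<close>. For \<open>K = ker \<Xi>\<close> and \<open>Z\<close> the zero set of \<open>\<alpha>\<close> these describe the relations between columns in
  the support of \<open>\<alpha>\<close>.
\<close>

lemma submatrix_rows_kernel:
  assumes Z: "Z \<subseteq> {..<dim_row K}" and t: "t \<in> carrier_vec (dim_col K)"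
  shows "t \<in> mat_kernel (submatrix K Z UNIV) \<longleftrightarrow> (\<forall>i\<in>Z. (K *\<^sub>v t) $ i = 0)"
proof -
  let ?C = "submatrix K Z UNIV"
  have Z2: "{i. i < dim_row K \<and> i \<in> Z} = Z" using Z by auto
  have dims: "dim_row ?C = card Z" "dim_col ?C = dim_col K"
    using Z2 by (simp_all add: dim_submatrix)
  have fin: "finite Z" using Z finite_subset by blast
  have eq: "(?C *\<^sub>v t) $ i = (K *\<^sub>v t) $ pick Z i" if i: "i < card Z" for i
  proof -
    have p: "pick Z i \<in> Z" using pick_in_set_le[OF i] .
    have "(?C *\<^sub>v t) $ i = (\<Sum>j<dim_col K. ?C $$ (i, j) * t $ j)"
      using mult_mat_vec_index[of i ?C t] dims i t by simp
    also have "\<dots> = (\<Sum>j<dim_col K. K $$ (pick Z i, j) * t $ j)"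
      using i by (intro sum.cong refl) (simp add: submatrix_index Z2 pick_UNIV)
    also have "\<dots> = (K *\<^sub>v t) $ pick Z i"
      using mult_mat_vec_index[of "pick Z i" K t] p Z t by auto
    finally show ?thesis .
  qed
  have surj: "\<exists>k<card Z. pick Z k = i" if "i \<in> Z" for i
  proof (intro exI conjI)
    show "pick Z (card {a\<in>Z. a < i}) = i" using pick_card_in_set[OF that] .
    show "card {a\<in>Z. a < i} < card Z" using that fin by (intro psubset_card_mono) auto
  qed
  have "t \<in> mat_kernel ?C \<longleftrightarrow> (\<forall>i<card Z. (?C *\<^sub>v t) $ i = 0)"
  proof
    assume "t \<in> mat_kernel ?C"
    then have "?C *\<^sub>v t = 0\<^sub>v (card Z)" using dims by (simp add: mat_kernel_def)
    then show "\<forall>i<card Z. (?C *\<^sub>v t) $ i = 0" by simp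
  next
    assume "\<forall>i<card Z. (?C *\<^sub>v t) $ i = 0"
    then have "?C *\<^sub>v t = 0\<^sub>v (card Z)" using dims by (intro eq_vecI) auto
    then show "t \<in> mat_kernel ?C" using t dims by (simp add: mat_kernel_def)
  qed
  also have "\<dots> \<longleftrightarrow> (\<forall>i\<in>Z. (K *\<^sub>v t) $ i = 0)"
    using eq surj pick_in_set_le[of _ Z] by metis
  finally show ?thesis .
qed

text \<open>
  The vector \<open>\<nu>\<close> is a relation between columns in the support of \<open>\<alpha>\<close> that starts as early as possible:
  the echelon form of \<open>ker \<Xi>\<close> turns the first nonzero index of the coefficient vector into the first nonzero index of
  the combination in a monotone way, and the echelon form of the second kernel matrix makes the former minimal.
  The vector \<open>u0\<close> only witnesses that some nonzero relation exists, so that the column 0 used by \<open>\<nu>\<close> does too.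
\<close>

lemma nu_minimal_pivot:
  assumes ker: "\<forall>X. kernel_matrix X (ker X)" and \<alpha>: "dim_vec \<alpha> = dim_col \<Xi>"
    and u0: "u0 \<in> mat_kernel \<Xi>" "u0 \<noteq> 0\<^sub>v (dim_col \<Xi>)" "\<forall>j\<in>zero_set \<alpha>. u0 $ j = 0"
  defines "v \<equiv> \<nu> ker \<Xi> \<alpha>"
  shows "v \<in> mat_kernel \<Xi>" "\<forall>j\<in>zero_set \<alpha>. v $ j = 0"
    "first_nonzero v < dim_col \<Xi>" "v $ first_nonzero v \<noteq> 0"
    "\<And>u i. u \<in> mat_kernel \<Xi> \<Longrightarrow> \<forall>j\<in>zero_set \<alpha>. u $ j = 0 \<Longrightarrow> i < first_nonzero v \<Longrightarrow> u $ i = 0"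
proof -
  define K where "K = ker \<Xi>"
  have K: "kernel_matrix \<Xi> K" using ker K_def by simp
  note d = kernel_matrixD[OF K]
  define Z where "Z = zero_set \<alpha>"
  have Z: "Z \<subseteq> {..<dim_row K}" using \<alpha> d(1) by (auto simp: Z_def zero_set_def)
  have mk: "K *\<^sub>v t \<in> mat_kernel \<Xi>" if t: "t \<in> carrier_vec (dim_col K)" for t
  proof -
    have Kc: "K \<in> carrier_mat (dim_col \<Xi>) (dim_col K)" using d(1) by auto
    have "\<Xi> * K = 0\<^sub>m (dim_row \<Xi>) (dim_col K)"
    proof (rule eq_matI)
      fix i j assume ij: "i < dim_row (0\<^sub>m (dim_row \<Xi>) (dim_col K))" "j < dim_col (0\<^sub>m (dim_row \<Xi>) (dim_col K))"
      then have "\<Xi> *\<^sub>v col K j = 0\<^sub>v (dim_row \<Xi>)" using d(2)[of j] by (auto simp: mat_kernel_def)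
      then have "(\<Xi> *\<^sub>v col K j) $ i = 0" using ij by simp
      then show "(\<Xi> * K) $$ (i, j) = 0\<^sub>m (dim_row \<Xi>) (dim_col K) $$ (i, j)" using ij by simp
    qed auto
    then have "\<Xi> *\<^sub>v (K *\<^sub>v t) = 0\<^sub>m (dim_row \<Xi>) (dim_col K) *\<^sub>v t"
      using assoc_mult_mat_vec[of \<Xi> _ _ K _ t] Kc t by (metis carrier_matI)
    also have "\<dots> = 0\<^sub>v (dim_row \<Xi>)" using t by (intro eq_vecI) auto
    finally show ?thesis using d(1) by (auto simp: mat_kernel_def intro!: carrier_vecI)
  qed
  \<comment> \<open>In both cases of its definition \<open>\<nu>\<close> is \<open>K t\<close>, where \<open>t\<close> starts at an index \<open>r\<close> that is\<close>
  \<comment> \<open>minimal among the coefficient vectors of relations supported on the support of \<open>\<alpha>\<close>.\<close>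
  obtain r t where rt: "r < dim_col K" "t \<in> carrier_vec (dim_col K)" "v = K *\<^sub>v t"
      "\<forall>i\<in>Z. (K *\<^sub>v t) $ i = 0" "\<forall>j<r. t $ j = 0" "t $ r \<noteq> 0"
      "\<forall>t'\<in>carrier_vec (dim_col K). (\<forall>i\<in>Z. (K *\<^sub>v t') $ i = 0) \<longrightarrow> (\<forall>j<r. t' $ j = 0)"
  proof (cases "norm0 \<alpha> = dim_col \<Xi>")
    case True
    have "supp \<alpha> = {..<dim_col \<Xi>}"
    proof (rule card_subset_eq)
      show "supp \<alpha> \<subseteq> {..<dim_col \<Xi>}" using \<alpha> by (auto simp: supp_def)
      show "card (supp \<alpha>) = card {..<dim_col \<Xi>}" using True by (simp add: norm0_def)
    qed simp
    then have "Z = {}" using \<alpha> by (auto simp: Z_def zero_set_def supp_def)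
    obtain t0 where t0: "t0 \<in> carrier_vec (dim_col K)" "u0 = K *\<^sub>v t0" using d(4)[OF u0(1)] by blast
    have pos: "0 < dim_col K"
    proof (rule ccontr)
      assume "\<not> 0 < dim_col K"
      then have "u0 = 0\<^sub>v (dim_col \<Xi>)" unfolding t0(2)
        using t0(1) d(1) by (intro eq_vecI) (auto simp: scalar_prod_def)
      then show False using u0(2) by simp
    qed
    have "v = col K 0" using True by (simp add: v_def \<nu>_def K_def)
    also have "\<dots> = K *\<^sub>v unit_vec (dim_col K) 0"
      using pos by (intro eq_vecI) (simp_all add: scalar_prod_right_unit)
    finally show thesis using that[of 0 "unit_vec (dim_col K) 0"] pos \<open>Z = {}\<close> by simp
  next
    case False
    define C where "C = submatrix K Z UNIV"
    define L where "L = ker C"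
    have L: "kernel_matrix C L" using ker L_def by simp
    note dL = kernel_matrixD[OF L]
    have dC: "dim_col C = dim_col K" by (simp add: C_def dim_submatrix)
    define t where "t = col L 0"
    have v: "v = K *\<^sub>v t" using False by (simp add: v_def \<nu>_def Let_def K_def t_def L_def C_def Z_def)
    note kC = submatrix_rows_kernel[OF Z, folded C_def]
    obtain t0 where t0: "t0 \<in> carrier_vec (dim_col K)" "u0 = K *\<^sub>v t0" using d(4)[OF u0(1)] by blast
    have t0k: "t0 \<in> mat_kernel C" using kC[OF t0(1)] t0(2) u0(3) Z_def by simp
    obtain w where w: "w \<in> carrier_vec (dim_col L)" "t0 = L *\<^sub>v w" using dL(4)[OF t0k] by blast
    have pos: "0 < dim_col L"
    proof (rule ccontr)
      assume "\<not> 0 < dim_col L"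
      then have "t0 = 0\<^sub>v (dim_col K)" unfolding w(2)
        using w(1) dL(1) dC by (intro eq_vecI) (auto simp: scalar_prod_def)
      then have "u0 = 0\<^sub>v (dim_col \<Xi>)" unfolding t0(2) using d(1)
        by (intro eq_vecI) (auto simp: scalar_prod_def)
      then show False using u0(2) by simp
    qed
    have tc: "t \<in> carrier_vec (dim_col K)" using dL(1) dC by (intro carrier_vecI) (simp add: t_def)
    have tk: "t \<in> mat_kernel C" using dL(2)[OF pos] by (simp add: t_def)
    have t0': "t \<noteq> 0\<^sub>v (dim_col K)" using dL(3)[OF pos] dC by (simp add: t_def)
    show thesis
    proof (rule that[of "first_nonzero t" t])
      show "first_nonzero t < dim_col K" "t $ first_nonzero t \<noteq> 0" "\<forall>j<first_nonzero t. t $ j = 0"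
        using first_nonzero_props[OF tc t0'] by auto
      show "\<forall>i\<in>Z. (K *\<^sub>v t) $ i = 0" using kC[OF tc] tk by simp
      show "\<forall>t'\<in>carrier_vec (dim_col K). (\<forall>i\<in>Z. (K *\<^sub>v t') $ i = 0) \<longrightarrow> (\<forall>j<first_nonzero t. t' $ j = 0)"
      proof (intro ballI impI allI)
        fix t' j assume t': "t' \<in> carrier_vec (dim_col K)" "\<forall>i\<in>Z. (K *\<^sub>v t') $ i = 0" "j < first_nonzero t"
        then obtain w' where w': "w' \<in> carrier_vec (dim_col L)" "t' = L *\<^sub>v w'" using dL(4)[of t'] kC by blast
        show "t' $ j = 0" using kernel_matrix_echelon(1)[OF L pos w'(1), of j] t'(3) w'(2) t_def by simp
      qed
    qed (use tc v in auto)
  qed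
  note e = kernel_matrix_echelon[OF K rt(1,2)]
  have vdim: "dim_vec v = dim_col \<Xi>" using rt(3) d(1) by simp
  have fn: "first_nonzero v = first_nonzero (col K r)"
    using rt e vdim by (intro first_nonzero_eqI) auto
  show "v \<in> mat_kernel \<Xi>" using mk rt by simp
  show "\<forall>j\<in>zero_set \<alpha>. v $ j = 0" using rt Z_def by simp
  show "first_nonzero v < dim_col \<Xi>" using fn e rt by simp
  show "v $ first_nonzero v \<noteq> 0" unfolding fn using e rt by simp
  fix u i assume u: "u \<in> mat_kernel \<Xi>" "\<forall>j\<in>zero_set \<alpha>. u $ j = 0" "i < first_nonzero v"
  obtain t' where t': "t' \<in> carrier_vec (dim_col K)" "u = K *\<^sub>v t'" using d(4)[OF u(1)] by blast
  then have "\<forall>j<r. t' $ j = 0" using rt(7) u(2) Z_def by blast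
  then show "u $ i = 0" using kernel_matrix_echelon(1)[OF K rt(1) t'(1), of i] u(3) fn t'(2) by simp
qed

section \<open>Linear relations between the columns of a matrix\<close>

lemma card_less_index: "card {j. j < (i :: 's :: {finite, linorder})} < CARD('s)"
  by (rule psubset_card_mono) auto

lemma vec_nth_to_cart: "vec_nth (to_cart v :: real ^ 's :: {finite, linorder}) i = v $ card {j. j < i}"
  by (simp add: to_cart_def)

lemma to_cart_mult:
  assumes "X \<in> carrier_mat CARD('s :: {finite, linorder}) n" "u \<in> carrier_vec n"
  shows "to_cart (X *\<^sub>v u) = (\<Sum>j<n. u $ j *\<^sub>R (to_cart (col X j) :: real ^ 's :: {finite, linorder}))"
proof (rule Finite_Cartesian_Product.vec_eq_iff[THEN iffD2], rule allI)
  fix i :: 's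
  have "vec_nth (to_cart (X *\<^sub>v u)) i = (\<Sum>j<n. X $$ (card {j. j < i}, j) * u $ j)"
    using assms card_less_index[of i] mult_mat_vec_index[of "card {j. j < i}" X u]
    by (simp add: vec_nth_to_cart)
  also have "\<dots> = vec_nth (\<Sum>j<n. u $ j *\<^sub>R (to_cart (col X j) :: real ^ 's :: {finite, linorder})) i"
    using assms card_less_index[of i] by (simp add: vec_nth_to_cart mult.commute)
  finally show "vec_nth (to_cart (X *\<^sub>v u)) i = vec_nth (\<Sum>j<n. u $ j *\<^sub>R (to_cart (col X j) :: real ^ 's :: {finite, linorder})) i" .
qed

lemma to_cart_zero [simp]: "to_cart (0\<^sub>v CARD('s)) = (0 :: real ^ 's :: {finite, linorder})"
  by (simp add: Finite_Cartesian_Product.vec_eq_iff vec_nth_to_cart card_less_index)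

lemma to_cart_eq_zero_iff:
  assumes "v \<in> carrier_vec CARD('s :: {finite, linorder})"
  shows "to_cart v = (0 :: real ^ 's :: {finite, linorder}) \<longleftrightarrow> v = 0\<^sub>v CARD('s)"
  using of_cart_to_cart[OF assms] of_cart_to_cart[of "0\<^sub>v CARD('s)"] to_cart_zero
  by (metis zero_carrier_vec)

definition column :: "real mat \<Rightarrow> nat \<Rightarrow> real ^ 's :: {finite, linorder}" where
  "column X j = to_cart (col X j)"

lemma mat_kernel_iff_relation:
  assumes "X \<in> carrier_mat CARD('s :: {finite, linorder}) n" "u \<in> carrier_vec n"
  shows "u \<in> mat_kernel X \<longleftrightarrow> (\<Sum>j<n. u $ j *\<^sub>R (column X j :: real ^ 's :: {finite, linorder})) = 0"
proof -
  have "X *\<^sub>v u \<in> carrier_vec CARD('s)" using assms by simp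
  from to_cart_eq_zero_iff[OF this] show ?thesis
    unfolding column_def to_cart_mult[OF assms, symmetric] using assms by (auto simp: mat_kernel_def)
qed

text \<open>
  A maximal independent set of columns has as many elements as the rank, hence is a basis, and expanding the
  coordinate vector of a point in it exhibits the point as a combination of columns.
\<close>

lemma span_columns_full_rank:
  assumes X: "X \<in> carrier_mat CARD('s :: {finite, linorder}) n" and r: "vec_space.rank CARD('s) X = CARD('s)"
  shows "Real_Vector_Spaces.span ((column X :: nat \<Rightarrow> real ^ 's :: {finite, linorder}) ` {..<n}) = UNIV"
proof -
  interpret V: vec_space "TYPE(real)" "CARD('s)" .
  have "V.lin_indpt {}" by (simp add: V.lin_dep_def)
  then obtain S where S: "maximal S (\<lambda>T. T \<subseteq> set (cols X) \<and> V.lin_indpt T)"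
    using maximal_exists_superset[of "set (cols X)" "\<lambda>T. T \<subseteq> set (cols X) \<and> V.lin_indpt T" "{}"]
    by auto
  then have Ss: "S \<subseteq> set (cols X)" "V.lin_indpt S" unfolding maximal_def by auto
  have c: "card S = CARD('s)" using V.rank_card_indpt[OF X S] r by simp
  have Sc: "S \<subseteq> carrier_vec CARD('s)" using Ss(1) cols_dim[of X] X by auto
  have finS: "finite S" using Ss(1) finite_subset[OF _ List.finite_set] by auto
  have b: "V.basis S" by (rule V.dim_li_is_basis) (use Sc finS Ss c V.dim_is_n V.fin_dim in auto)
  have "x \<in> Real_Vector_Spaces.span ((column X :: nat \<Rightarrow> real ^ 's :: {finite, linorder}) ` {..<n})" for x
  proof -
    have "of_cart x \<in> V.span S" using b unfolding V.basis_def by (simp add: of_cart_def)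
    then obtain a where a: "of_cart x = V.lincomb a S" using V.finite_in_span[OF finS] Sc by metis
    have "x = (\<Sum>v\<in>S. a v *\<^sub>R (to_cart v :: real ^ 's :: {finite, linorder}))"
    proof (rule Finite_Cartesian_Product.vec_eq_iff[THEN iffD2], rule allI)
      fix i :: 's
      have "vec_nth x i = of_cart x $ card {j. j < i}" using vec_nth_to_cart[of "of_cart x" i] to_cart_of_cart[of x] by simp
      also have "\<dots> = (\<Sum>v\<in>S. a v * v $ card {j. j < i})" unfolding a
        by (rule V.lincomb_index[OF card_less_index Sc])
      finally show "vec_nth x i = vec_nth (\<Sum>v\<in>S. a v *\<^sub>R (to_cart v :: real ^ 's :: {finite, linorder})) i"
        by (simp add: vec_nth_to_cart)
    qed
    moreover have "(to_cart v :: real ^ 's :: {finite, linorder}) \<in> (column X :: nat \<Rightarrow> real ^ 's :: {finite, linorder}) ` {..<n}" if "v \<in> S" for v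
    proof -
      have "v \<in> set (cols X)" using that Ss by blast
      then obtain j where "j < n" "v = col X j" using X unfolding cols_def by auto
      then show ?thesis by (auto simp: column_def)
    qed
    then have "(\<Sum>v\<in>S. a v *\<^sub>R (to_cart v :: real ^ 's :: {finite, linorder})) \<in>
        Real_Vector_Spaces.span ((column X :: nat \<Rightarrow> real ^ 's :: {finite, linorder}) ` {..<n})"
      by (intro span_sum span_scale span_base)
    ultimately show ?thesis by simp
  qed
  then show ?thesis by blast
qed

text \<open>
  The minus sign makes this the adjoint of the product of the derivatives along the \<open>\<xi> j\<close>.
\<close>

definition dir_derivs :: "('i \<Rightarrow> 'a :: euclidean_space) \<Rightarrow> 'i list \<Rightarrow> ('a \<Rightarrow> real) \<Rightarrow> 'a \<Rightarrow> real" where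
  "dir_derivs \<xi> js f = foldr (\<lambda>j. dir_deriv (- \<xi> j)) js f"

lemma dir_derivs_Nil_Cons [simp]: "dir_derivs \<xi> [] f = f" "dir_derivs \<xi> (j # js) f = dir_deriv (- \<xi> j) (dir_derivs \<xi> js f)"
  by (simp_all add: dir_derivs_def)

lemma dir_derivs_append: "dir_derivs \<xi> (is @ js) f = dir_derivs \<xi> is (dir_derivs \<xi> js f)"
  by (simp add: dir_derivs_def)

lemma test_function_dir_derivs: "test_function f \<Longrightarrow> test_function (dir_derivs \<xi> js f)"
  by (induction js) (auto intro: test_function_dir_deriv)

lemma dir_deriv_commute_test: "test_function f \<Longrightarrow> dir_deriv v (dir_deriv w f) = dir_deriv w (dir_deriv v f)"
  using dir_deriv_commute test_function_iff by blast

lemma dir_deriv_dir_derivs: "test_function f \<Longrightarrow> dir_deriv v (dir_derivs \<xi> js f) = dir_derivs \<xi> js (dir_deriv v f)"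
proof (induction js)
  case (Cons j js)
  then show ?case
    using dir_deriv_commute_test[OF test_function_dir_derivs[OF Cons.prems], of v "- \<xi> j" \<xi> js] by (simp only: dir_derivs_Nil_Cons)
qed simp

text \<open>
  Commuting derivatives may be reordered; hence the columns dropped by the recursion can be collected in a list
  without keeping track of the order of the steps.
\<close>

lemma dir_derivs_perm:
  assumes "mset is = mset js" "test_function f"
  shows "dir_derivs \<xi> is f = dir_derivs \<xi> js f"
  using assms(1)
proof (induction "is" arbitrary: js)
  case (Cons i "is")
  then have "i \<in> set js" by (metis list.set_intros(1) set_mset_mset)
  then obtain as bs where js: "js = as @ i # bs" by (meson split_list)
  have "mset is = mset (as @ bs)" using Cons.prems js by simp
  from Cons.IH[OF this]
  have "dir_derivs \<xi> (i # is) f = dir_deriv (- \<xi> i) (dir_derivs \<xi> as (dir_derivs \<xi> bs f))"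
    by (simp only: dir_derivs_append dir_derivs_Nil_Cons)
  also have "\<dots> = dir_derivs \<xi> js f"
    using dir_deriv_dir_derivs[OF test_function_dir_derivs[OF assms(2)]] js by (simp add: dir_derivs_append)
  finally show ?case .
qed simp

text \<open>
  Iterates \<open>cone_pairing_dir_deriv\<close>, raising the exponents at all \<open>js\<close> by one. All intermediate supports
  lie in the independent family \<open>A\<close>.
\<close>

lemma cone_pairing_dir_derivs:
  assumes A: "finite A" "lin_indep_family \<xi> A" and \<gamma>: "{i. \<gamma> i \<noteq> 0} \<subseteq> A"
    and B: "set js \<subseteq> A" "distinct js" and f: "test_function f"
  shows "cone_pairing \<xi> (\<lambda>i. \<gamma> i + of_bool (i \<in> set js)) (dir_derivs \<xi> js f) = cone_pairing \<xi> \<gamma> f"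
  using B
proof (induction js)
  case (Cons j js)
  let ?\<gamma> = "\<lambda>i. \<gamma> i + of_bool (i \<in> set js)"
  have sub: "{i. ?\<gamma> i \<noteq> 0} \<subseteq> A" using \<gamma> Cons.prems by (auto split: if_splits)
  have eq: "(\<lambda>i. \<gamma> i + of_bool (i \<in> set (j # js))) = ?\<gamma>(j := Suc (?\<gamma> j))"
    using Cons.prems by auto
  have "cone_pairing \<xi> (\<lambda>i. \<gamma> i + of_bool (i \<in> set (j # js))) (dir_derivs \<xi> (j # js) f)
      = cone_pairing \<xi> ?\<gamma> (dir_derivs \<xi> js f)"
    unfolding eq dir_derivs_Nil_Cons
  proof (rule cone_pairing_dir_deriv)
    show "finite {i. ?\<gamma> i \<noteq> 0}" using sub A(1) by (rule finite_subset)
    show "lin_indep_family \<xi> (insert j {i. ?\<gamma> i \<noteq> 0})"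
      by (rule lin_indep_family_subset[OF A]) (use sub Cons.prems in simp)
  qed (rule test_function_dir_derivs[OF f])
  then show ?case using Cons by simp
qed simp

lemma sum_mset_bind:
  "(\<Sum>y\<in>#(\<Sum>x\<in>#M. g x). F y) = (\<Sum>x\<in>#M. \<Sum>y\<in>#g x. (F y :: 'b :: comm_monoid_add))"
  by (induction M) simp_all

lemma spanning_family_indep:
  fixes \<xi> :: "nat \<Rightarrow> 'a :: euclidean_space"
  assumes A: "finite A" "card A = DIM('a)" and span: "Real_Vector_Spaces.span (\<xi> ` A) = UNIV"
  shows "lin_indep_family \<xi> A"
proof -
  have "Real_Vector_Spaces.dim (UNIV :: 'a set) \<le> card (\<xi> ` A)"
    using span_card_ge_dim[of "\<xi> ` A" UNIV] span A by simp
  then have c: "card (\<xi> ` A) = card A" using card_image_le[OF A(1), of \<xi>] A by simp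
  then have inj: "inj_on \<xi> A" using eq_card_imp_inj_on A by blast
  have ind: "independent (\<xi> ` A)"
    by (rule card_le_dim_spanning[of _ UNIV]) (use span A c in auto)
  show ?thesis unfolding lin_indep_family_def
  proof (intro allI impI ballI)
    fix u i assume u: "(\<Sum>i\<in>A. u i *\<^sub>R \<xi> i) = 0" and i: "i \<in> A"
    have u0: "(\<Sum>v\<in>\<xi> ` A. u (the_inv_into A \<xi> v) *\<^sub>R v) = 0"
      using u by (simp add: sum.reindex[OF inj] the_inv_into_f_f[OF inj])
    have "\<forall>v\<in>\<xi> ` A. w v = 0" if "(\<Sum>v\<in>\<xi> ` A. w v *\<^sub>R v) = 0" for w
      using ind that unfolding dependent_finite[OF finite_imageI[OF A(1)]] by blast
    from this[OF u0] have "u (the_inv_into A \<xi> (\<xi> i)) = 0" using i by blast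
    then show "u i = 0" using i by (simp add: the_inv_into_f_f[OF inj])
  qed
qed

lemma many_vectors_relation:
  fixes \<xi> :: "nat \<Rightarrow> 'a :: euclidean_space"
  assumes "finite A" "card A > DIM('a)"
  obtains u i where "(\<Sum>i\<in>A. u i *\<^sub>R \<xi> i) = 0" "i \<in> A" "u i \<noteq> 0"
proof -
  have "\<not> lin_indep_family \<xi> A"
  proof
    assume l: "lin_indep_family \<xi> A"
    have "card (\<xi> ` A) \<le> DIM('a)"
      using independent_card_le[OF lin_indep_family_independent[OF assms(1) l]] .
    then show False using card_image[OF lin_indep_family_inj[OF assms(1) l]] assms(2) by simp
  qed
  then show ?thesis using that unfolding lin_indep_family_def by blast
qed

section \<open>The recursion for \<open>P\<close>\<close>

text \<open>
  The exponents \<open>\<alpha> - 1\<close> on the support of \<open>\<alpha>\<close>; truncated subtraction gives 0 outside the support as well.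
\<close>

definition excess :: "nat vec \<Rightarrow> nat \<Rightarrow> nat" where
  "excess \<alpha> i = (if i < dim_vec \<alpha> then \<alpha> $ i - 1 else 0)"

definition entries :: "nat vec \<Rightarrow> nat \<Rightarrow> nat" where
  "entries \<alpha> i = (if i < dim_vec \<alpha> then \<alpha> $ i else 0)"

definition dropped :: "nat vec \<Rightarrow> nat list" where
  "dropped \<alpha> = filter (\<lambda>j. \<alpha> $ j = 0) [0..<dim_vec \<alpha>]"

text \<open>
  The invariant of the recursion after \<open>k\<close> steps. Its last part says that no relation between
  columns in the support of \<open>\<alpha>\<close> starts before a raised entry. Together with the minimality of the next pivot
  it makes the raised columns and the pivot column linearly independent, and it forces the entries of the support
  after the pivot to be still 1.
\<close>

definition admissible :: "(nat \<Rightarrow> 'a :: euclidean_space) \<Rightarrow> nat \<Rightarrow> nat \<Rightarrow> nat vec \<Rightarrow> bool" where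
  "admissible \<xi> n k \<alpha> \<longleftrightarrow> dim_vec \<alpha> = n \<and> card (supp \<alpha>) = n - k \<and>
    Real_Vector_Spaces.span (\<xi> ` supp \<alpha>) = UNIV \<and>
    (\<forall>u. (\<Sum>j\<in>supp \<alpha>. u j *\<^sub>R \<xi> j) = 0 \<longrightarrow>
      (\<forall>r\<in>supp \<alpha>. \<alpha> $ r \<ge> 2 \<longrightarrow> (\<forall>i\<in>supp \<alpha>. i < r \<longrightarrow> u i = 0)))"

lemma finite_supp: "finite (supp \<alpha>)"
  by (simp add: supp_def)

lemma sum_extend_supp:
  fixes \<xi> :: "nat \<Rightarrow> 'a :: euclidean_space"
  assumes "dim_vec \<alpha> = n" "A \<subseteq> supp \<alpha>"
  shows "(\<Sum>j<n. (if j \<in> A then u j else 0) *\<^sub>R \<xi> j) = (\<Sum>j\<in>A. u j *\<^sub>R \<xi> j)"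
proof -
  have "A \<subseteq> {..<n}" using assms by (auto simp: supp_def)
  then show ?thesis by (intro sum.mono_neutral_cong_right) auto
qed

text \<open>
  \<open>nu_minimal_pivot\<close> in terms of relations between the points \<open>column \<Xi> j\<close>: more than \<open>s\<close> columns
  are dependent, so a nonzero relation exists.
\<close>

lemma pivot_of_relations:
  fixes \<Xi> :: "real mat" and ker :: "real mat \<Rightarrow> real mat"
  assumes carrier: "\<Xi> \<in> carrier_mat CARD('s :: {finite, linorder}) n"
    and ker: "\<forall>X. kernel_matrix X (ker X)"
    and \<alpha>: "dim_vec \<alpha> = n" "card (supp \<alpha>) > CARD('s)"
  defines "v \<equiv> \<nu> ker \<Xi> \<alpha>" and "\<xi> \<equiv> column \<Xi> :: nat \<Rightarrow> real ^ 's :: {finite, linorder}"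
  defines "m \<equiv> first_nonzero v"
  shows "m \<in> supp \<alpha>" "v $ m \<noteq> 0" "\<And>i. i < m \<Longrightarrow> v $ i = 0"
    "\<And>j. j < n \<Longrightarrow> v $ j \<noteq> 0 \<Longrightarrow> j \<in> supp \<alpha>"
    "(\<Sum>j\<in>supp \<alpha>. v $ j *\<^sub>R \<xi> j) = 0"
    "\<And>u i. (\<Sum>j\<in>supp \<alpha>. u j *\<^sub>R \<xi> j) = 0 \<Longrightarrow> i \<in> supp \<alpha> \<Longrightarrow> i < m \<Longrightarrow> u i = 0"
proof -
  have n: "dim_col \<Xi> = n" using carrier by simp
  define E where "E u = Matrix.vec n (\<lambda>j. if j \<in> supp \<alpha> then u j else (0::real))" for u
  have Ek: "E u \<in> mat_kernel \<Xi>" if "(\<Sum>j\<in>supp \<alpha>. u j *\<^sub>R \<xi> j) = 0" for u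
  proof -
    have "(\<Sum>j<n. E u $ j *\<^sub>R \<xi> j) = 0"
      using that sum_extend_supp[OF \<alpha>(1) subset_refl, of u \<xi>] by (simp add: E_def)
    then show ?thesis using mat_kernel_iff_relation[OF carrier, of "E u"] by (simp add: E_def \<xi>_def)
  qed
  have Ez: "\<forall>j\<in>zero_set \<alpha>. E u $ j = 0" for u
    using \<alpha>(1) by (auto simp: E_def zero_set_def supp_def)
  have "DIM(real ^ 's :: {finite, linorder}) < card (supp \<alpha>)" using \<alpha>(2) by simp
  then obtain u0 i0 where u0: "(\<Sum>i\<in>supp \<alpha>. u0 i *\<^sub>R \<xi> i) = 0" "i0 \<in> supp \<alpha>" "u0 i0 \<noteq> 0"
    using many_vectors_relation[OF finite_supp] by blast
  have "E u0 $ i0 \<noteq> 0" "i0 < n" using u0 \<alpha>(1) by (auto simp: E_def supp_def)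
  then have Enz: "E u0 \<noteq> 0\<^sub>v (dim_col \<Xi>)" using n by auto
  note P = nu_minimal_pivot[OF ker \<alpha>(1)[folded n] Ek[OF u0(1)] Enz Ez, folded v_def m_def]
  have vk: "v \<in> mat_kernel \<Xi>" by (rule P(1))
  then have vc: "v \<in> carrier_vec n" using n by (simp add: mat_kernel_def)
  show js: "j \<in> supp \<alpha>" if "j < n" "v $ j \<noteq> 0" for j
    using P(2) that \<alpha>(1) by (auto simp: supp_def zero_set_def)
  show "v $ m \<noteq> 0" by (rule P(4))
  then show "m \<in> supp \<alpha>" using js P(3) n by simp
  show "v $ i = 0" if "i < m" for i
    by (rule P(5)[OF vk P(2) that])
  have "(\<Sum>j<n. v $ j *\<^sub>R \<xi> j) = (\<Sum>j\<in>supp \<alpha>. v $ j *\<^sub>R \<xi> j)"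
    using js \<alpha>(1) by (intro sum.mono_neutral_right) (auto simp: supp_def)
  then show "(\<Sum>j\<in>supp \<alpha>. v $ j *\<^sub>R \<xi> j) = 0"
    using mat_kernel_iff_relation[OF carrier vc] vk by (simp add: \<xi>_def)
  show "u i = 0" if "(\<Sum>j\<in>supp \<alpha>. u j *\<^sub>R \<xi> j) = 0" "i \<in> supp \<alpha>" "i < m" for u i
    using P(5)[OF Ek[OF that(1)] Ez that(3)] that(2) \<alpha>(1) by (simp add: E_def supp_def)
qed

text \<open>
  One step of the recursion. Raise the exponent at the pivot \<open>m\<close> by one at the cost of a derivative along
  \<open>\<xi> m\<close>, and replace \<open>\<xi> m\<close> by its expansion in the later columns occurring in \<open>\<nu>\<close>. The coefficients of this
  expansion are those of \<open>P_step\<close>, and the derivative along \<open>\<xi> j\<close> belongs to the newly dropped column \<open>j\<close>.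
\<close>

lemma P_step_admissible_pairing:
  fixes \<Xi> :: "real mat" and ker :: "real mat \<Rightarrow> real mat"
  assumes carrier: "\<Xi> \<in> carrier_mat CARD('s :: {finite, linorder}) n"
    and ker: "\<forall>X. kernel_matrix X (ker X)"
    and nonzero: "\<forall>j<n. column \<Xi> j \<noteq> (0 :: real ^ 's :: {finite, linorder})"
    and k: "k < n - CARD('s)" and adm: "admissible (column \<Xi> :: nat \<Rightarrow> real ^ 's :: {finite, linorder}) n k \<alpha>"
  shows "\<forall>(c', \<alpha>') \<in># P_step ker \<Xi> (c, \<alpha>). admissible (column \<Xi> :: nat \<Rightarrow> real ^ 's :: {finite, linorder}) n (Suc k) \<alpha>'"
    and "test_function f \<Longrightarrow> (\<Sum>(c', \<alpha>')\<in>#P_step ker \<Xi> (c, \<alpha>).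
        c' * cone_pairing (column \<Xi> :: nat \<Rightarrow> real ^ 's :: {finite, linorder}) (excess \<alpha>') (dir_derivs (column \<Xi>) (dropped \<alpha>') f))
      = c * cone_pairing (column \<Xi>) (excess \<alpha>) (dir_derivs (column \<Xi>) (dropped \<alpha>) f)"
proof -
  define \<xi> where "\<xi> = (column \<Xi> :: nat \<Rightarrow> real ^ 's :: {finite, linorder})"
  define A where "A = supp \<alpha>"
  define v where "v = \<nu> ker \<Xi> \<alpha>"
  define m where "m = first_nonzero v"
  define J where "J = {j. m < j \<and> j < n \<and> v $ j \<noteq> 0}"
  have \<alpha>: "dim_vec \<alpha> = n" "card A = n - k" "Real_Vector_Spaces.span (\<xi> ` A) = UNIV"
    and rel: "\<And>u r i. (\<Sum>j\<in>A. u j *\<^sub>R \<xi> j) = 0 \<Longrightarrow> r \<in> A \<Longrightarrow> \<alpha> $ r \<ge> 2 \<Longrightarrow> i \<in> A \<Longrightarrow> i < r \<Longrightarrow> u i = 0"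
    using adm unfolding admissible_def A_def \<xi>_def by blast+
  have n: "dim_col \<Xi> = n" using carrier by simp
  have fin: "finite A" "finite J" by (simp_all add: A_def J_def finite_supp)
  have "card (supp \<alpha>) > CARD('s)" using \<alpha>(2) k by (simp add: A_def)
  note P = pivot_of_relations[OF carrier ker \<alpha>(1) this, folded \<xi>_def v_def A_def, folded m_def]
  have An: "A \<subseteq> {..<n}" using \<alpha>(1) by (auto simp: A_def supp_def)
  have mn: "m < n" using P(1) An by auto
  have JA: "J \<subseteq> A" using P(4) by (auto simp: J_def)
  \<comment> \<open>The relation \<open>v\<close> is nonzero at \<open>m\<close>, so \<open>m\<close> is not before a raised entry.\<close>
  have R: "r \<le> m" if "r \<in> A" "\<alpha> $ r \<ge> 2" for r
    using rel[OF P(5) that P(1)] P(2) by (meson not_less)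
  have one: "\<alpha> $ j = 1" if "j \<in> J" for j
  proof -
    have "j \<in> A" "m < j" using that JA by (auto simp: J_def)
    then have "\<alpha> $ j \<noteq> 0" "\<not> \<alpha> $ j \<ge> 2" using R[of j] by (auto simp: A_def supp_def)
    then show ?thesis by simp
  qed
  have suppj: "supp (shift_entry m j \<alpha>) = A - {j}" if "j \<in> J" for j
  proof -
    have "m \<noteq> j" "m \<in> A" using that P(1) by (auto simp: J_def)
    then show ?thesis using one[OF that] \<alpha>(1)
      by (auto simp: supp_def shift_entry_def A_def split: if_splits)
  qed
  have sm: "(\<Sum>j\<in>J. - (v $ j / v $ m) *\<^sub>R \<xi> j) = \<xi> m"
  proof -
    have "(\<Sum>j\<in>A. v $ j *\<^sub>R \<xi> j) = (\<Sum>j\<in>insert m J. v $ j *\<^sub>R \<xi> j)"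
    proof (rule sum.mono_neutral_right)
      show "\<forall>j\<in>A - insert m J. v $ j *\<^sub>R \<xi> j = 0"
        using P(3) An by (auto simp: J_def) (metis lessThan_iff linorder_neqE_nat subsetD)
    qed (use fin JA P(1) in auto)
    also have "\<dots> = v $ m *\<^sub>R \<xi> m + (\<Sum>j\<in>J. v $ j *\<^sub>R \<xi> j)"
      using fin by (simp add: J_def)
    finally have "(\<Sum>j\<in>J. v $ j *\<^sub>R \<xi> j) = - (v $ m *\<^sub>R \<xi> m)"
      using P(5) by (simp add: eq_neg_iff_add_eq_0 add.commute)
    then have "(- 1 / v $ m) *\<^sub>R (\<Sum>j\<in>J. v $ j *\<^sub>R \<xi> j) = \<xi> m"
      using P(2) by simp
    then show ?thesis by (simp add: scaleR_sum_right)
  qed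
  have stepJ: "P_step ker \<Xi> (c, \<alpha>) = image_mset (\<lambda>j. (- c * (v $ j / v $ m), shift_entry m j \<alpha>)) (mset_set J)"
    by (simp add: P_step_def Let_def v_def m_def J_def n)
  show "\<forall>(c', \<alpha>') \<in># P_step ker \<Xi> (c, \<alpha>). admissible (column \<Xi> :: nat \<Rightarrow> real ^ 's :: {finite, linorder}) n (Suc k) \<alpha>'"
  proof -
    have "admissible \<xi> n (Suc k) (shift_entry m j \<alpha>)" if j: "j \<in> J" for j
      unfolding admissible_def suppj[OF j]
    proof (intro conjI allI impI ballI)
      show "dim_vec (shift_entry m j \<alpha>) = n" using \<alpha>(1) by (simp add: shift_entry_def)
      have jA: "j \<in> A" using j JA by auto
      show "card (A - {j}) = n - Suc k" using jA fin \<alpha>(2) by simp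
      let ?S = "Real_Vector_Spaces.span (\<xi> ` (A - {j}))"
      have vj: "v $ j \<noteq> 0" using j by (simp add: J_def)
      have "v $ j *\<^sub>R \<xi> j = - (\<Sum>i\<in>A - {j}. v $ i *\<^sub>R \<xi> i)"
        using P(5) sum.remove[OF fin(1) jA, of "\<lambda>i. v $ i *\<^sub>R \<xi> i"] by (simp add: eq_neg_iff_add_eq_0)
      moreover have "\<dots> \<in> ?S" by (intro span_neg span_sum span_scale span_base imageI)
      ultimately have "(1 / v $ j) *\<^sub>R (v $ j *\<^sub>R \<xi> j) \<in> ?S" using span_scale by metis
      then have "\<xi> j \<in> ?S" using vj by simp
      then have "\<xi> i \<in> ?S" if "i \<in> A" for i
        using that span_base[of "\<xi> i" "\<xi> ` (A - {j})"] by (cases "i = j") auto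
      then have "\<xi> ` A \<subseteq> ?S" by auto
      then have "Real_Vector_Spaces.span (\<xi> ` A) \<subseteq> ?S" by (rule span_minimal) (rule subspace_span)
      then show "?S = UNIV" using \<alpha>(3) by auto
      fix u r i assume u: "(\<Sum>j\<in>A - {j}. u j *\<^sub>R \<xi> j) = 0"
        and r: "r \<in> A - {j}" "2 \<le> shift_entry m j \<alpha> $ r" and i: "i \<in> A - {j}" "i < r"
      have "r = m \<or> \<alpha> $ r \<ge> 2" using r \<alpha>(1) An by (auto simp: shift_entry_def split: if_splits)
      then have "r \<le> m" using R r by auto
      then have im: "i < m" using i by simp
      have "(\<Sum>i\<in>A. (if i = j then 0 else u i) *\<^sub>R \<xi> i) = 0"
        using sum.remove[OF fin(1) jA, of "\<lambda>i. (if i = j then 0 else u i) *\<^sub>R \<xi> i"] u by simp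
      from P(6)[OF this _ im] show "u i = 0" using i by simp
    qed
    then show ?thesis unfolding stepJ using fin by (auto simp: \<xi>_def)
  qed
  assume f: "test_function f"
  define g where "g = dir_derivs \<xi> (dropped \<alpha>) f"
  have g: "test_function g" unfolding g_def by (rule test_function_dir_derivs[OF f])
  let ?\<gamma> = "excess \<alpha>" and ?\<gamma>' = "(excess \<alpha>)(m := Suc (excess \<alpha> m))"
  have exs: "{i. ?\<gamma> i \<noteq> 0} = {r \<in> A. \<alpha> $ r \<ge> 2}"
    using \<alpha>(1) by (auto simp: excess_def A_def supp_def)
  define R' where "R' = insert m {i. ?\<gamma> i \<noteq> 0}"
  have R'A: "R' \<subseteq> A" using P(1) exs by (auto simp: R'_def)
  have finR: "finite R'" using R'A fin finite_subset by blast
  \<comment> \<open>A relation on \<open>R'\<close> vanishes before \<open>m\<close>, and \<open>R'\<close> has no element after \<open>m\<close>; what remains is a\<close>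
  \<comment> \<open>multiple of the nonzero vector \<open>\<xi> m\<close>.\<close>
  have ind: "lin_indep_family \<xi> R'"
    unfolding lin_indep_family_def
  proof (intro allI impI)
    fix u assume u: "(\<Sum>i\<in>R'. u i *\<^sub>R \<xi> i) = 0"
    have "(\<Sum>i\<in>A. (if i \<in> R' then u i else 0) *\<^sub>R \<xi> i) = (\<Sum>i\<in>R'. u i *\<^sub>R \<xi> i)"
      using R'A fin by (intro sum.mono_neutral_cong_right) auto
    then have l: "u i = 0" if "i \<in> R'" "i < m" for i
      using P(6)[of "\<lambda>i. if i \<in> R' then u i else 0" i] that R'A u by auto
    have "R' \<subseteq> {..m}" using R exs by (auto simp: R'_def)
    then have l2: "u i = 0" if "i \<in> R'" "i \<noteq> m" for i using l that by force
    have "(\<Sum>i\<in>R'. u i *\<^sub>R \<xi> i) = (\<Sum>i\<in>{m}. u i *\<^sub>R \<xi> i)"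
      using l2 finR by (intro sum.mono_neutral_right) (auto simp: R'_def)
    then have "u m = 0" using u nonzero mn by (simp add: \<xi>_def)
    then show "\<forall>i\<in>R'. u i = 0" using l2 by blast
  qed
  have s': "{i. ?\<gamma>' i \<noteq> 0} = R'" by (auto simp: R'_def)
  have dg: "dir_deriv (- \<xi> m) g x = (\<Sum>j\<in>J. - (v $ j / v $ m) * dir_deriv (- \<xi> j) g x)" for x
  proof -
    have "Ck (Suc 0) g" using g test_function_iff by blast
    then interpret linear "\<lambda>h. dir_deriv h g x" using dir_deriv_linear Ck_Suc_iff by blast
    have "- \<xi> m = (\<Sum>j\<in>J. - (v $ j / v $ m) *\<^sub>R (- \<xi> j))"
      unfolding sm[symmetric] by (simp add: sum_negf)
    from arg_cong[OF this, of "\<lambda>h. dir_deriv h g x"] show ?thesis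
      by (simp only: sum scaleR real_scaleR_def)
  qed
  have "cone_pairing \<xi> ?\<gamma> g = cone_pairing \<xi> ?\<gamma>' (dir_deriv (- \<xi> m) g)"
    by (rule cone_pairing_dir_deriv[symmetric]) (use finR ind g in \<open>auto simp: R'_def\<close>)
  also have "\<dots> = (\<Sum>j\<in>J. - (v $ j / v $ m) * cone_pairing \<xi> ?\<gamma>' (dir_deriv (- \<xi> j) g))"
    unfolding dg[abs_def] by (rule cone_pairing_sum) (use finR ind s' in \<open>auto intro: test_function_dir_deriv g\<close>)
  also have "\<dots> = (\<Sum>j\<in>J. - (v $ j / v $ m) *
      cone_pairing \<xi> (excess (shift_entry m j \<alpha>)) (dir_derivs \<xi> (dropped (shift_entry m j \<alpha>)) f))"
  proof (rule sum.cong[OF refl])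
    fix j assume j: "j \<in> J"
    have mj: "m \<noteq> j" "m \<in> A" "j \<in> A" using j P(1) JA by (auto simp: J_def)
    \<comment> \<open>Lowering entry \<open>j\<close> from 1 to 0 does not change the excess, which is 0 for both.\<close>
    have "?\<gamma>' = excess (shift_entry m j \<alpha>)"
      using mj one[OF j] \<alpha>(1) by (auto simp: excess_def shift_entry_def A_def supp_def fun_eq_iff)
    moreover have "dir_deriv (- \<xi> j) g = dir_derivs \<xi> (dropped (shift_entry m j \<alpha>)) f"
    proof -
      have "mset (dropped \<beta>) = mset_set ({..<n} - supp \<beta>)" if "dim_vec \<beta> = n" for \<beta>
      proof -
        have "mset (dropped \<beta>) = mset_set (set (dropped \<beta>))"
          by (rule mset_set_set[symmetric]) (simp add: dropped_def)
        also have "set (dropped \<beta>) = {..<n} - supp \<beta>" using that by (auto simp: dropped_def supp_def)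
        finally show ?thesis .
      qed
      note md = this
      have "mset (j # dropped \<alpha>) = mset (dropped (shift_entry m j \<alpha>))"
      proof -
        have "{..<n} - (A - {j}) = insert j ({..<n} - A)" using mj An by auto
        then show ?thesis using md[of \<alpha>] md[of "shift_entry m j \<alpha>"] \<alpha>(1) suppj[OF j] mj
          by (simp add: shift_entry_def A_def)
      qed
      from dir_derivs_perm[OF this f] show ?thesis by (simp add: g_def)
    qed
    ultimately show "- (v $ j / v $ m) * cone_pairing \<xi> ?\<gamma>' (dir_deriv (- \<xi> j) g) = - (v $ j / v $ m) *
      cone_pairing \<xi> (excess (shift_entry m j \<alpha>)) (dir_derivs \<xi> (dropped (shift_entry m j \<alpha>)) f)" by simp
  qed
  finally have eq: "cone_pairing \<xi> ?\<gamma> g = (\<Sum>j\<in>J. - (v $ j / v $ m) *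
      cone_pairing \<xi> (excess (shift_entry m j \<alpha>)) (dir_derivs \<xi> (dropped (shift_entry m j \<alpha>)) f))" .
  show "(\<Sum>(c', \<alpha>')\<in>#P_step ker \<Xi> (c, \<alpha>).
        c' * cone_pairing (column \<Xi> :: nat \<Rightarrow> real ^ 's :: {finite, linorder}) (excess \<alpha>') (dir_derivs (column \<Xi>) (dropped \<alpha>') f))
      = c * cone_pairing (column \<Xi>) (excess \<alpha>) (dir_derivs (column \<Xi>) (dropped \<alpha>) f)"
    unfolding stepJ \<xi>_def[symmetric] g_def[symmetric] eq
    by (simp add: multiset.map_comp o_def sum_unfold_sum_mset[symmetric] sum_distrib_left mult.assoc)
qed

section \<open>Cone integrals as integrals over Euclidean space\<close>

text \<open>
  Volumes of images under linear maps refer to index types of class \<open>wellorder\<close>. A finite linear order is a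
  well-order, though not by a class inclusion; the copy \<open>'a wo\<close> of a type carries that instance.
\<close>

datatype 'a wo = Wo (unwo: 'a)

lemma bij_Wo: "bij Wo"
  by (rule bijI') (simp, metis wo.exhaust)

instance wo :: (finite) finite
proof
  have "(UNIV :: 'a wo set) = Wo ` UNIV" using bij_is_surj[OF bij_Wo] by (rule sym)
  then show "finite (UNIV :: 'a wo set)" by (metis finite finite_imageI)
qed

instantiation wo :: (linorder) linorder
begin
definition "x \<le> y \<longleftrightarrow> unwo x \<le> unwo y"
definition "x < y \<longleftrightarrow> unwo x < unwo y"
instance by standard (auto simp: less_eq_wo_def less_wo_def intro: wo.expand)
end

instance wo :: ("{finite, linorder}") wellorder
proof
  fix P :: "'a wo \<Rightarrow> bool" and a :: "'a wo"
  assume step: "\<And>x. (\<And>y. y < x \<Longrightarrow> P y) \<Longrightarrow> P x"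
  show "P a"
  proof (induction "card {y. y < a}" arbitrary: a rule: less_induct)
    case less
    show ?case
    proof (rule step)
      fix y assume "y < a"
      then show "P y" by (intro less psubset_card_mono) auto
    qed
  qed
qed

text \<open>
  The scaled image measure agrees with the Lebesgue measure on boxes, whose preimages are their images under the
  inverse map. Arguing with measures covers functions that are not integrable as well.
\<close>

lemma lborel_linear_image:
  fixes L :: "real ^ 'n :: {finite, wellorder} \<Rightarrow> real ^ 'n :: {finite, wellorder}"
  assumes L: "linear L" and d: "Determinants.det (matrix L) \<noteq> 0"
    and h: "h \<in> borel_measurable borel"
  shows "(\<integral>y. h (L y) \<partial>lborel) = (\<integral>x. h x / \<bar>Determinants.det (matrix L)\<bar> \<partial>lborel :: real)"
proof -
  let ?d = "Determinants.det (matrix L)"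
  have inj: "inj L" using det_nz_iff_inj[OF L] d by simp
  obtain K where K: "linear K" "K \<circ> L = id" "L \<circ> K = id"
    using linear_injective_isomorphism[OF L inj] by (auto simp: fun_eq_iff)
  have KL: "K (L x) = x" "L (K x) = x" for x using K by (metis comp_apply id_apply)+
  have "Determinants.det (matrix (L \<circ> K)) = ?d * Determinants.det (matrix K)"
    by (simp add: matrix_compose[OF K(1) L] det_mul)
  then have dd: "?d * Determinants.det (matrix K) = 1" by (simp add: K(3) matrix_id_mat_1)
  have LK[measurable]: "L \<in> borel_measurable borel" "K \<in> borel_measurable borel"
    using L K(1) by (auto intro!: borel_measurable_continuous_onI linear_continuous_on simp: linear_linear)
  let ?M = "density (distr lborel borel L) (\<lambda>_. ennreal \<bar>?d\<bar>)"
  have M: "lborel = ?M"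
  proof (rule lborel_eqI)
    fix l u :: "real ^ 'n :: {finite, wellorder}"
    assume le: "\<And>b. b \<in> Basis \<Longrightarrow> l \<bullet> b \<le> u \<bullet> b"
    have pre: "L -` box l u = K ` box l u" 
    proof (intro Set.set_eqI iffI)
      show "x \<in> K ` box l u" if "x \<in> L -` box l u" for x
        using that KL(1)[of x] by (metis imageI vimageD)
      show "x \<in> L -` box l u" if "x \<in> K ` box l u" for x
        using that by (elim imageE) (simp only: vimage_eq KL)
    qed
    have m: "box l u \<in> lmeasurable" by simp
    have Km: "K ` box l u \<in> lmeasurable" by (rule measurable_linear_image[OF K(1) m])
    have Kb: "K ` box l u \<in> sets borel" 
      unfolding pre[symmetric] by (rule measurable_sets_borel[OF LK(1)]) simp
    have "emeasure ?M (box l u) = ennreal \<bar>?d\<bar> * emeasure lborel (K ` box l u)"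
      by (simp add: emeasure_density_const emeasure_distr pre)
    also have "emeasure lborel (K ` box l u) = emeasure lebesgue (K ` box l u)" using Kb by simp
    also have "\<dots> = ennreal (measure lebesgue (K ` box l u))"
      using emeasure_eq_measure2[OF Km] by simp
    also have "measure lebesgue (K ` box l u) = \<bar>Determinants.det (matrix K)\<bar> * measure lebesgue (box l u)"
      by (rule measure_linear_image[OF K(1) m])
    also have "ennreal \<bar>?d\<bar> * ennreal (\<bar>Determinants.det (matrix K)\<bar> * measure lebesgue (box l u)) =
        ennreal (measure lebesgue (box l u))"
      using dd by (simp add: ennreal_mult[symmetric] mult.assoc[symmetric] abs_mult[symmetric])
    also have "measure lebesgue (box l u) = (\<Prod>b\<in>Basis. (u - l) \<bullet> b)"
      using le by (simp add: measure_lborel_box_eq)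
    finally show "emeasure ?M (box l u) = (\<Prod>b\<in>Basis. (u - l) \<bullet> b)" .
  qed simp
  have "(\<integral>x. h x / \<bar>?d\<bar> \<partial>lborel) = (\<integral>x. h x / \<bar>?d\<bar> \<partial>?M)" using M by simp
  also have "\<dots> = (\<integral>x. \<bar>?d\<bar> *\<^sub>R (h x / \<bar>?d\<bar>) \<partial>(distr lborel borel L))"
    by (rule integral_density) (use h in auto)
  also have "\<dots> = (\<integral>y. \<bar>?d\<bar> *\<^sub>R (h (L y) / \<bar>?d\<bar>) \<partial>lborel)"
    by (rule integral_distr) (use h in auto)
  finally show ?thesis using d by simp
qed

lemma measurable_from_coordinates:
  fixes \<sigma> :: "'n :: finite \<Rightarrow> 'i"
  assumes \<sigma>A: "\<And>k. \<sigma> k \<in> A"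
  shows "(\<lambda>t. vec_lambda (\<lambda>k. t (\<sigma> k)) :: real ^ 'n) \<in> borel_measurable (\<Pi>\<^sub>M i\<in>A. lborel)"
proof (rule borel_measurable_euclidean_space[THEN iffD2], rule ballI)
  fix b :: "real ^ 'n" assume "b \<in> Basis"
  then obtain k where b: "b = axis k 1" by (auto simp: Basis_vec_def)
  have "(\<lambda>t. t (\<sigma> k)) \<in> borel_measurable (\<Pi>\<^sub>M i\<in>A. lborel :: real measure)"
    using measurable_component_singleton[OF \<sigma>A, where M = "\<lambda>_. lborel :: real measure"] by simp
  then show "(\<lambda>t. (vec_lambda (\<lambda>k. t (\<sigma> k)) :: real ^ 'n) \<bullet> b) \<in> borel_measurable (\<Pi>\<^sub>M i\<in>A. lborel)"
    by (simp add: b inner_axis)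
qed

lemma lborel_from_coordinates:
  fixes \<sigma> :: "'n :: finite \<Rightarrow> 'i"
  assumes \<sigma>: "bij_betw \<sigma> UNIV A"
  shows "distr (\<Pi>\<^sub>M i\<in>A. lborel) borel (\<lambda>t. vec_lambda (\<lambda>k. t (\<sigma> k)) :: real ^ 'n) = lborel"
proof (rule lborel_eqI[symmetric])
  interpret product_sigma_finite "\<lambda>_. lborel :: real measure" by (rule product_sigma_finite_lborel)
  have A: "finite A" using \<sigma> by (metis bij_betw_finite finite)
  let ?Y = "\<lambda>t. vec_lambda (\<lambda>k. t (\<sigma> k)) :: real ^ 'n"
  have \<sigma>A: "\<sigma> k \<in> A" for k using \<sigma> by (auto simp: bij_betw_def)
  have Y: "?Y \<in> borel_measurable (\<Pi>\<^sub>M i\<in>A. lborel)"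
    using measurable_from_coordinates \<sigma>A .
  fix l u :: "real ^ 'n" assume le: "\<And>b. b \<in> Basis \<Longrightarrow> l \<bullet> b \<le> u \<bullet> b"
  have le': "vec_nth l k \<le> vec_nth u k" for k
    using le[of "axis k 1"] by (simp add: inner_axis axis_in_Basis_iff)
  let ?\<tau> = "the_inv_into UNIV \<sigma>"
  have \<tau>: "?\<tau> (\<sigma> k) = k" for k using \<sigma> by (simp add: the_inv_into_f_f bij_betw_def)
  have pre: "?Y -` box l u \<inter> space (\<Pi>\<^sub>M i\<in>A. lborel) = (\<Pi>\<^sub>E i\<in>A. {vec_nth l (?\<tau> i)<..<vec_nth u (?\<tau> i)})"
  proof -
    have A: "A = range \<sigma>" using \<sigma> by (auto simp: bij_betw_def)
    show ?thesis by (auto simp: A space_PiM PiE_iff mem_box_cart \<tau>)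
  qed
  have "emeasure (distr (\<Pi>\<^sub>M i\<in>A. lborel) borel ?Y) (box l u) = 
      (\<Prod>i\<in>A. emeasure lborel {vec_nth l (?\<tau> i)<..<vec_nth u (?\<tau> i)})"
    using Y by (simp add: emeasure_distr pre emeasure_PiM[OF A])
  also have "\<dots> = (\<Prod>k\<in>UNIV. emeasure lborel {vec_nth l k<..<vec_nth u k})"
    using \<sigma> by (simp add: prod.reindex_bij_betw[OF \<sigma>, symmetric] \<tau>)
  also have "\<dots> = (\<Prod>k\<in>UNIV. ennreal (vec_nth u k - vec_nth l k))" using le' by simp
  also have "\<dots> = ennreal (\<Prod>k\<in>UNIV. vec_nth u k - vec_nth l k)"
    using le' by (intro prod_ennreal) simp
  also have "(\<Prod>k\<in>UNIV. vec_nth u k - vec_nth l k) = (\<Prod>b\<in>Basis. (u - l) \<bullet> b)"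
    by (simp add: Basis_vec_def UNION_singleton_eq_range prod.reindex inj_on_def axis_eq_axis inner_axis)
  finally show "emeasure (distr (\<Pi>\<^sub>M i\<in>A. lborel) borel ?Y) (box l u) = (\<Prod>b\<in>Basis. (u - l) \<bullet> b)" .
qed simp

text \<open>
  Both determinants are sums over permutations; conjugation with the bijection \<open>\<iota>\<close> matches the permutations
  and preserves their signs.
\<close>

lemma det_reindex:
  fixes B :: "real mat" and \<iota> :: "'n :: finite \<Rightarrow> nat"
  assumes B: "B \<in> carrier_mat s s" and \<iota>: "bij_betw \<iota> UNIV {0..<s}"
  shows "Determinants.det (vec_lambda (\<lambda>r. vec_lambda (\<lambda>c. B $$ (\<iota> r, \<iota> c))) :: real ^ 'n ^ 'n) = det B"
proof -
  let ?m = "map_permutation UNIV \<iota>"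
  have inj: "inj_on \<iota> UNIV" using \<iota> by (simp add: bij_betw_def)
  have bm: "bij_betw ?m {p. p permutes UNIV} {p. p permutes {0..<s}}"
  proof (rule bij_betw_byWitness[of _ "map_permutation {0..<s} (inv_into UNIV \<iota>)"])
    have \<iota>': "bij_betw (inv_into UNIV \<iota>) {0..<s} UNIV" by (rule bij_betw_inv_into[OF \<iota>])
    show "\<forall>p\<in>{p. p permutes UNIV}. map_permutation {0..<s} (inv_into UNIV \<iota>) (?m p) = p"
      using map_permutation_compose_inv[OF \<iota>] inj by (simp add: inv_into_f_f)
    show "\<forall>p\<in>{p. p permutes {0..<s}}. ?m (map_permutation {0..<s} (inv_into UNIV \<iota>) p) = p"
      using map_permutation_compose_inv[OF \<iota>'] \<iota> by (simp add: bij_betw_inv_into_right)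
    show "?m ` {p. p permutes UNIV} \<subseteq> {p. p permutes {0..<s}}"
      using map_permutation_permutes[OF \<iota>] by blast
    show "map_permutation {0..<s} (inv_into UNIV \<iota>) ` {p. p permutes {0..<s}} \<subseteq> {p. p permutes UNIV}"
      using map_permutation_permutes[OF \<iota>'] by blast
  qed
  have mp: "?m p (\<iota> r) = \<iota> (p r)" for p r
    by (rule map_permutation_apply[OF inj UNIV_I])
  have "det B = (\<Sum>p | p permutes {0..<s}. signof p * (\<Prod>i = 0..<s. B $$ (i, p i)))"
    by (rule det_def'[OF B])
  also have "\<dots> = (\<Sum>p | p permutes (UNIV :: 'n set). signof (?m p) * (\<Prod>i = 0..<s. B $$ (i, ?m p i)))"
    by (rule sum.reindex_bij_betw[OF bm, symmetric])
  also have "\<dots> = (\<Sum>p | p permutes (UNIV :: 'n set). of_int (sign p) * (\<Prod>r\<in>UNIV. B $$ (\<iota> r, \<iota> (p r))))"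
  proof (rule sum.cong[OF refl])
    fix p assume "p \<in> {p. p permutes (UNIV :: 'n set)}"
    then have p: "p permutes (UNIV :: 'n set)" by simp
    have "(\<Prod>i = 0..<s. B $$ (i, ?m p i)) = (\<Prod>r\<in>UNIV. B $$ (\<iota> r, \<iota> (p r)))"
      unfolding prod.reindex_bij_betw[OF \<iota>, symmetric] mp ..
    then show "signof (?m p) * (\<Prod>i = 0..<s. B $$ (i, ?m p i)) = of_int (sign p) * (\<Prod>r\<in>UNIV. B $$ (\<iota> r, \<iota> (p r)))"
      using sign_map_permutation[OF inj p finite] by simp
  qed
  finally show ?thesis by (simp add: Determinants.det_def)
qed

lemma bij_betw_card_less: "bij_betw (\<lambda>i. card {j. j < i}) (UNIV :: 's :: {finite, linorder} set) {0..<CARD('s)}"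
proof -
  have mono: "card {j. j < i} < card {j. j < k}" if "i < k" for i k :: 's
    using that by (intro psubset_card_mono) auto
  have inj: "inj (\<lambda>i :: 's. card {j. j < i})"
    by (rule linorder_injI) (use mono in \<open>metis less_irrefl\<close>)
  have "(\<lambda>i :: 's. card {j. j < i}) ` UNIV = {0..<CARD('s)}"
    by (rule card_subset_eq) (use inj card_less_index in \<open>auto simp: card_image\<close>)
  then show ?thesis using inj by (simp add: bij_betw_def)
qed

lemma bij_betw_pick:
  assumes "finite A"
  shows "bij_betw (pick A) {0..<card A} A"
proof -
  have im: "pick A ` {0..<card A} = A"
  proof (intro Set.set_eqI iffI)
    fix i assume i: "i \<in> A"
    have "card {a \<in> A. a < i} < card A" using i assms by (intro psubset_card_mono) auto
    then show "i \<in> pick A ` {0..<card A}"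
      by (intro image_eqI[of _ _ "card {a \<in> A. a < i}"]) (simp_all add: pick_card_in_set[OF i])
  next
    fix i assume "i \<in> pick A ` {0..<card A}"
    then show "i \<in> A" using pick_in_set_le by auto
  qed
  then have "inj_on (pick A) {0..<card A}" by (intro eq_card_imp_inj_on) simp_all
  with im show ?thesis by (simp add: bij_betw_def)
qed

lemma submatrix_columns:
  assumes X: "X \<in> carrier_mat s n" and A: "A \<subseteq> {..<n}"
  shows "submatrix X UNIV A \<in> carrier_mat s (card A)"
    and "i < s \<Longrightarrow> k < card A \<Longrightarrow> submatrix X UNIV A $$ (i, k) = X $$ (i, pick A k)"
    and "k < card A \<Longrightarrow> col (submatrix X UNIV A) k = col X (pick A k)"
proof -
  have A2: "{j. j < n \<and> j \<in> A} = A" and dX: "dim_row X = s" "dim_col X = n" using A X by auto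
  show c: "submatrix X UNIV A \<in> carrier_mat s (card A)"
    by (intro carrier_matI) (simp_all add: dim_submatrix dX A2)
  show e: "submatrix X UNIV A $$ (i, k) = X $$ (i, pick A k)" if "i < s" "k < card A" for i k
    using that by (subst submatrix_index) (simp_all add: dX A2 pick_UNIV)
  show "col (submatrix X UNIV A) k = col X (pick A k)" if k: "k < card A"
  proof (rule eq_vecI)
    have p: "pick A k < n" using pick_in_set_le[OF k] A by auto
    fix i assume "i < dim_vec (col X (pick A k))"
    then show "col (submatrix X UNIV A) k $ i = col X (pick A k) $ i"
      using e[of i k] k c X p by simp
  qed (use c X in simp)
qed

lemma det_submatrix_columns_nonzero:
  assumes X: "X \<in> carrier_mat CARD('s :: {finite, linorder}) n" and A: "A \<subseteq> {..<n}" "card A = CARD('s)"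
    and ind: "lin_indep_family (column X :: nat \<Rightarrow> real ^ 's :: {finite, linorder}) A"
  shows "det (submatrix X UNIV A) \<noteq> 0"
proof
  let ?B = "submatrix X UNIV A"
  note sc = submatrix_columns[OF X A(1), unfolded A(2)]
  have fin: "finite A" using A(1) finite_subset by blast
  note bp = bij_betw_pick[OF fin, unfolded A(2)]
  assume "det ?B = 0"
  then obtain v where v: "v \<in> carrier_vec CARD('s)" "v \<noteq> 0\<^sub>v CARD('s)" "?B *\<^sub>v v = 0\<^sub>v CARD('s)"
    using det_0_iff_vec_prod_zero_field[OF sc(1)] by blast
  define w where "w i = v $ the_inv_into {0..<CARD('s)} (pick A) i" for i
  have w: "w (pick A k) = v $ k" if "k < CARD('s)" for k
    using bp that by (simp add: w_def the_inv_into_f_f bij_betw_def)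
  have "(\<Sum>i\<in>A. w i *\<^sub>R (column X i :: real ^ 's :: {finite, linorder})) = (\<Sum>k\<in>{0..<CARD('s)}. w (pick A k) *\<^sub>R column X (pick A k))"
    by (rule sum.reindex_bij_betw[OF bp, symmetric])
  also have "\<dots> = (\<Sum>k<CARD('s). v $ k *\<^sub>R (to_cart (col ?B k) :: real ^ 's :: {finite, linorder}))"
    by (rule sum.cong) (auto simp: w column_def sc(3))
  also have "\<dots> = to_cart (?B *\<^sub>v v)"
    using to_cart_mult[OF sc(1) v(1)] by simp
  finally have "(\<Sum>i\<in>A. w i *\<^sub>R (column X i :: real ^ 's :: {finite, linorder})) = 0" using v(3) by simp
  then have "\<forall>i\<in>A. w i = 0" using ind unfolding lin_indep_family_def by blast
  then have "v $ k = 0" if "k < CARD('s)" for k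
    using w[OF that] pick_in_set_le[of k A] that A(2) by simp
  then show False using v(1,2) by (auto intro!: eq_vecI)
qed

text \<open>
  The parametrization \<open>t \<mapsto> \<Sum>\<^sub>i t\<^sub>i \<xi>\<^sub>i\<close> is the composition of labelling the coordinates by \<open>A\<close>, a linear map
  with the matrix of columns in \<open>A\<close>, and passing from the index type \<open>'s wo\<close> back to \<open>'s\<close>.
\<close>

lemma integral_over_cone_coordinates:
  fixes h :: "real ^ 's :: {finite, linorder} \<Rightarrow> real"
  assumes X: "X \<in> carrier_mat CARD('s) n" and A: "A \<subseteq> {..<n}" "card A = CARD('s)"
    and d: "det (submatrix X UNIV A) \<noteq> 0" and h: "h \<in> borel_measurable borel"
  shows "(\<integral>t. h (\<Sum>i\<in>A. t i *\<^sub>R column X i) \<partial>(\<Pi>\<^sub>M i\<in>A. lborel)) =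
    (\<integral>x. h x / \<bar>det (submatrix X UNIV A)\<bar> \<partial>lborel)"
proof -
  let ?B = "submatrix X UNIV A"
  note sc = submatrix_columns[OF X A(1), unfolded A(2)]
  have fin: "finite A" using A(1) finite_subset by blast
  define idx where "idx i = card {j. j < i}" for i :: 's
  have bi: "bij_betw idx UNIV {0..<CARD('s)}" unfolding idx_def by (rule bij_betw_card_less)
  have bs: "bij_betw (\<lambda>i. pick A (idx i)) UNIV A"
    using bij_betw_trans[OF bi bij_betw_pick[OF fin, unfolded A(2)]] by (simp add: o_def)
  have bu: "bij_betw unwo (UNIV :: 's wo set) UNIV"
    by (rule bij_betw_byWitness[of _ Wo]) auto
  define \<sigma> where "\<sigma> c = pick A (idx (unwo c))" for c
  have b\<sigma>: "bij_betw \<sigma> UNIV A" using bij_betw_trans[OF bu bs] by (simp add: o_def \<sigma>_def[abs_def])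
  have b\<iota>: "bij_betw (\<lambda>c. idx (unwo c)) UNIV {0..<CARD('s)}" using bij_betw_trans[OF bu bi] by (simp add: o_def)
  define M :: "real ^ 's wo ^ 's wo" where
    "M = vec_lambda (\<lambda>r. vec_lambda (\<lambda>c. ?B $$ (idx (unwo r), idx (unwo c))))"
  define L where "L = (*v) M"
  have L: "linear L" "matrix L = M" unfolding L_def by (simp_all add: matrix_vector_mul_linear)
  have dM: "Determinants.det M = det ?B"
    unfolding M_def by (rule det_reindex[OF sc(1) b\<iota>])
  define C :: "real ^ 's wo \<Rightarrow> real ^ 's :: {finite, linorder}" where "C z = vec_lambda (\<lambda>i. vec_nth z (Wo i))" for z
  have Cm: "C \<in> borel_measurable borel"
    unfolding C_def[abs_def] by (intro borel_measurable_continuous_onI continuous_on_vec_lambda continuous_intros)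
  define Y :: "(nat \<Rightarrow> real) \<Rightarrow> real ^ 's wo" where "Y t = vec_lambda (\<lambda>c. t (\<sigma> c))" for t
  have Ym: "Y \<in> borel_measurable (\<Pi>\<^sub>M i\<in>A. lborel)"
    unfolding Y_def[abs_def] by (rule measurable_from_coordinates) (use b\<sigma> in \<open>auto simp: bij_betw_def\<close>)
  have Yd: "distr (\<Pi>\<^sub>M i\<in>A. lborel) borel Y = lborel"
    unfolding Y_def[abs_def] by (rule lborel_from_coordinates[OF b\<sigma>])
  have Lm: "L \<in> borel_measurable borel"
    using L(1) by (auto intro!: borel_measurable_continuous_onI linear_continuous_on simp: linear_linear)
  have hC: "(\<lambda>z. h (C z)) \<in> borel_measurable borel" using measurable_compose[OF Cm h] .
  have CLY: "C (L (Y t)) = (\<Sum>i\<in>A. t i *\<^sub>R column X i)" for t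
  proof -
    have "vec_nth (C (L (Y t))) i = vec_nth (\<Sum>i\<in>A. t i *\<^sub>R column X i) i" for i
    proof -
      have ii: "idx i < CARD('s)" for i using bi by (auto simp: bij_betw_def)
      have "vec_nth (C (L (Y t))) i = (\<Sum>c\<in>UNIV. ?B $$ (idx i, idx (unwo c)) * t (\<sigma> c))"
        by (simp add: C_def L_def M_def Y_def matrix_vector_mult_def)
      also have "\<dots> = (\<Sum>c\<in>UNIV. t (\<sigma> c) * vec_nth (column X (\<sigma> c) :: real ^ 's :: {finite, linorder}) i)"
      proof (rule sum.cong[OF refl])
        fix c :: "'s wo"
        have "\<sigma> c < n" using b\<sigma> A(1) by (auto simp: bij_betw_def)
        then show "?B $$ (idx i, idx (unwo c)) * t (\<sigma> c) = t (\<sigma> c) * vec_nth (column X (\<sigma> c) :: real ^ 's :: {finite, linorder}) i"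
          using sc(2)[OF ii ii, of i "unwo c"] ii[of i] X
          by (simp add: column_def vec_nth_to_cart \<sigma>_def idx_def)
      qed
      also have "\<dots> = (\<Sum>j\<in>A. t j * vec_nth (column X j :: real ^ 's :: {finite, linorder}) i)"
        by (rule sum.reindex_bij_betw[OF b\<sigma>])
      finally show ?thesis by simp
    qed
    then show ?thesis by (simp add: Finite_Cartesian_Product.vec_eq_iff)
  qed
  have CY: "C (Y t) = vec_lambda (\<lambda>i. t (pick A (idx i)))" for t
    by (simp add: C_def Y_def \<sigma>_def)
  have "(\<integral>t. h (\<Sum>i\<in>A. t i *\<^sub>R column X i) \<partial>(\<Pi>\<^sub>M i\<in>A. lborel)) = (\<integral>t. h (C (L (Y t))) \<partial>(\<Pi>\<^sub>M i\<in>A. lborel))"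
    by (simp add: CLY)
  also have "\<dots> = (\<integral>y. h (C (L y)) \<partial>(distr (\<Pi>\<^sub>M i\<in>A. lborel) borel Y))"
    using measurable_compose[OF Lm hC] by (rule integral_distr[OF Ym, symmetric])
  also have "\<dots> = (\<integral>z. h (C z) / \<bar>det ?B\<bar> \<partial>lborel)"
    unfolding Yd using lborel_linear_image[OF L(1) _ hC] d by (simp add: L(2) dM)
  also have "\<dots> = (\<integral>z. h (C z) / \<bar>det ?B\<bar> \<partial>(distr (\<Pi>\<^sub>M i\<in>A. lborel) borel Y))" by (simp add: Yd)
  also have "\<dots> = (\<integral>t. h (C (Y t)) / \<bar>det ?B\<bar> \<partial>(\<Pi>\<^sub>M i\<in>A. lborel))"
    by (rule integral_distr[OF Ym]) (use hC in simp)
  also have "\<dots> = (\<integral>x. h x / \<bar>det ?B\<bar> \<partial>(distr (\<Pi>\<^sub>M i\<in>A. lborel) borel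
      (\<lambda>t. vec_lambda (\<lambda>i. t (pick A (idx i))) :: real ^ 's :: {finite, linorder})))"
    unfolding CY
    by (rule integral_distr[symmetric, OF measurable_from_coordinates]) (use bs h in \<open>auto simp: bij_betw_def\<close>)
  also have "\<dots> = (\<integral>x. h x / \<bar>det ?B\<bar> \<partial>lborel)" unfolding lborel_from_coordinates[OF bs] ..
  finally show ?thesis .
qed

section \<open>The fundamental solution and its differences\<close>

lemma entries_eq_excess: "dim_vec \<alpha> = n \<Longrightarrow> entries \<alpha> i = excess \<alpha> i + of_bool (i \<in> supp \<alpha>)"
  by (auto simp: entries_def excess_def supp_def)

lemma admissible_ones:
  assumes span: "Real_Vector_Spaces.span (\<xi> ` {..<n}) = UNIV"
  shows "admissible \<xi> n 0 (ones n)"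
proof -
  have "supp (ones n) = {..<n}" by (auto simp: supp_def ones_def)
  moreover have "\<not> ones n $ r \<ge> 2" if "r < n" for r using that by (simp add: ones_def)
  ultimately show ?thesis using span by (auto simp: admissible_def ones_def)
qed

text \<open>
  The invariant described at the beginning, proved by induction with \<open>P_step_admissible_pairing\<close>. It
  starts from the constant vector 1, where nothing is raised or dropped and the pairing is evaluation at 0.
\<close>

lemma P_mset_reproduces_delta:
  fixes \<Xi> :: "real mat" and ker :: "real mat \<Rightarrow> real mat"
  assumes carrier: "\<Xi> \<in> carrier_mat CARD('s :: {finite, linorder}) n"
    and ker: "\<forall>X. kernel_matrix X (ker X)"
    and nonzero: "\<forall>j<n. column \<Xi> j \<noteq> (0 :: real ^ 's :: {finite, linorder})"
    and span: "Real_Vector_Spaces.span ((column \<Xi> :: nat \<Rightarrow> real ^ 's :: {finite, linorder}) ` {..<n}) = UNIV"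
    and k: "k \<le> n - CARD('s)"
  shows "(\<forall>(c, \<alpha>) \<in># P_mset ker \<Xi> k. admissible (column \<Xi> :: nat \<Rightarrow> real ^ 's :: {finite, linorder}) n k \<alpha>) \<and>
    (\<forall>f. test_function f \<longrightarrow> (\<Sum>(c, \<alpha>)\<in>#P_mset ker \<Xi> k.
        c * cone_pairing (column \<Xi> :: nat \<Rightarrow> real ^ 's :: {finite, linorder}) (excess \<alpha>) (dir_derivs (column \<Xi>) (dropped \<alpha>) f))
      = f 0)"
  using k
proof (induction k)
  case 0
  have n: "dim_col \<Xi> = n" using carrier by simp
  have "excess (ones n) = (\<lambda>_. 0)" "dropped (ones n) = []"
    by (auto simp: excess_def dropped_def ones_def fun_eq_iff)
  then show ?case using admissible_ones[OF span] by (simp add: n cone_pairing_zero)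
next
  case (Suc k)
  then have IH: "\<And>q. q \<in># P_mset ker \<Xi> k \<Longrightarrow> admissible (column \<Xi> :: nat \<Rightarrow> real ^ 's :: {finite, linorder}) n k (snd q)"
    "\<And>f. test_function f \<Longrightarrow> (\<Sum>(c, \<alpha>)\<in>#P_mset ker \<Xi> k.
        c * cone_pairing (column \<Xi> :: nat \<Rightarrow> real ^ 's :: {finite, linorder}) (excess \<alpha>) (dir_derivs (column \<Xi>) (dropped \<alpha>) f)) = f 0"
    by auto
  have k: "k < n - CARD('s)" using Suc.prems by simp
  note step = P_step_admissible_pairing[OF carrier ker nonzero k]
  show ?case
  proof (intro conjI allI impI)
    show "\<forall>(c, \<alpha>) \<in># P_mset ker \<Xi> (Suc k). admissible (column \<Xi> :: nat \<Rightarrow> real ^ 's :: {finite, linorder}) n (Suc k) \<alpha>"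
    proof
      fix q assume "q \<in># P_mset ker \<Xi> (Suc k)"
      then obtain q' where q': "q' \<in># P_mset ker \<Xi> k" "q \<in># P_step ker \<Xi> q'" by auto
      have "q \<in># P_step ker \<Xi> (fst q', snd q')" using q'(2) by simp
      from step(1)[OF IH(1)[OF q'(1)], THEN bspec, OF this]
      show "case q of (c, \<alpha>) \<Rightarrow> admissible (column \<Xi> :: nat \<Rightarrow> real ^ 's :: {finite, linorder}) n (Suc k) \<alpha>" .
    qed
    fix f :: "real ^ 's :: {finite, linorder} \<Rightarrow> real" assume f: "test_function f"
    let ?F = "\<lambda>(c, \<alpha>). c * cone_pairing (column \<Xi> :: nat \<Rightarrow> real ^ 's :: {finite, linorder}) (excess \<alpha>) (dir_derivs (column \<Xi>) (dropped \<alpha>) f)"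
    have "sum_mset (image_mset ?F (P_mset ker \<Xi> (Suc k))) = (\<Sum>q\<in>#P_mset ker \<Xi> k. sum_mset (image_mset ?F (P_step ker \<Xi> q)))"
      by (simp add: sum_mset_bind)
    also have "\<dots> = (\<Sum>q\<in>#P_mset ker \<Xi> k. ?F q)"
    proof (rule arg_cong[where f = sum_mset], rule image_mset_cong)
      fix q assume "q \<in># P_mset ker \<Xi> k"
      from step(2)[OF IH(1)[OF this] f, of "fst q"]
      show "sum_mset (image_mset ?F (P_step ker \<Xi> q)) = ?F q" by (simp add: case_prod_beta)
    qed
    also have "\<dots> = f 0" by (rule IH(2)[OF f])
    finally show "sum_mset (image_mset ?F (P_mset ker \<Xi> (Suc k))) = f 0" .
  qed
qed

text \<open>
  After \<open>n - s\<close> steps each support is a basis, so the derivatives along the supporting columns that are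
  missing from the product can be added by \<open>cone_pairing_dir_derivs\<close>, which turns \<open>excess \<alpha>\<close> into
  \<open>entries \<alpha>\<close>.
\<close>

lemma truncated_powers_fundamental_solution:
  fixes \<Xi> :: "real mat" and ker :: "real mat \<Rightarrow> real mat"
  assumes carrier: "\<Xi> \<in> carrier_mat CARD('s :: {finite, linorder}) n"
    and ker: "\<forall>X. kernel_matrix X (ker X)"
    and nonzero: "\<forall>j<n. column \<Xi> j \<noteq> (0 :: real ^ 's :: {finite, linorder})"
    and span: "Real_Vector_Spaces.span ((column \<Xi> :: nat \<Rightarrow> real ^ 's :: {finite, linorder}) ` {..<n}) = UNIV"
  shows "\<And>c \<alpha>. (c, \<alpha>) \<in># P_mset ker \<Xi> (n - CARD('s)) \<Longrightarrow> dim_vec \<alpha> = n \<and> card (supp \<alpha>) = CARD('s) \<and>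
      lin_indep_family (column \<Xi> :: nat \<Rightarrow> real ^ 's :: {finite, linorder}) (supp \<alpha>)"
    and "\<And>f. test_function f \<Longrightarrow> (\<Sum>(c, \<alpha>)\<in>#P_mset ker \<Xi> (n - CARD('s)).
        c * cone_pairing (column \<Xi> :: nat \<Rightarrow> real ^ 's :: {finite, linorder}) (entries \<alpha>) (dir_derivs (column \<Xi>) [0..<n] f)) = f 0"
proof -
  let ?\<xi> = "column \<Xi> :: nat \<Rightarrow> real ^ 's :: {finite, linorder}"
  note P = P_mset_reproduces_delta[OF carrier ker nonzero span order_refl]
  have "Real_Vector_Spaces.dim (UNIV :: (real ^ 's :: {finite, linorder}) set) \<le> card (?\<xi> ` {..<n})"
    using span_card_ge_dim[of "?\<xi> ` {..<n}" UNIV] span by simp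
  also have "\<dots> \<le> n" using card_image_le[of "{..<n}" ?\<xi>] by simp
  finally have sn: "CARD('s) \<le> n" by simp
  show props: "dim_vec \<alpha> = n \<and> card (supp \<alpha>) = CARD('s) \<and> lin_indep_family ?\<xi> (supp \<alpha>)"
    if "(c, \<alpha>) \<in># P_mset ker \<Xi> (n - CARD('s))" for c \<alpha>
  proof -
    have "admissible ?\<xi> n (n - CARD('s)) \<alpha>" using P that by blast
    then have a: "dim_vec \<alpha> = n" "card (supp \<alpha>) = CARD('s)" "Real_Vector_Spaces.span (?\<xi> ` supp \<alpha>) = UNIV"
      using sn unfolding admissible_def by auto
    then show ?thesis using spanning_family_indep[OF finite_supp, of \<alpha> ?\<xi>] by simp
  qed
  fix f :: "real ^ 's :: {finite, linorder} \<Rightarrow> real" assume f: "test_function f"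
  have "cone_pairing ?\<xi> (entries \<alpha>) (dir_derivs ?\<xi> [0..<n] f) = cone_pairing ?\<xi> (excess \<alpha>) (dir_derivs ?\<xi> (dropped \<alpha>) f)"
    if "(c, \<alpha>) \<in># P_mset ker \<Xi> (n - CARD('s))" for c \<alpha>
  proof -
    note p = props[OF that]
    define js where "js = filter (\<lambda>j. \<alpha> $ j \<noteq> 0) [0..<n]"
    have js: "set js = supp \<alpha>" "distinct js" using p by (auto simp: js_def supp_def)
    have "mset xs = mset (filter (\<lambda>j. \<alpha> $ j \<noteq> 0) xs @ filter (\<lambda>j. \<alpha> $ j = 0) xs)" for xs
      by (induction xs) auto
    from this[of "[0..<n]"] have "mset [0..<n] = mset (js @ dropped \<alpha>)"
      using p by (simp only: js_def dropped_def)
    from dir_derivs_perm[OF this f] have "dir_derivs ?\<xi> [0..<n] f = dir_derivs ?\<xi> js (dir_derivs ?\<xi> (dropped \<alpha>) f)"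
      by (simp only: dir_derivs_append)
    moreover have "entries \<alpha> = (\<lambda>i. excess \<alpha> i + of_bool (i \<in> set js))"
      using p js(1) by (intro ext) (simp add: entries_eq_excess)
    moreover have "cone_pairing ?\<xi> (\<lambda>i. excess \<alpha> i + of_bool (i \<in> set js)) (dir_derivs ?\<xi> js (dir_derivs ?\<xi> (dropped \<alpha>) f))
        = cone_pairing ?\<xi> (excess \<alpha>) (dir_derivs ?\<xi> (dropped \<alpha>) f)"
    proof (rule cone_pairing_dir_derivs[OF finite_supp])
      show "lin_indep_family ?\<xi> (supp \<alpha>)" using p by simp
      show "{i. excess \<alpha> i \<noteq> 0} \<subseteq> supp \<alpha>" by (auto simp: excess_def supp_def split: if_splits)
      show "set js \<subseteq> supp \<alpha>" "distinct js" using js by simp_all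
    qed (rule test_function_dir_derivs[OF f])
    ultimately show ?thesis by simp
  qed
  note eq = this
  have "(\<Sum>(c, \<alpha>)\<in>#P_mset ker \<Xi> (n - CARD('s)). c * cone_pairing ?\<xi> (entries \<alpha>) (dir_derivs ?\<xi> [0..<n] f)) =
    (\<Sum>(c, \<alpha>)\<in>#P_mset ker \<Xi> (n - CARD('s)). c * cone_pairing ?\<xi> (excess \<alpha>) (dir_derivs ?\<xi> (dropped \<alpha>) f))"
  proof (rule arg_cong[where f = sum_mset], rule image_mset_cong)
    fix q assume "q \<in># P_mset ker \<Xi> (n - CARD('s))"
    then show "(case q of (c, \<alpha>) \<Rightarrow> c * cone_pairing ?\<xi> (entries \<alpha>) (dir_derivs ?\<xi> [0..<n] f)) =
        (case q of (c, \<alpha>) \<Rightarrow> c * cone_pairing ?\<xi> (excess \<alpha>) (dir_derivs ?\<xi> (dropped \<alpha>) f))"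
      using eq[of "fst q" "snd q"] by (simp add: case_prod_beta)
  qed
  then show "(\<Sum>(c, \<alpha>)\<in>#P_mset ker \<Xi> (n - CARD('s)). c * cone_pairing ?\<xi> (entries \<alpha>) (dir_derivs ?\<xi> [0..<n] f)) = f 0"
    using P[THEN conjunct2, rule_format, OF f] by (rule trans)
qed

definition segment_avgs :: "('i \<Rightarrow> 'a :: euclidean_space) \<Rightarrow> 'i list \<Rightarrow> ('a \<Rightarrow> real) \<Rightarrow> 'a \<Rightarrow> real" where
  "segment_avgs \<xi> js f = foldr (\<lambda>j. segment_avg (\<xi> j)) js f"

lemma segment_avgs_Nil_Cons [simp]: "segment_avgs \<xi> [] f = f" "segment_avgs \<xi> (j # js) f = segment_avg (\<xi> j) (segment_avgs \<xi> js f)"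
  by (simp_all add: segment_avgs_def)

lemma test_function_segment_avgs: "test_function f \<Longrightarrow> test_function (segment_avgs \<xi> js f)"
  by (induction js) (auto intro: test_function_segment_avg)

lemma dir_derivs_segment_avg: "test_function f \<Longrightarrow> dir_derivs \<xi> js (segment_avg v f) = segment_avg v (dir_derivs \<xi> js f)"
proof (induction js)
  case (Cons j js)
  have "Ck (Suc 0) (dir_derivs \<xi> js f)" using test_function_dir_derivs[OF Cons.prems] test_function_iff by blast
  then show ?case using Cons dir_deriv_segment_avg by simp
qed simp

text \<open>
  The translation by \<open>y\<close> is needed for the induction, since the recursion for the box spline
  translates the test function.
\<close>

lemma box_spline_cols_segment_avgs: "box_spline_cols Z (\<lambda>x. f (x + y)) = segment_avgs to_cart Z f y"
proof (induction Z arbitrary: f y)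
  case (Cons \<zeta> Z)
  have "box_spline_cols Z (\<lambda>x. f (x + t *\<^sub>R to_cart \<zeta> + y)) = segment_avgs to_cart Z f (y + t *\<^sub>R to_cart \<zeta>)" for t
    using Cons[of f "y + t *\<^sub>R to_cart \<zeta>"] by (simp add: add.commute add.left_commute)
  then show ?case by (simp add: segment_avg_def)
qed simp

lemma to_cart_add:
  assumes "u \<in> carrier_vec CARD('s :: {finite, linorder})" "v \<in> carrier_vec CARD('s)"
  shows "to_cart (u + v) = (to_cart u + to_cart v :: real ^ 's :: {finite, linorder})"
  using assms by (simp add: Finite_Cartesian_Product.vec_eq_iff vec_nth_to_cart card_less_index)

lemma S_cols_carrier: "set Z \<subseteq> carrier_vec s \<Longrightarrow> (b, p) \<in># S_cols s Z \<Longrightarrow> p \<in> carrier_vec s"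
  by (induction Z arbitrary: b p) auto

lemma sum_mset_uminus: "(\<Sum>q\<in>#M. - F q) = - (\<Sum>q\<in>#M. (F q :: 'b :: ab_group_add))"
  by (induction M) simp_all

text \<open>
  Derivatives and averages commute, so each derivative meets the average along its own column and leaves the
  difference \<open>G x - G (x + \<zeta>)\<close>. The two terms correspond to the two parts of the recursion for \<open>S\<close>.
\<close>

lemma dir_derivs_segment_avgs_differences:
  fixes f :: "real ^ 's :: {finite, linorder} \<Rightarrow> real"
  assumes f: "test_function f" and Z: "set Z \<subseteq> carrier_vec CARD('s)"
  shows "dir_derivs to_cart Z (segment_avgs to_cart Z f) x = (\<Sum>(b, p)\<in>#S_cols CARD('s) Z. b * f (x + to_cart p))"
  using Z
proof (induction Z arbitrary: x)
  case (Cons \<zeta> Z)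
  define G where "G = dir_derivs to_cart Z (segment_avgs to_cart Z f)"
  have G: "Ck (Suc 0) G" using test_function_dir_derivs[OF test_function_segment_avgs[OF f]] test_function_iff unfolding G_def by blast
  have "dir_derivs to_cart (\<zeta> # Z) (segment_avgs to_cart (\<zeta> # Z) f) = dir_deriv (- to_cart \<zeta>) (segment_avg (to_cart \<zeta>) G)"
    unfolding dir_derivs_Nil_Cons segment_avgs_Nil_Cons G_def by (subst dir_derivs_segment_avg[OF test_function_segment_avgs[OF f]]) (rule refl)
  also have "\<dots> = segment_avg (to_cart \<zeta>) (dir_deriv (- to_cart \<zeta>) G)" by (rule dir_deriv_segment_avg[OF G])
  also have "dir_deriv (- to_cart \<zeta>) G = (\<lambda>x. - 1 * dir_deriv (to_cart \<zeta>) G x)"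
    using dir_deriv_scale[OF G, of "-1" "to_cart \<zeta>"] by (simp add: fun_eq_iff)
  finally have "dir_derivs to_cart (\<zeta> # Z) (segment_avgs to_cart (\<zeta> # Z) f) x = G x - G (x + to_cart \<zeta>)"
    by (simp only: segment_avg_cmult segment_avg_dir_deriv_same[OF G]) simp
  moreover have "(\<Sum>(b, p)\<in>#image_mset (\<lambda>(c, p). (- c, \<zeta> + p)) (S_cols CARD('s) Z). b * f (x + to_cart p)) =
      (\<Sum>(b, p)\<in>#S_cols CARD('s) Z. - (b * f (x + to_cart \<zeta> + to_cart p)))"
    unfolding multiset.map_comp o_def
  proof (rule arg_cong[where f = sum_mset], rule image_mset_cong)
    fix q assume "q \<in># S_cols CARD('s) Z"
    then have "snd q \<in> carrier_vec CARD('s)" using S_cols_carrier[of Z _ "fst q" "snd q"] Cons.prems by simp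
    then show "(case case q of (c, p) \<Rightarrow> (- c, \<zeta> + p) of (b, p) \<Rightarrow> b * f (x + to_cart p)) =
       (case q of (b, p) \<Rightarrow> - (b * f (x + to_cart \<zeta> + to_cart p)))"
      using Cons.prems by (simp add: case_prod_beta to_cart_add add.assoc)
  qed
  moreover have "\<dots> = - (\<Sum>(b, p)\<in>#S_cols CARD('s) Z. b * f (x + to_cart \<zeta> + to_cart p))"
    unfolding case_prod_beta' by (rule sum_mset_uminus)
  ultimately show ?case using Cons by (simp add: G_def)
qed simp

lemma cone_pairing_sum_mset:
  assumes fin: "finite {i. \<gamma> i \<noteq> 0}" and ind: "lin_indep_family \<xi> {i. \<gamma> i \<noteq> 0}"
    and f: "\<And>q. test_function (f q)"
  shows "cone_pairing \<xi> \<gamma> (\<lambda>x. \<Sum>q\<in>#M. c q * f q x) = (\<Sum>q\<in>#M. c q * cone_pairing \<xi> \<gamma> (f q))"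
proof -
  obtain qs where qs: "M = mset qs" by (metis ex_mset)
  have s: "(\<Sum>q\<in>#M. F q) = (\<Sum>i<length qs. F (qs ! i))" for F :: "_ \<Rightarrow> real"
    by (simp add: qs sum_mset_sum_list flip: mset_map) (simp add: sum_list_sum_nth atLeast0LessThan)
  show ?thesis unfolding s by (rule cone_pairing_sum[OF fin ind f])
qed

section \<open>The box spline as a sum of truncated powers\<close>

lemma locally_integrable_dominated:
  fixes f :: "'a :: euclidean_space \<Rightarrow> real"
  assumes f: "f \<in> borel_measurable borel" and Q: "continuous_on UNIV Q" "\<And>x. \<bar>f x\<bar> \<le> \<bar>Q x\<bar>"
  shows "locally_integrable f"
  unfolding locally_integrable_def
proof (intro allI impI)
  fix K :: "'a set" assume K: "compact K"
  have "set_integrable lborel K Q"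
    by (rule borel_integrable_compact[OF K, folded set_integrable_def]) (rule continuous_on_subset[OF Q(1)], simp)
  moreover have "set_borel_measurable lborel K f"
    unfolding set_borel_measurable_def using f compact_imp_closed[OF K]
    by (intro borel_measurable_scaleR borel_measurable_indicator) auto
  ultimately show "set_integrable lborel K f"
    by (rule set_integrable_bound) (use Q(2) in simp)
qed

lemma locally_integrable_cmult: "locally_integrable f \<Longrightarrow> locally_integrable (\<lambda>x. c * f x)"
  unfolding locally_integrable_def by (auto intro: set_integrable_mult_right)

lemma locally_integrable_sum_mset:
  "(\<And>q. q \<in># M \<Longrightarrow> locally_integrable (f q)) \<Longrightarrow> locally_integrable (\<lambda>x. \<Sum>q\<in>#M. f q x)"
proof (induction M)
  case empty
  then show ?case by (simp add: locally_integrable_def set_integrable_def)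
next
  case (add q M)
  then show ?case unfolding locally_integrable_def by (auto intro: set_integral_add(1))
qed

lemma locally_integrable_times_test:
  assumes f: "locally_integrable f" and \<phi>: "test_function \<phi>"
  shows "integrable lborel (\<lambda>x. f x * \<phi> x)"
proof -
  let ?K = "closure {x. \<phi> x \<noteq> 0}"
  obtain M where M: "\<And>x. \<bar>\<phi> x\<bar> \<le> M" "M \<ge> 0" using test_function_bounded[OF \<phi>] by blast
  have i: "integrable lborel (\<lambda>x. indicator ?K x *\<^sub>R f x)"
    using f \<phi> unfolding locally_integrable_def test_function_def set_integrable_def by blast
  have eq: "f x * \<phi> x = (indicator ?K x *\<^sub>R f x) * \<phi> x" for x
    using closure_subset[of "{x. \<phi> x \<noteq> 0}"] by (cases "\<phi> x = 0") (auto simp: indicator_def)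
  have "integrable lborel (\<lambda>x. (indicator ?K x *\<^sub>R f x) * \<phi> x)"
  proof (rule Bochner_Integration.integrable_bound)
    show "integrable lborel (\<lambda>x. M * (indicator ?K x *\<^sub>R f x))" using i by simp
    show "(\<lambda>x. (indicator ?K x *\<^sub>R f x) * \<phi> x) \<in> borel_measurable lborel"
      using borel_measurable_integrable[OF i] test_function_measurable[OF \<phi>] by (intro borel_measurable_times) auto
    show "AE x in lborel. norm ((indicator ?K x *\<^sub>R f x) * \<phi> x) \<le> norm (M * (indicator ?K x *\<^sub>R f x))"
    proof (rule AE_I2)
      fix x
      have "\<bar>\<phi> x\<bar> * \<bar>indicator ?K x *\<^sub>R f x\<bar> \<le> M * \<bar>indicator ?K x *\<^sub>R f x\<bar>"
        by (rule mult_right_mono[OF M(1) abs_ge_zero])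
      then show "norm ((indicator ?K x *\<^sub>R f x) * \<phi> x) \<le> norm (M * (indicator ?K x *\<^sub>R f x))"
        using M(2) by (simp only: real_norm_def abs_mult mult.commute abs_of_nonneg)
    qed
  qed
  then show ?thesis unfolding eq .
qed

lemma integral_sum_mset:
  assumes "\<And>q. q \<in># M \<Longrightarrow> integrable N (f q)"
  shows "integrable N (\<lambda>x. \<Sum>q\<in>#M. f q x :: real) \<and> (\<integral>x. (\<Sum>q\<in>#M. f q x) \<partial>N) = (\<Sum>q\<in>#M. \<integral>x. f q x \<partial>N)"
  using assms by (induction M) auto

lemma sum_mset_mult_left: "(c :: real) * (\<Sum>q\<in>#M. f q) = (\<Sum>q\<in>#M. c * f q)"
  by (induction M) (simp_all add: distrib_left)

lemma sum_mset_mult_right: "(\<Sum>q\<in>#M. f q) * (c :: real) = (\<Sum>q\<in>#M. f q * c)"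
  by (induction M) (simp_all add: distrib_right)

lemma integral_translate:
  fixes g :: "'a :: euclidean_space \<Rightarrow> real"
  assumes "g \<in> borel_measurable borel"
  shows "(\<integral>x. g (x + a) \<partial>lborel) = (\<integral>x. g x \<partial>lborel)"
proof -
  have "(\<integral>x. g x \<partial>lborel) = (\<integral>x. g x \<partial>(distr lborel borel ((+) a)))" by (simp add: lborel_distr_plus)
  also have "\<dots> = (\<integral>x. g (a + x) \<partial>lborel)" by (rule integral_distr) (use assms in auto)
  finally show ?thesis by (simp add: add.commute)
qed

text \<open>
  The list of nonzero entries and \<open>pick\<close> enumerate the support in the same order: the \<open>k\<close>-th element of the
  increasing list has exactly \<open>k\<close> smaller elements of the support before it.
\<close>

lemma mu_index:
  assumes "k < card (supp \<alpha>)"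
  shows "\<mu> \<alpha> $ k = \<alpha> $ pick (supp \<alpha>) k" "dim_vec (\<mu> \<alpha>) = card (supp \<alpha>)"
proof -
  define js where "js = filter (\<lambda>j. \<alpha> $ j \<noteq> 0) [0..<dim_vec \<alpha>]"
  have js: "set js = supp \<alpha>" "sorted_wrt (<) js" "distinct js"
    by (auto simp: js_def supp_def intro!: sorted_wrt_filter)
  have len: "length js = card (supp \<alpha>)" using distinct_card[OF js(3)] js(1) by simp
  have "list_of_vec \<alpha> = map (\<lambda>j. \<alpha> $ j) [0..<dim_vec \<alpha>]"
    by (rule nth_equalityI) (simp_all add: list_of_vec_index)
  then have mu: "\<mu> \<alpha> = vec_of_list (map (\<lambda>j. \<alpha> $ j) js)"
    by (simp add: \<mu>_def js_def filter_map o_def)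
  then show "dim_vec (\<mu> \<alpha>) = card (supp \<alpha>)" using len by simp
  have "pick (supp \<alpha>) k = js ! k"
  proof -
    have k: "k < length js" using assms len by simp
    have "{a \<in> supp \<alpha>. a < js ! k} = (!) js ` {..<k}"
    proof (intro Set.set_eqI iffI)
      fix a assume a: "a \<in> {a \<in> supp \<alpha>. a < js ! k}"
      then obtain i where i: "i < length js" "a = js ! i" using js(1) by (metis (lifting) in_set_conv_nth mem_Collect_eq)
      have "\<not> k \<le> i"
      proof
        assume "k \<le> i"
        then have "js ! k \<le> js ! i"
          using sorted_wrt_nth_less[OF js(2), of k i] i(1) by (cases "k = i") auto
        then show False using a i(2) by simp
      qed
      then show "a \<in> (!) js ` {..<k}" using i by auto
    next
      fix a assume "a \<in> (!) js ` {..<k}"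
      then obtain i where i: "i < k" "a = js ! i" by auto
      then show "a \<in> {a \<in> supp \<alpha>. a < js ! k}"
        using sorted_wrt_nth_less[OF js(2) i(1)] k js(1) nth_mem[of i js] by auto
    qed
    moreover have "inj_on ((!) js) {..<k}" using js(3) k by (auto simp: inj_on_def nth_eq_iff_index_eq)
    ultimately have "card {a \<in> supp \<alpha>. a < js ! k} = k" by (simp add: card_image)
    moreover have "js ! k \<in> supp \<alpha>" using js(1) nth_mem[OF k] by simp
    ultimately show ?thesis using pick_card_in_set[of "js ! k" "supp \<alpha>"] by simp
  qed
  then show "\<mu> \<alpha> $ k = \<alpha> $ pick (supp \<alpha>) k" using mu assms len by (simp add: vec_of_list_index)
qed

text \<open>
  The one-sided power in the coordinates with respect to the columns selected by \<open>\<alpha>\<close>, without the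
  determinant factor and the translation.
\<close>

definition trunc_power :: "real mat \<Rightarrow> nat vec \<Rightarrow> real ^ 's :: {finite, linorder} \<Rightarrow> real" where
  "trunc_power \<Xi> \<alpha> x = one_sided_power (the (mat_inverse (sub_cols \<Xi> \<alpha>)) *\<^sub>v of_cart x) (\<mu> \<alpha> - ones CARD('s))"

lemma of_cart_carrier: "of_cart (x :: real ^ 's :: {finite, linorder}) \<in> carrier_vec CARD('s)"
  by (simp add: of_cart_def)

lemma of_cart_diff:
  assumes "p \<in> carrier_vec CARD('s :: {finite, linorder})"
  shows "of_cart (x - to_cart p :: real ^ 's :: {finite, linorder}) = of_cart x - p"
  using assms by (intro eq_vecI) (auto simp: of_cart_def vec_nth_to_cart card_less_sorted_list_of_set_nth)

text \<open>
  The function is a polynomial in the coordinates times Heaviside factors; the polynomial is the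
  continuous bound, which gives local integrability.
\<close>

lemma trunc_power_measurable_dominated:
  assumes B: "the (mat_inverse (sub_cols \<Xi> \<alpha>)) \<in> carrier_mat CARD('s :: {finite, linorder}) CARD('s)"
  shows "(trunc_power \<Xi> \<alpha> :: real ^ 's :: {finite, linorder} \<Rightarrow> real) \<in> borel_measurable borel"
    and "\<exists>Q. continuous_on UNIV Q \<and> (\<forall>x. \<bar>trunc_power \<Xi> \<alpha> (x :: real ^ 's :: {finite, linorder})\<bar> \<le> \<bar>Q x\<bar>)"
proof -
  define C where "C = the (mat_inverse (sub_cols \<Xi> \<alpha>))"
  define \<beta> where "\<beta> = \<mu> \<alpha> - ones CARD('s)"
  define y where "y j x = (C *\<^sub>v of_cart x) $ j" for j and x :: "real ^ 's :: {finite, linorder}"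
  have C: "C \<in> carrier_mat CARD('s) CARD('s)" using B C_def by simp
  have cont: "continuous_on UNIV (y j)" if j: "j < CARD('s)" for j
  proof -
    have "y j = (\<lambda>x. \<Sum>i<CARD('s). C $$ (j, i) * vec_nth x (sorted_list_of_set UNIV ! i))"
    proof
      fix x :: "real ^ 's :: {finite, linorder}"
      have "y j x = (\<Sum>i<CARD('s). C $$ (j, i) * of_cart x $ i)"
        using mult_mat_vec_index[of j C "of_cart x"] C j of_cart_carrier[of x] by (simp add: y_def)
      then show "y j x = (\<Sum>i<CARD('s). C $$ (j, i) * vec_nth x (sorted_list_of_set UNIV ! i))"
        by (simp add: of_cart_def)
    qed
    then show ?thesis by (simp only:) (intro continuous_intros)
  qed
  have eq: "trunc_power \<Xi> \<alpha> x = (\<Prod>j<CARD('s). y j x ^ (\<beta> $ j) * heaviside (y j x) / fact (\<beta> $ j))" for x :: "real ^ 's :: {finite, linorder}"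
    using C unfolding trunc_power_def one_sided_power_def C_def[symmetric] \<beta>_def[symmetric] y_def by simp
  have hm: "heaviside \<in> borel_measurable borel" unfolding heaviside_def[abs_def] by measurable
  have ym: "y j \<in> borel_measurable borel" if "j < CARD('s)" for j
    by (rule borel_measurable_continuous_onI[OF cont[OF that]])
  show "(trunc_power \<Xi> \<alpha> :: real ^ 's :: {finite, linorder} \<Rightarrow> real) \<in> borel_measurable borel"
    unfolding eq[abs_def]
    by (intro borel_measurable_prod borel_measurable_divide borel_measurable_times borel_measurable_power
        borel_measurable_const measurable_compose[OF _ hm] ym) simp_all
  define Q where "Q x = (\<Prod>j<CARD('s). y j x ^ (\<beta> $ j) / fact (\<beta> $ j))" for x
  have "continuous_on UNIV Q"
    unfolding Q_def[abs_def] by (intro continuous_on_prod continuous_on_divide continuous_on_power cont continuous_on_const) simp_all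
  moreover have "\<bar>trunc_power \<Xi> \<alpha> x\<bar> \<le> \<bar>Q x\<bar>" for x
    unfolding eq Q_def abs_prod by (intro prod_mono) (simp add: abs_mult heaviside_def)
  ultimately show "\<exists>Q. continuous_on UNIV Q \<and> (\<forall>x. \<bar>trunc_power \<Xi> \<alpha> (x :: real ^ 's :: {finite, linorder})\<bar> \<le> \<bar>Q x\<bar>)"
    by blast
qed

lemma mat_inverse_det:
  fixes B :: "real mat"
  assumes B: "B \<in> carrier_mat s s" and d: "det B \<noteq> 0"
  shows "the (mat_inverse B) \<in> carrier_mat s s" "the (mat_inverse B) * B = 1\<^sub>m s"
proof -
  have "B \<in> Units (ring_mat TYPE(real) s ())" by (rule det_non_zero_imp_unit[OF B d])
  then obtain C where "mat_inverse B = Some C" using mat_inverse(1)[OF B, of "()"] by fastforce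
  then show "the (mat_inverse B) \<in> carrier_mat s s" "the (mat_inverse B) * B = 1\<^sub>m s"
    using mat_inverse(2)[OF B, of C] by auto
qed

text \<open>
  On the cone parametrization, applying the inverse matrix recovers the parameters, so the density in
  \<open>cone_pairing\<close> is \<open>trunc_power\<close> evaluated at the point \<open>\<Sum>\<^sub>i t\<^sub>i \<xi>\<^sub>i\<close>. The inverse matrix is a proper one because the
  supporting columns are independent.
\<close>

lemma cone_pairing_eq_integral:
  fixes \<phi> :: "real ^ 's :: {finite, linorder} \<Rightarrow> real"
  assumes X: "\<Xi> \<in> carrier_mat CARD('s) n" and \<alpha>: "dim_vec \<alpha> = n" "card (supp \<alpha>) = CARD('s)"
    and ind: "lin_indep_family (column \<Xi> :: nat \<Rightarrow> real ^ 's :: {finite, linorder}) (supp \<alpha>)" and \<phi>: "test_function \<phi>"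
  shows "the (mat_inverse (sub_cols \<Xi> \<alpha>)) \<in> carrier_mat CARD('s) CARD('s)"
    and "cone_pairing (column \<Xi>) (entries \<alpha>) \<phi> =
    (\<integral>x. trunc_power \<Xi> \<alpha> x * \<phi> x / \<bar>det (sub_cols \<Xi> \<alpha>)\<bar> \<partial>lborel)"
proof -
  define A where "A = supp \<alpha>"
  define B where "B = sub_cols \<Xi> \<alpha>"
  define C where "C = the (mat_inverse B)"
  have A: "A \<subseteq> {..<n}" "card A = CARD('s)" "finite A" using \<alpha> by (auto simp: A_def supp_def)
  have Bs: "B = submatrix \<Xi> UNIV A" by (simp add: B_def A_def sub_cols_def)
  note sc = submatrix_columns[OF X A(1), folded Bs, unfolded A(2)]
  note bp = bij_betw_pick[OF A(3), unfolded A(2)]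
  have d: "det B \<noteq> 0" unfolding Bs by (rule det_submatrix_columns_nonzero[OF X A(1,2) ind[folded A_def]])
  have C: "C \<in> carrier_mat CARD('s) CARD('s)" "C * B = 1\<^sub>m CARD('s)"
    unfolding C_def by (rule mat_inverse_det[OF sc(1) d])+
  then show Cc: "the (mat_inverse (sub_cols \<Xi> \<alpha>)) \<in> carrier_mat CARD('s) CARD('s)" by (simp add: C_def B_def)
  have key: "(\<Prod>i\<in>A. tpow (entries \<alpha> i) (t i)) = trunc_power \<Xi> \<alpha> (\<Sum>i\<in>A. t i *\<^sub>R column \<Xi> i :: real ^ 's :: {finite, linorder})" for t
  proof -
    define w where "w = Matrix.vec CARD('s) (\<lambda>k. t (pick A k))"
    have wc: "w \<in> carrier_vec CARD('s)" by (simp add: w_def)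
    have "(\<Sum>i\<in>A. t i *\<^sub>R column \<Xi> i :: real ^ 's :: {finite, linorder}) = (\<Sum>k\<in>{0..<CARD('s)}. t (pick A k) *\<^sub>R column \<Xi> (pick A k))"
      by (rule sum.reindex_bij_betw[OF bp, symmetric])
    also have "\<dots> = (\<Sum>k<CARD('s). w $ k *\<^sub>R to_cart (col B k))"
      by (rule sum.cong) (auto simp: w_def column_def sc(3))
    also have "\<dots> = to_cart (B *\<^sub>v w)" by (rule to_cart_mult[OF sc(1) wc, symmetric])
    finally have T: "(\<Sum>i\<in>A. t i *\<^sub>R column \<Xi> i :: real ^ 's :: {finite, linorder}) = to_cart (B *\<^sub>v w)" .
    have "of_cart (to_cart (B *\<^sub>v w) :: real ^ 's :: {finite, linorder}) = B *\<^sub>v w"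
      by (rule of_cart_to_cart) (use sc(1) wc in simp)
    moreover have "C *\<^sub>v (B *\<^sub>v w) = w"
      using assoc_mult_mat_vec[OF C(1) sc(1) wc] C(2) wc by simp
    ultimately have "trunc_power \<Xi> \<alpha> (to_cart (B *\<^sub>v w) :: real ^ 's :: {finite, linorder}) = one_sided_power w (\<mu> \<alpha> - ones CARD('s))"
      by (simp add: trunc_power_def C_def B_def)
    also have "\<dots> = (\<Prod>k\<in>{0..<CARD('s)}. tpow (entries \<alpha> (pick A k)) (t (pick A k)))"
      unfolding one_sided_power_def
    proof (rule prod.cong)
      show "{..<dim_vec w} = {0..<CARD('s)}" by (auto simp: w_def)
      fix k assume k: "k \<in> {0..<CARD('s)}"
      then have "pick A k \<in> A" using pick_in_set_le[of k A] A(2) by simp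
      then have e: "entries \<alpha> (pick A k) = \<alpha> $ pick A k" by (simp add: entries_def A_def supp_def)
      have b: "(\<mu> \<alpha> - ones CARD('s)) $ k = \<alpha> $ pick A k - 1"
        using k mu_index[of k \<alpha>] \<alpha>(2) by (simp add: ones_def A_def)
      show "w $ k ^ ((\<mu> \<alpha> - ones CARD('s)) $ k) * heaviside (w $ k) / fact ((\<mu> \<alpha> - ones CARD('s)) $ k) =
          tpow (entries \<alpha> (pick A k)) (t (pick A k))"
        unfolding b e using k by (simp add: w_def tpow_def heaviside_def)
    qed
    also have "\<dots> = (\<Prod>i\<in>A. tpow (entries \<alpha> i) (t i))" by (rule prod.reindex_bij_betw[OF bp])
    finally show ?thesis using T by simp
  qed
  have "{i. entries \<alpha> i \<noteq> 0} = A" by (auto simp: entries_def A_def supp_def)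
  then have "cone_pairing (column \<Xi>) (entries \<alpha>) \<phi> =
      (\<integral>t. trunc_power \<Xi> \<alpha> (\<Sum>i\<in>A. t i *\<^sub>R column \<Xi> i :: real ^ 's :: {finite, linorder}) * \<phi> (\<Sum>i\<in>A. t i *\<^sub>R column \<Xi> i) \<partial>(\<Pi>\<^sub>M i\<in>A. lborel))"
    by (simp add: cone_pairing_def cone_integral_def key)
  also have "\<dots> = (\<integral>x. trunc_power \<Xi> \<alpha> x * \<phi> x / \<bar>det B\<bar> \<partial>lborel)"
    unfolding Bs
    by (rule integral_over_cone_coordinates[OF X A(1,2), where h = "\<lambda>x. trunc_power \<Xi> \<alpha> x * \<phi> x"])
       (use d Bs trunc_power_measurable_dominated(1)[OF Cc] test_function_measurable[OF \<phi>] in auto)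
  finally show "cone_pairing (column \<Xi>) (entries \<alpha>) \<phi> =
    (\<integral>x. trunc_power \<Xi> \<alpha> x * \<phi> x / \<bar>det (sub_cols \<Xi> \<alpha>)\<bar> \<partial>lborel)" by (simp add: B_def)
qed

text \<open>
  Apply \<open>truncated_powers_fundamental_solution\<close> to the average of \<open>\<phi>\<close> along all the columns. Its
  value at 0 is the box spline, its derivative along all the columns is the sum over \<open>S\<close> of translates of
  \<open>\<phi>\<close>, and translation invariance moves the translation to the truncated powers.
\<close>

theorem theorem4p13:
  fixes \<Xi> :: "real mat" and n :: nat and ker :: "real mat \<Rightarrow> real mat"
  assumes carrier: "\<Xi> \<in> carrier_mat CARD('s) n"
    and rank: "vec_space.rank CARD('s) \<Xi> = CARD('s)"
    and nonzero: "\<forall>j<n. col \<Xi> j \<noteq> 0\<^sub>v CARD('s)"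
    and ker: "\<forall>X. kernel_matrix X (ker X)"
  shows "eq_regular_distribution
    (box_spline \<Xi> :: (real ^ 's :: {finite, linorder} \<Rightarrow> real) \<Rightarrow> real)
    (\<lambda>x. \<Sum>(b, p)\<in>#S_mset \<Xi>. \<Sum>(c, \<alpha>)\<in>#P_mset ker \<Xi> (n - CARD('s)).
      b * c / \<bar>det (sub_cols \<Xi> \<alpha>)\<bar> *
      one_sided_power (the (mat_inverse (sub_cols \<Xi> \<alpha>)) *\<^sub>v (of_cart x - p))
        (\<mu> \<alpha> - ones CARD('s)))"
proof -
  let ?\<xi> = "column \<Xi> :: nat \<Rightarrow> real ^ 's :: {finite, linorder}"
  define P where "P = P_mset ker \<Xi> (n - CARD('s))"
  define S where "S = S_mset \<Xi>"
  have nz: "\<forall>j<n. ?\<xi> j \<noteq> 0"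
    using nonzero to_cart_eq_zero_iff[where 's='s] carrier by (auto simp: column_def)
  have Z: "set (cols \<Xi>) \<subseteq> carrier_vec CARD('s)" using cols_dim[of \<Xi>] carrier by auto
  have Sc: "p \<in> carrier_vec CARD('s)" if "(b, p) \<in># S" for b p
    using that S_cols_carrier[OF Z] carrier by (simp add: S_def S_mset_def)
  note F = truncated_powers_fundamental_solution[OF carrier ker nz span_columns_full_rank[OF carrier rank], folded P_def]
  define G where "G b p c \<alpha> x = b * c / \<bar>det (sub_cols \<Xi> \<alpha>)\<bar> * trunc_power \<Xi> \<alpha> (x - to_cart p)"
    for b p c \<alpha> and x :: "real ^ 's :: {finite, linorder}"
  define g where "g x = (\<Sum>(b, p)\<in>#S. \<Sum>(c, \<alpha>)\<in>#P. G b p c \<alpha> x)" for x :: "real ^ 's :: {finite, linorder}"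
  have inv: "the (mat_inverse (sub_cols \<Xi> \<alpha>)) \<in> carrier_mat CARD('s) CARD('s)"
    and pairing: "\<And>\<phi>. test_function \<phi> \<Longrightarrow> cone_pairing ?\<xi> (entries \<alpha>) \<phi> =
      (\<integral>x. trunc_power \<Xi> \<alpha> x * \<phi> x / \<bar>det (sub_cols \<Xi> \<alpha>)\<bar> \<partial>lborel)" if "(c, \<alpha>) \<in># P" for c \<alpha>
  proof -
    note p = F(1)[OF that]
    have zero: "test_function (\<lambda>x :: real ^ 's :: {finite, linorder}. 0)"
      by (simp add: test_function_iff Ck_zero)
    show "the (mat_inverse (sub_cols \<Xi> \<alpha>)) \<in> carrier_mat CARD('s) CARD('s)"
      using cone_pairing_eq_integral(1)[OF carrier _ _ _ zero] p by blast
    show "cone_pairing ?\<xi> (entries \<alpha>) \<phi> =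
      (\<integral>x. trunc_power \<Xi> \<alpha> x * \<phi> x / \<bar>det (sub_cols \<Xi> \<alpha>)\<bar> \<partial>lborel)" if "test_function \<phi>" for \<phi>
      using cone_pairing_eq_integral(2)[OF carrier _ _ _ that] p by blast
  qed
  have liG: "locally_integrable (G b p c \<alpha>)" if "(c, \<alpha>) \<in># P" for b p c \<alpha>
  proof -
    note m = trunc_power_measurable_dominated[OF inv[OF that]]
    obtain Q where Q: "continuous_on UNIV Q" "\<And>x :: real ^ 's :: {finite, linorder}. \<bar>trunc_power \<Xi> \<alpha> x\<bar> \<le> \<bar>Q x\<bar>"
      using m(2) by blast
    have shift: "continuous_on UNIV (\<lambda>x :: real ^ 's :: {finite, linorder}. x - to_cart p)"
      by (intro continuous_intros)
    have "locally_integrable (\<lambda>x :: real ^ 's :: {finite, linorder}. trunc_power \<Xi> \<alpha> (x - to_cart p))"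
    proof (rule locally_integrable_dominated[of _ "\<lambda>x. Q (x - to_cart p)"])
      show "(\<lambda>x :: real ^ 's :: {finite, linorder}. trunc_power \<Xi> \<alpha> (x - to_cart p)) \<in> borel_measurable borel"
        by (rule measurable_compose[OF borel_measurable_continuous_onI[OF shift] m(1)])
      show "continuous_on UNIV (\<lambda>x. Q (x - to_cart p))"
        by (rule continuous_on_along[OF Q(1) shift])
    qed (rule Q(2))
    then show ?thesis unfolding G_def[abs_def] by (rule locally_integrable_cmult)
  qed
  \<comment> \<open>\<open>g\<close> is the function of the theorem, with the translation taken on points instead of coordinate vectors.\<close>
  have goal: "(\<Sum>(b, p)\<in>#S_mset \<Xi>. \<Sum>(c, \<alpha>)\<in>#P_mset ker \<Xi> (n - CARD('s)).
      b * c / \<bar>det (sub_cols \<Xi> \<alpha>)\<bar> *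
      one_sided_power (the (mat_inverse (sub_cols \<Xi> \<alpha>)) *\<^sub>v (of_cart x - p)) (\<mu> \<alpha> - ones CARD('s))) = g x"
    for x :: "real ^ 's :: {finite, linorder}"
    unfolding g_def S_def[symmetric] P_def[symmetric]
  proof (rule arg_cong[where f = sum_mset], rule image_mset_cong)
    fix q assume q: "q \<in># S"
    obtain b p where bp: "q = (b, p)" by (cases q)
    have "p \<in> carrier_vec CARD('s)" using Sc q bp by simp
    from of_cart_diff[OF this, of x] bp
    show "(case q of (b, p) \<Rightarrow> \<Sum>(c, \<alpha>)\<in>#P. b * c / \<bar>det (sub_cols \<Xi> \<alpha>)\<bar> *
        one_sided_power (the (mat_inverse (sub_cols \<Xi> \<alpha>)) *\<^sub>v (of_cart x - p)) (\<mu> \<alpha> - ones CARD('s))) =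
      (case q of (b, p) \<Rightarrow> \<Sum>(c, \<alpha>)\<in>#P. G b p c \<alpha> x)"
      by (simp add: G_def trunc_power_def)
  qed
  have "locally_integrable g"
    unfolding g_def[abs_def] case_prod_beta'
    by (intro locally_integrable_sum_mset liG) simp
  moreover have "box_spline \<Xi> \<phi> = (\<integral>x. g x * \<phi> x \<partial>lborel)" if \<phi>: "test_function \<phi>" for \<phi>
  proof -
    let ?\<psi> = "segment_avgs to_cart (cols \<Xi>) \<phi>"
    have \<psi>: "test_function ?\<psi>" by (rule test_function_segment_avgs[OF \<phi>])
    have colsX: "cols \<Xi> = map (col \<Xi>) [0..<n]" using carrier by (simp add: cols_def)
    have "dir_derivs ?\<xi> [0..<n] ?\<psi> = dir_derivs to_cart (cols \<Xi>) ?\<psi>"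
      unfolding colsX by (simp add: dir_derivs_def foldr_map o_def column_def)
    also have "\<dots> = (\<lambda>x. \<Sum>q\<in>#S. fst q * \<phi> (x + to_cart (snd q)))"
      using dir_derivs_segment_avgs_differences[OF \<phi> Z] carrier by (simp add: S_def S_mset_def case_prod_beta' fun_eq_iff)
    finally have D: "dir_derivs ?\<xi> [0..<n] ?\<psi> = (\<lambda>x. \<Sum>q\<in>#S. fst q * \<phi> (x + to_cart (snd q)))" .
    have shifted: "b * (c * cone_pairing ?\<xi> (entries \<alpha>) (\<lambda>x. \<phi> (x + to_cart p))) = (\<integral>x. G b p c \<alpha> x * \<phi> x \<partial>lborel)"
      if "(c, \<alpha>) \<in># P" for b p c \<alpha>
    proof -
      have m: "(\<lambda>x. G b p c \<alpha> x * \<phi> x) \<in> borel_measurable borel"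
        using borel_measurable_integrable[OF locally_integrable_times_test[OF liG[OF that] \<phi>]] by simp
      have "(\<integral>x. G b p c \<alpha> x * \<phi> x \<partial>lborel) = (\<integral>x. G b p c \<alpha> (x + to_cart p) * \<phi> (x + to_cart p) \<partial>lborel)"
        by (rule integral_translate[OF m, symmetric])
      also have "\<dots> = (\<integral>x. (b * c) * (trunc_power \<Xi> \<alpha> x * \<phi> (x + to_cart p) / \<bar>det (sub_cols \<Xi> \<alpha>)\<bar>) \<partial>lborel)"
        by (rule Bochner_Integration.integral_cong[OF refl]) (simp add: G_def)
      also have "\<dots> = b * c * cone_pairing ?\<xi> (entries \<alpha>) (\<lambda>x. \<phi> (x + to_cart p))"
        unfolding pairing[OF that test_function_translate[OF \<phi>]] by (rule integral_mult_right_zero)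
      finally show ?thesis by simp
    qed
    have "box_spline \<Xi> \<phi> = ?\<psi> 0"
      using box_spline_cols_segment_avgs[of "cols \<Xi>" \<phi> 0] by (simp add: box_spline_def)
    also have "\<dots> = (\<Sum>r\<in>#P. fst r * cone_pairing ?\<xi> (entries (snd r)) (dir_derivs ?\<xi> [0..<n] ?\<psi>))"
      using F(2)[OF \<psi>] by (simp add: case_prod_beta')
    also have "\<dots> = (\<Sum>r\<in>#P. \<Sum>q\<in>#S. \<integral>x. G (fst q) (snd q) (fst r) (snd r) x * \<phi> x \<partial>lborel)"
    proof (rule arg_cong[where f = sum_mset], rule image_mset_cong)
      fix r assume r: "r \<in># P"
      then have r': "(fst r, snd r) \<in># P" by simp
      note p = F(1)[OF r']
      have e: "{i. entries (snd r) i \<noteq> 0} = supp (snd r)" by (auto simp: entries_def supp_def)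
      have "cone_pairing ?\<xi> (entries (snd r)) (dir_derivs ?\<xi> [0..<n] ?\<psi>) =
          (\<Sum>q\<in>#S. fst q * cone_pairing ?\<xi> (entries (snd r)) (\<lambda>x. \<phi> (x + to_cart (snd q))))"
        unfolding D by (rule cone_pairing_sum_mset) (use e p finite_supp test_function_translate[OF \<phi>] in auto)
      then have "fst r * cone_pairing ?\<xi> (entries (snd r)) (dir_derivs ?\<xi> [0..<n] ?\<psi>) =
          (\<Sum>q\<in>#S. fst q * (fst r * cone_pairing ?\<xi> (entries (snd r)) (\<lambda>x. \<phi> (x + to_cart (snd q)))))"
        by (simp only: sum_mset_mult_left mult.left_commute)
      then show "fst r * cone_pairing ?\<xi> (entries (snd r)) (dir_derivs ?\<xi> [0..<n] ?\<psi>) =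
          (\<Sum>q\<in>#S. \<integral>x. G (fst q) (snd q) (fst r) (snd r) x * \<phi> x \<partial>lborel)"
        by (simp only: shifted[OF r'])
    qed
    also have "\<dots> = (\<Sum>q\<in>#S. \<Sum>r\<in>#P. \<integral>x. G (fst q) (snd q) (fst r) (snd r) x * \<phi> x \<partial>lborel)"
      by (rule sum_mset.swap)
    also have "\<dots> = (\<Sum>q\<in>#S. \<integral>x. (\<Sum>r\<in>#P. G (fst q) (snd q) (fst r) (snd r) x * \<phi> x) \<partial>lborel)"
    proof (rule arg_cong[where f = sum_mset], rule image_mset_cong)
      fix q
      show "(\<Sum>r\<in>#P. \<integral>x. G (fst q) (snd q) (fst r) (snd r) x * \<phi> x \<partial>lborel) =
        (\<integral>x. (\<Sum>r\<in>#P. G (fst q) (snd q) (fst r) (snd r) x * \<phi> x) \<partial>lborel)"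
        by (rule integral_sum_mset[THEN conjunct2, symmetric])
           (rule locally_integrable_times_test[OF liG \<phi>], simp)
    qed
    also have "\<dots> = (\<integral>x. (\<Sum>q\<in>#S. \<Sum>r\<in>#P. G (fst q) (snd q) (fst r) (snd r) x * \<phi> x) \<partial>lborel)"
    proof (rule integral_sum_mset[THEN conjunct2, symmetric])
      fix q
      show "integrable lborel (\<lambda>x. \<Sum>r\<in>#P. G (fst q) (snd q) (fst r) (snd r) x * \<phi> x)"
        by (rule integral_sum_mset[THEN conjunct1])
           (rule locally_integrable_times_test[OF liG \<phi>], simp)
    qed
    also have "\<dots> = (\<integral>x. g x * \<phi> x \<partial>lborel)"
      by (simp add: g_def case_prod_beta' sum_mset_mult_right)
    finally show ?thesis .
  qed
  ultimately show ?thesis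
    unfolding eq_regular_distribution_def goal[abs_def] by blast
qed

end
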